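(* Let $(G,P,\theta)$ be an algebraic dynamical system such that for every foundation set $F$ for $P$ with $F\subset P^{(\mathrm{fin})}$ there exists an accurate foundation set $F_a$ for $P$ which refines $F$ and satisfies $F_a\subset P^{(\mathrm{fin})}$. Let $S=G\rtimes_\theta P$. Then $\mathcal{Q}(S)$ is the universal $C^*$-algebra generated by a unitary representation $\bar u$ of the group $G$ and a representation $\bar s$ of the semigroup $P$ by isometries subject to the relations: (A1) $\bar s_p\bar u_g=\bar u_{\theta_p(g)}\bar s_p$ for all $p\in P$, $g\in G$; (A2) for all $p,q\in P$, $g\in G$: $\bar s_p^*\bar u_g\bar s_q=\bar u_k\bar s_{p'}\bar s_{q'}^*\bar u_\ell^*$ if $pP\cap qP=rP$, $pp'=qq'=r$ and $g=\theta_p(k)\theta_q(\ell^{-1})$ for some $k,\ell\in G$, and $\bar s_p^*\bar u_g\bar s_q=0$ otherwise; (O) $1=\sum_{(g,p)\in F}\bar e_{g,p}$ for every elementary foundation set $F\in\mathfrak{F}_e(G,P,\theta)$, where $\bar e_{g,p}=\bar u_g\bar s_p\bar s_p^*\bar u_g^*$.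
   Context: All semigroups are countable, discrete and left cancellative. A semigroup is right LCM if the intersection of two principal right ideals is either empty or again a principal right ideal. An algebraic dynamical system $(G,P,\theta)$ is an action $\theta$ of a right LCM semigroup $P$ with identity by injective endomorphisms of a group $G$ (so $\theta_p\theta_q=\theta_{pq}$, $\theta_1=\mathrm{id}$) such that $pP\cap qP=rP$ implies $\theta_p(G)\cap\theta_q(G)=\theta_r(G)$ for all $p,q,r\in P$. $G\rtimes_\theta P$ is the set $G\times P$ with product $(g,p)(h,q)=(g\theta_p(h),pq)$; it is a right LCM semigroup with identity. $P^{(\mathrm{fin})}$ is the subsemigroup of those $p\in P$ for which $G/\theta_p(G)$ is finite. For a right LCM semigroup $T$ with identity: a finite subset $F\subset T$ is a foundation set for $T$ if for every $s\in T$ there is $t\in F$ with $sT\cap tT\neq\emptyset$. A foundation set $F$ is accurate if $sT\cap tT=\emptyset$ for all distinct $s,t\in F$. A set $F_a$ refines $F$ if every $f_a\in F_a$ lies in $fT$ for some $f\in F$. An elementary foundation set for $S$ is a finite set $F=\{(g_\ell^{(k)},p_\ell)\mid 1\leq\ell\leq m,\ 1\leq k\leq n_\ell\}\subset S$ such that $\{p_1,\dots,p_m\}\subset P^{(\mathrm{fin})}$ is an accurate foundation set for $P$, and for each $\ell$ the family $(g_\ell^{(k)})_{1\leq k\leq n_\ell}$ is a transversal for $G/\theta_{p_\ell}(G)$. The collection of these is $\mathfrak{F}_e(G,P,\theta)$. For a right LCM semigroup $S$ with identity, $\mathcal{J}(S)=\{sS\mid s\in S\}\cup\{\emptyset\}$,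 and $C^*(S)$ is the universal $C^*$-algebra generated by isometries $(v_s)_{s\in S}$ and projections $(e_X)_{X\in\mathcal{J}(S)}$ satisfying $v_sv_t=v_{st}$, $v_se_Xv_s^*=e_{sX}$, $e_S=1$, $e_\emptyset=0$, $e_Xe_Y=e_{X\cap Y}$ for all $s,t\in S$, $X,Y\in\mathcal{J}(S)$. The boundary quotient $\mathcal{Q}(S)$ is the quotient of $C^*(S)$ by the relations $\prod_{s\in F}(1-e_{sS})=0$ for every foundation set $F$ for $S$; the image of $v_s$ is $\bar v_s$. The generators are identified via $\bar u_g=\bar v_{(g,1)}$ and $\bar s_p=\bar v_{(1,p)}$. *)

theory Defs
  imports Complex_Main "HOL-Library.Countable_Set" "HOL-Algebra.QuotRing"
    "HOL-Algebra.Subrings" "HOL-Algebra.Module" "HOL-Algebra.Left_Coset"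
begin

section \<open>C*-algebras\<close>

record 'a star_alg = "(complex, 'a) module" +
  adj :: "'a \<Rightarrow> 'a"  (\<open>(_\<^sup>\<star>\<index>)\<close> [1000] 999)

record 'a cstar = "'a star_alg" +
  cnorm :: "'a \<Rightarrow> real"

text \<open>All algebras are unital over the complex numbers. The zero algebra is allowed.\<close>

locale star_algebra = ring A for A :: "('a, 'm) star_alg_scheme" (structure) +
  assumes smult_closed: "x \<in> carrier A \<Longrightarrow> c \<odot> x \<in> carrier A"
    and smult_l_distr: "x \<in> carrier A \<Longrightarrow> (c + d) \<odot> x = c \<odot> x \<oplus> d \<odot> x"
    and smult_r_distr: "x \<in> carrier A \<Longrightarrow> y \<in> carrier A \<Longrightarrow> c \<odot> (x \<oplus> y) = c \<odot> x \<oplus> c \<odot> y"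
    and smult_assoc: "x \<in> carrier A \<Longrightarrow> (c * d) \<odot> x = c \<odot> (d \<odot> x)"
    and smult_one: "x \<in> carrier A \<Longrightarrow> 1 \<odot> x = x"
    and smult_mult_left: "x \<in> carrier A \<Longrightarrow> y \<in> carrier A \<Longrightarrow> (c \<odot> x) \<otimes> y = c \<odot> (x \<otimes> y)"
    and smult_mult_right: "x \<in> carrier A \<Longrightarrow> y \<in> carrier A \<Longrightarrow> x \<otimes> (c \<odot> y) = c \<odot> (x \<otimes> y)"
    and adj_closed: "x \<in> carrier A \<Longrightarrow> x\<^sup>\<star> \<in> carrier A"
    and adj_add: "x \<in> carrier A \<Longrightarrow> y \<in> carrier A \<Longrightarrow> (x \<oplus> y)\<^sup>\<star> = x\<^sup>\<star> \<oplus> y\<^sup>\<star>"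
    and adj_smult: "x \<in> carrier A \<Longrightarrow> (c \<odot> x)\<^sup>\<star> = cnj c \<odot> x\<^sup>\<star>"
    and adj_mult: "x \<in> carrier A \<Longrightarrow> y \<in> carrier A \<Longrightarrow> (x \<otimes> y)\<^sup>\<star> = y\<^sup>\<star> \<otimes> x\<^sup>\<star>"
    and adj_adj: "x \<in> carrier A \<Longrightarrow> (x\<^sup>\<star>)\<^sup>\<star> = x"

definition cstar_seminorm :: "('a, 'm) star_alg_scheme \<Rightarrow> ('a \<Rightarrow> real) \<Rightarrow> bool" where
  "cstar_seminorm A p \<longleftrightarrow>
    (\<forall>x\<in>carrier A. 0 \<le> p x) \<and>
    (\<forall>x\<in>carrier A. \<forall>y\<in>carrier A. p (x \<oplus>\<^bsub>A\<^esub> y) \<le> p x + p y) \<and>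
    (\<forall>c. \<forall>x\<in>carrier A. p (c \<odot>\<^bsub>A\<^esub> x) = cmod c * p x) \<and>
    (\<forall>x\<in>carrier A. \<forall>y\<in>carrier A. p (x \<otimes>\<^bsub>A\<^esub> y) \<le> p x * p y) \<and>
    (\<forall>x\<in>carrier A. p (x\<^sup>\<star>\<^bsub>A\<^esub> \<otimes>\<^bsub>A\<^esub> x) = (p x)\<^sup>2)"

definition cauchy_seqs :: "('a, 'm) star_alg_scheme \<Rightarrow> ('a \<Rightarrow> real) \<Rightarrow> (nat \<Rightarrow> 'a) set" where
  "cauchy_seqs A p = {f. (\<forall>n. f n \<in> carrier A) \<and>
     (\<forall>e>0. \<exists>N. \<forall>m\<ge>N. \<forall>n\<ge>N. p (f m \<ominus>\<^bsub>A\<^esub> f n) < e)}"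

definition converges_to :: "('a, 'm) cstar_scheme \<Rightarrow> (nat \<Rightarrow> 'a) \<Rightarrow> 'a \<Rightarrow> bool" where
  "converges_to A f x \<longleftrightarrow> (\<lambda>n. cnorm A (f n \<ominus>\<^bsub>A\<^esub> x)) \<longlonglongrightarrow> 0"

locale cstar_algebra = star_algebra A for A :: "('a, 'm) cstar_scheme" (structure) +
  assumes cstar_norm: "cstar_seminorm A (cnorm A)"
    and cnorm_definite: "x \<in> carrier A \<Longrightarrow> cnorm A x = 0 \<Longrightarrow> x = \<zero>"
    and complete: "f \<in> cauchy_seqs A (cnorm A) \<Longrightarrow> \<exists>x\<in>carrier A. converges_to A f x"

definition star_hom :: "('a, 'm) star_alg_scheme \<Rightarrow> ('b, 'n) star_alg_scheme \<Rightarrow> ('a \<Rightarrow> 'b) set" where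
  "star_hom A B = {\<phi> \<in> ring_hom A B.
     (\<forall>c. \<forall>x\<in>carrier A. \<phi> (c \<odot>\<^bsub>A\<^esub> x) = c \<odot>\<^bsub>B\<^esub> \<phi> x) \<and>
     (\<forall>x\<in>carrier A. \<phi> (x\<^sup>\<star>\<^bsub>A\<^esub>) = (\<phi> x)\<^sup>\<star>\<^bsub>B\<^esub>)}"

definition norm_closed :: "('a, 'm) cstar_scheme \<Rightarrow> 'a set \<Rightarrow> bool" where
  "norm_closed A C \<longleftrightarrow>
    (\<forall>f x. (\<forall>n. f n \<in> C) \<longrightarrow> x \<in> carrier A \<longrightarrow> converges_to A f x \<longrightarrow> x \<in> C)"

definition cstar_generated :: "('a, 'm) cstar_scheme \<Rightarrow> 'a set \<Rightarrow> 'a set" where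
  "cstar_generated A X = \<Inter>{C. subring C A \<and>
     (\<forall>c. \<forall>x\<in>C. c \<odot>\<^bsub>A\<^esub> x \<in> C) \<and> (\<forall>x\<in>C. x\<^sup>\<star>\<^bsub>A\<^esub> \<in> C) \<and> norm_closed A C \<and> X \<subseteq> C}"

definition closed_ideal :: "('a, 'm) cstar_scheme \<Rightarrow> 'a set \<Rightarrow> 'a set" where
  "closed_ideal A X = \<Inter>{I. ideal I A \<and> norm_closed A I \<and> X \<subseteq> I}"

text \<open>Quotient of a *-algebra with seminorm \<open>p\<close> by a *-ideal, with the quotient seminorm.\<close>

definition star_quot :: "('a, 'm) star_alg_scheme \<Rightarrow> ('a \<Rightarrow> real) \<Rightarrow> 'a set \<Rightarrow> 'a set cstar" where
  "star_quot A p I =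
    \<lparr>carrier = carrier (A Quot I), mult = mult (A Quot I), one = one (A Quot I),
     zero = zero (A Quot I), add = add (A Quot I),
     smult = (\<lambda>c X. \<Union>x\<in>X. I +>\<^bsub>A\<^esub> (c \<odot>\<^bsub>A\<^esub> x)),
     adj = (\<lambda>X. \<Union>x\<in>X. I +>\<^bsub>A\<^esub> (x\<^sup>\<star>\<^bsub>A\<^esub>)),
     cnorm = (\<lambda>X. INF x\<in>X. p x)\<rparr>"


section \<open>Universal C*-algebras\<close>

text \<open>The free unital *-algebra on \<open>I\<close>: noncommutative polynomials, i.e. finitely supported
  functions on words in the letters \<open>(i, False)\<close>, standing for the generator \<open>i\<close>, and
  \<open>(i, True)\<close>, standing for its adjoint.\<close>

type_synonym 'i free_elem = "('i \<times> bool) list \<Rightarrow> complex"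

definition free_star_alg :: "'i set \<Rightarrow> 'i free_elem star_alg" where
  "free_star_alg I =
    \<lparr>carrier = {f. finite {w. f w \<noteq> 0} \<and> (\<forall>w. f w \<noteq> 0 \<longrightarrow> fst ` set w \<subseteq> I)},
     mult = (\<lambda>f g w. \<Sum>k\<le>length w. f (take k w) * g (drop k w)),
     one = (\<lambda>w. if w = [] then 1 else 0),
     zero = (\<lambda>w. 0),
     add = (\<lambda>f g w. f w + g w),
     smult = (\<lambda>c f w. c * f w),
     adj = (\<lambda>f w. cnj (f (rev (map (\<lambda>(i, b). (i, \<not> b)) w))))\<rparr>"

definition letter :: "'i \<Rightarrow> 'i free_elem" where
  "letter i = (\<lambda>w. if w = [(i, False)] then 1 else 0)"

text \<open>The Hausdorff completion with respect to a C*-seminorm: Cauchy sequences modulo null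
  sequences.\<close>

definition cauchy_alg :: "('a, 'm) star_alg_scheme \<Rightarrow> ('a \<Rightarrow> real) \<Rightarrow> (nat \<Rightarrow> 'a) star_alg" where
  "cauchy_alg A p =
    \<lparr>carrier = cauchy_seqs A p,
     mult = (\<lambda>f g n. f n \<otimes>\<^bsub>A\<^esub> g n), one = (\<lambda>n. \<one>\<^bsub>A\<^esub>),
     zero = (\<lambda>n. \<zero>\<^bsub>A\<^esub>), add = (\<lambda>f g n. f n \<oplus>\<^bsub>A\<^esub> g n),
     smult = (\<lambda>c f n. c \<odot>\<^bsub>A\<^esub> f n), adj = (\<lambda>f n. (f n)\<^sup>\<star>\<^bsub>A\<^esub>)\<rparr>"

definition null_seqs :: "('a, 'm) star_alg_scheme \<Rightarrow> ('a \<Rightarrow> real) \<Rightarrow> (nat \<Rightarrow> 'a) set" where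
  "null_seqs A p = {f \<in> cauchy_seqs A p. (\<lambda>n. p (f n)) \<longlonglongrightarrow> 0}"

definition completion :: "('a, 'm) star_alg_scheme \<Rightarrow> ('a \<Rightarrow> real) \<Rightarrow> (nat \<Rightarrow> 'a) set cstar" where
  "completion A p = star_quot (cauchy_alg A p) (\<lambda>f. lim (\<lambda>n. p (f n))) (null_seqs A p)"

definition completion_emb :: "('a, 'm) star_alg_scheme \<Rightarrow> ('a \<Rightarrow> real) \<Rightarrow> 'a \<Rightarrow> (nat \<Rightarrow> 'a) set" where
  "completion_emb A p x = null_seqs A p +>\<^bsub>cauchy_alg A p\<^esub> (\<lambda>n. x)"

text \<open>The universal C*-algebra on generators \<open>I\<close> subject to relations \<open>r = 0\<close> for \<open>r \<in> R\<close> is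
  the completion of the free *-algebra with respect to the largest C*-seminorm vanishing on \<open>R\<close>.
  C*-seminorms vanishing on \<open>R\<close> correspond to the *-homomorphisms into C*-algebras that
  respect the relations. The supremum is meaningful only if the relations bound the norms of
  all generators, as they do when the generators are isometries and projections.\<close>

definition universal_seminorm :: "('a, 'm) star_alg_scheme \<Rightarrow> 'a set \<Rightarrow> 'a \<Rightarrow> real" where
  "universal_seminorm A R x = Sup {p x | p. cstar_seminorm A p \<and> (\<forall>r\<in>R. p r = 0)}"

type_synonym 'i univ_elem = "(nat \<Rightarrow> 'i free_elem) set"

definition universal_cstar :: "'i set \<Rightarrow> 'i free_elem set \<Rightarrow> 'i univ_elem cstar" where
  "universal_cstar I R =
    completion (free_star_alg I) (universal_seminorm (free_star_alg I) R)"

definition universal_gen :: "'i set \<Rightarrow> 'i free_elem set \<Rightarrow> 'i \<Rightarrow> 'i univ_elem" where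
  "universal_gen I R i =
    completion_emb (free_star_alg I) (universal_seminorm (free_star_alg I) R) (letter i)"


section \<open>Right LCM semigroups and foundation sets\<close>

abbreviation principal :: "('s, 'm) monoid_scheme \<Rightarrow> 's \<Rightarrow> 's set" where
  "principal T s \<equiv> s <#\<^bsub>T\<^esub> carrier T"

locale right_lcm = monoid T for T :: "('s, 'm) monoid_scheme" (structure) +
  assumes countable: "countable (carrier T)"
    and left_cancel: "\<lbrakk>s \<in> carrier T; x \<in> carrier T; y \<in> carrier T; s \<otimes> x = s \<otimes> y\<rbrakk> \<Longrightarrow> x = y"
    and lcm: "\<lbrakk>s \<in> carrier T; t \<in> carrier T\<rbrakk> \<Longrightarrow>
      principal T s \<inter> principal T t = {} \<or>
      (\<exists>r\<in>carrier T. principal T s \<inter> principal T t = principal T r)"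

definition foundation_set :: "('s, 'm) monoid_scheme \<Rightarrow> 's set \<Rightarrow> bool" where
  "foundation_set T F \<longleftrightarrow> finite F \<and> F \<subseteq> carrier T \<and>
    (\<forall>s\<in>carrier T. \<exists>t\<in>F. principal T s \<inter> principal T t \<noteq> {})"

definition accurate_foundation_set :: "('s, 'm) monoid_scheme \<Rightarrow> 's set \<Rightarrow> bool" where
  "accurate_foundation_set T F \<longleftrightarrow> foundation_set T F \<and>
    (\<forall>s\<in>F. \<forall>t\<in>F. s \<noteq> t \<longrightarrow> principal T s \<inter> principal T t = {})"

definition refines :: "('s, 'm) monoid_scheme \<Rightarrow> 's set \<Rightarrow> 's set \<Rightarrow> bool" where
  "refines T F' F \<longleftrightarrow> (\<forall>f'\<in>F'. \<exists>f\<in>F. f' \<in> principal T f)"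


section \<open>The C*-algebra of a right LCM semigroup and its boundary quotient\<close>

datatype 's lcm_gen = Isom 's | Proj "'s set"

definition constructible_ideals :: "('s, 'm) monoid_scheme \<Rightarrow> 's set set" where
  "constructible_ideals T = principal T ` carrier T \<union> {{}}"

definition lcm_gens :: "('s, 'm) monoid_scheme \<Rightarrow> 's lcm_gen set" where
  "lcm_gens T = Isom ` carrier T \<union> Proj ` constructible_ideals T"

definition lcm_rels :: "('s, 'm) monoid_scheme \<Rightarrow> 's lcm_gen free_elem set" where
  "lcm_rels T =
    (let A = free_star_alg (lcm_gens T); J = constructible_ideals T;
         v = (\<lambda>s. letter (Isom s)); e = (\<lambda>X. letter (Proj X)) in
      {(v s)\<^sup>\<star>\<^bsub>A\<^esub> \<otimes>\<^bsub>A\<^esub> v s \<ominus>\<^bsub>A\<^esub> \<one>\<^bsub>A\<^esub> | s. s \<in> carrier T}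
    \<union> {(e X)\<^sup>\<star>\<^bsub>A\<^esub> \<ominus>\<^bsub>A\<^esub> e X | X. X \<in> J}
    \<union> {e X \<otimes>\<^bsub>A\<^esub> e X \<ominus>\<^bsub>A\<^esub> e X | X. X \<in> J}
    \<union> {v s \<otimes>\<^bsub>A\<^esub> v t \<ominus>\<^bsub>A\<^esub> v (s \<otimes>\<^bsub>T\<^esub> t) | s t. s \<in> carrier T \<and> t \<in> carrier T}
    \<union> {v s \<otimes>\<^bsub>A\<^esub> e X \<otimes>\<^bsub>A\<^esub> (v s)\<^sup>\<star>\<^bsub>A\<^esub> \<ominus>\<^bsub>A\<^esub> e (s <#\<^bsub>T\<^esub> X) | s X. s \<in> carrier T \<and> X \<in> J}
    \<union> {e (carrier T) \<ominus>\<^bsub>A\<^esub> \<one>\<^bsub>A\<^esub>}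
    \<union> {e {}}
    \<union> {e X \<otimes>\<^bsub>A\<^esub> e Y \<ominus>\<^bsub>A\<^esub> e (X \<inter> Y) | X Y. X \<in> J \<and> Y \<in> J})"

definition lcm_cstar :: "('s, 'm) monoid_scheme \<Rightarrow> 's lcm_gen univ_elem cstar" where
  "lcm_cstar T = universal_cstar (lcm_gens T) (lcm_rels T)"

definition lcm_v :: "('s, 'm) monoid_scheme \<Rightarrow> 's \<Rightarrow> 's lcm_gen univ_elem" where
  "lcm_v T s = universal_gen (lcm_gens T) (lcm_rels T) (Isom s)"

definition lcm_e :: "('s, 'm) monoid_scheme \<Rightarrow> 's set \<Rightarrow> 's lcm_gen univ_elem" where
  "lcm_e T X = universal_gen (lcm_gens T) (lcm_rels T) (Proj X)"

text \<open>The products over foundation sets are taken along arbitrary enumerations, since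
  \<^const>\<open>finprod\<close> is meant for commutative monoids. The factors commute, so the enumeration
  does not matter.\<close>

definition boundary_rels :: "('s, 'm) monoid_scheme \<Rightarrow> 's lcm_gen univ_elem set" where
  "boundary_rels T =
    (let A = lcm_cstar T in
      {foldr (\<lambda>s a. (\<one>\<^bsub>A\<^esub> \<ominus>\<^bsub>A\<^esub> lcm_e T (principal T s)) \<otimes>\<^bsub>A\<^esub> a) xs \<one>\<^bsub>A\<^esub> | xs.
        distinct xs \<and> foundation_set T (set xs)})"

definition boundary_quotient :: "('s, 'm) monoid_scheme \<Rightarrow> 's lcm_gen univ_elem set cstar" where
  "boundary_quotient T =
    star_quot (lcm_cstar T) (cnorm (lcm_cstar T)) (closed_ideal (lcm_cstar T) (boundary_rels T))"

definition boundary_v :: "('s, 'm) monoid_scheme \<Rightarrow> 's \<Rightarrow> 's lcm_gen univ_elem set" where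
  "boundary_v T s = closed_ideal (lcm_cstar T) (boundary_rels T) +>\<^bsub>lcm_cstar T\<^esub> lcm_v T s"


section \<open>Algebraic dynamical systems\<close>

locale algebraic_dynamical_system =
  G: group G + P: right_lcm P
  for G :: "('g, 'm) monoid_scheme" and P :: "('p, 'n) monoid_scheme"
    and \<theta> :: "'p \<Rightarrow> 'g \<Rightarrow> 'g" +
  assumes countable_G: "countable (carrier G)"
    and endo: "p \<in> carrier P \<Longrightarrow> \<theta> p \<in> hom G G"
    and inj: "p \<in> carrier P \<Longrightarrow> inj_on (\<theta> p) (carrier G)"
    and action: "\<lbrakk>p \<in> carrier P; q \<in> carrier P; g \<in> carrier G\<rbrakk> \<Longrightarrow>
      \<theta> p (\<theta> q g) = \<theta> (p \<otimes>\<^bsub>P\<^esub> q) g"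
    and action_one: "g \<in> carrier G \<Longrightarrow> \<theta> \<one>\<^bsub>P\<^esub> g = g"
    and respects_order: "\<lbrakk>p \<in> carrier P; q \<in> carrier P; r \<in> carrier P;
      principal P p \<inter> principal P q = principal P r\<rbrakk> \<Longrightarrow>
      \<theta> p ` carrier G \<inter> \<theta> q ` carrier G = \<theta> r ` carrier G"

definition semidirect ::
  "('g, 'm) monoid_scheme \<Rightarrow> ('p, 'n) monoid_scheme \<Rightarrow> ('p \<Rightarrow> 'g \<Rightarrow> 'g) \<Rightarrow> ('g \<times> 'p) monoid" where
  "semidirect G P \<theta> =
    \<lparr>carrier = carrier G \<times> carrier P,
     mult = (\<lambda>(g, p) (h, q). (g \<otimes>\<^bsub>G\<^esub> \<theta> p h, p \<otimes>\<^bsub>P\<^esub> q)),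
     one = (\<one>\<^bsub>G\<^esub>, \<one>\<^bsub>P\<^esub>)\<rparr>"

definition P_fin ::
  "('g, 'm) monoid_scheme \<Rightarrow> ('p, 'n) monoid_scheme \<Rightarrow> ('p \<Rightarrow> 'g \<Rightarrow> 'g) \<Rightarrow> 'p set" where
  "P_fin G P \<theta> = {p \<in> carrier P. finite (lcosets\<^bsub>G\<^esub> (\<theta> p ` carrier G))}"

definition left_transversal :: "('g, 'm) monoid_scheme \<Rightarrow> 'g set \<Rightarrow> 'g set \<Rightarrow> bool" where
  "left_transversal G H X \<longleftrightarrow> X \<subseteq> carrier G \<and> (\<forall>C\<in>lcosets\<^bsub>G\<^esub> H. \<exists>!g. g \<in> X \<inter> C)"

text \<open>The elements \<open>p\<^sub>\<ell>\<close> of the defining family are read as pairwise distinct, so that the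
  transversal belonging to \<open>p\<close> is the fibre of \<open>F\<close> over \<open>p\<close>.\<close>

definition elementary_foundation_set ::
  "('g, 'm) monoid_scheme \<Rightarrow> ('p, 'n) monoid_scheme \<Rightarrow> ('p \<Rightarrow> 'g \<Rightarrow> 'g) \<Rightarrow> ('g \<times> 'p) set \<Rightarrow> bool" where
  "elementary_foundation_set G P \<theta> F \<longleftrightarrow>
    finite F \<and> F \<subseteq> carrier G \<times> carrier P \<and>
    snd ` F \<subseteq> P_fin G P \<theta> \<and> accurate_foundation_set P (snd ` F) \<and>
    (\<forall>p\<in>snd ` F. left_transversal G (\<theta> p ` carrier G) {g. (g, p) \<in> F})"

definition unitary_rep ::
  "('g, 'm) monoid_scheme \<Rightarrow> ('a, 'k) cstar_scheme \<Rightarrow> ('g \<Rightarrow> 'a) \<Rightarrow> bool" where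
  "unitary_rep G B u \<longleftrightarrow>
    (\<forall>g\<in>carrier G. u g \<in> carrier B \<and>
       (u g)\<^sup>\<star>\<^bsub>B\<^esub> \<otimes>\<^bsub>B\<^esub> u g = \<one>\<^bsub>B\<^esub> \<and> u g \<otimes>\<^bsub>B\<^esub> (u g)\<^sup>\<star>\<^bsub>B\<^esub> = \<one>\<^bsub>B\<^esub>) \<and>
    (\<forall>g\<in>carrier G. \<forall>h\<in>carrier G. u (g \<otimes>\<^bsub>G\<^esub> h) = u g \<otimes>\<^bsub>B\<^esub> u h)"

definition isometric_rep ::
  "('p, 'm) monoid_scheme \<Rightarrow> ('a, 'k) cstar_scheme \<Rightarrow> ('p \<Rightarrow> 'a) \<Rightarrow> bool" where
  "isometric_rep P B s \<longleftrightarrow>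
    (\<forall>p\<in>carrier P. s p \<in> carrier B \<and> (s p)\<^sup>\<star>\<^bsub>B\<^esub> \<otimes>\<^bsub>B\<^esub> s p = \<one>\<^bsub>B\<^esub>) \<and>
    (\<forall>p\<in>carrier P. \<forall>q\<in>carrier P. s (p \<otimes>\<^bsub>P\<^esub> q) = s p \<otimes>\<^bsub>B\<^esub> s q)"

definition rel_A1 ::
  "('g, 'm) monoid_scheme \<Rightarrow> ('p, 'n) monoid_scheme \<Rightarrow> ('p \<Rightarrow> 'g \<Rightarrow> 'g) \<Rightarrow>
   ('a, 'k) cstar_scheme \<Rightarrow> ('g \<Rightarrow> 'a) \<Rightarrow> ('p \<Rightarrow> 'a) \<Rightarrow> bool" where
  "rel_A1 G P \<theta> B u s \<longleftrightarrow>
    (\<forall>p\<in>carrier P. \<forall>g\<in>carrier G. s p \<otimes>\<^bsub>B\<^esub> u g = u (\<theta> p g) \<otimes>\<^bsub>B\<^esub> s p)"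

definition A2_case ::
  "('g, 'm) monoid_scheme \<Rightarrow> ('p, 'n) monoid_scheme \<Rightarrow> ('p \<Rightarrow> 'g \<Rightarrow> 'g) \<Rightarrow>
   'p \<Rightarrow> 'p \<Rightarrow> 'g \<Rightarrow> 'p \<Rightarrow> 'p \<Rightarrow> 'g \<Rightarrow> 'g \<Rightarrow> bool" where
  "A2_case G P \<theta> p q g p' q' k l \<longleftrightarrow>
    p' \<in> carrier P \<and> q' \<in> carrier P \<and> k \<in> carrier G \<and> l \<in> carrier G \<and>
    (\<exists>r\<in>carrier P. principal P p \<inter> principal P q = principal P r \<and>
       p \<otimes>\<^bsub>P\<^esub> p' = r \<and> q \<otimes>\<^bsub>P\<^esub> q' = r) \<and>
    g = \<theta> p k \<otimes>\<^bsub>G\<^esub> \<theta> q (inv\<^bsub>G\<^esub> l)"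

definition rel_A2 ::
  "('g, 'm) monoid_scheme \<Rightarrow> ('p, 'n) monoid_scheme \<Rightarrow> ('p \<Rightarrow> 'g \<Rightarrow> 'g) \<Rightarrow>
   ('a, 'k) cstar_scheme \<Rightarrow> ('g \<Rightarrow> 'a) \<Rightarrow> ('p \<Rightarrow> 'a) \<Rightarrow> bool" where
  "rel_A2 G P \<theta> B u s \<longleftrightarrow>
    (\<forall>p\<in>carrier P. \<forall>q\<in>carrier P. \<forall>g\<in>carrier G.
      (\<forall>p' q' k l. A2_case G P \<theta> p q g p' q' k l \<longrightarrow>
        (s p)\<^sup>\<star>\<^bsub>B\<^esub> \<otimes>\<^bsub>B\<^esub> u g \<otimes>\<^bsub>B\<^esub> s q
          = u k \<otimes>\<^bsub>B\<^esub> s p' \<otimes>\<^bsub>B\<^esub> (s q')\<^sup>\<star>\<^bsub>B\<^esub> \<otimes>\<^bsub>B\<^esub> (u l)\<^sup>\<star>\<^bsub>B\<^esub>) \<and>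
      ((\<nexists>p' q' k l. A2_case G P \<theta> p q g p' q' k l) \<longrightarrow>
        (s p)\<^sup>\<star>\<^bsub>B\<^esub> \<otimes>\<^bsub>B\<^esub> u g \<otimes>\<^bsub>B\<^esub> s q = \<zero>\<^bsub>B\<^esub>))"

definition range_proj ::
  "('a, 'k) cstar_scheme \<Rightarrow> ('g \<Rightarrow> 'a) \<Rightarrow> ('p \<Rightarrow> 'a) \<Rightarrow> 'g \<Rightarrow> 'p \<Rightarrow> 'a" where
  "range_proj B u s g p = u g \<otimes>\<^bsub>B\<^esub> s p \<otimes>\<^bsub>B\<^esub> (s p)\<^sup>\<star>\<^bsub>B\<^esub> \<otimes>\<^bsub>B\<^esub> (u g)\<^sup>\<star>\<^bsub>B\<^esub>"

definition rel_O ::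
  "('g, 'm) monoid_scheme \<Rightarrow> ('p, 'n) monoid_scheme \<Rightarrow> ('p \<Rightarrow> 'g \<Rightarrow> 'g) \<Rightarrow>
   ('a, 'k) cstar_scheme \<Rightarrow> ('g \<Rightarrow> 'a) \<Rightarrow> ('p \<Rightarrow> 'a) \<Rightarrow> bool" where
  "rel_O G P \<theta> B u s \<longleftrightarrow>
    (\<forall>F. elementary_foundation_set G P \<theta> F \<longrightarrow>
      \<one>\<^bsub>B\<^esub> = (\<Oplus>\<^bsub>B\<^esub>x\<in>F. range_proj B u s (fst x) (snd x)))"

definition A1_A2_O_rep ::
  "('g, 'm) monoid_scheme \<Rightarrow> ('p, 'n) monoid_scheme \<Rightarrow> ('p \<Rightarrow> 'g \<Rightarrow> 'g) \<Rightarrow>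
   ('a, 'k) cstar_scheme \<Rightarrow> ('g \<Rightarrow> 'a) \<Rightarrow> ('p \<Rightarrow> 'a) \<Rightarrow> bool" where
  "A1_A2_O_rep G P \<theta> B u s \<longleftrightarrow>
    unitary_rep G B u \<and> isometric_rep P B s \<and>
    rel_A1 G P \<theta> B u s \<and> rel_A2 G P \<theta> B u s \<and> rel_O G P \<theta> B u s"

end

theory Submission
  imports Defs
begin

text \<open>Two facts about C*-algebras carry the universal constructions. First, the quotient seminorm by a
  closed star ideal satisfies the C*-identity; instead of functional calculus, the approximate units
  are ergodic averages of powers of \<open>1 + i \<delta> y\<close>. Second, every C*-seminorm on a C*-algebra is
  bounded by its norm, since a self-adjoint element of norm less than 1 is the real part of a unitary;
  hence *-homomorphisms are continuous and determined by their values on generators.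

  In the boundary quotient, (A2) expresses \<open>v\<^sub>s\<^sup>* v\<^sub>t\<close> through a least common multiple, and (O) is the
  relation for elementary foundation sets, whose range projections are orthogonal. Conversely, let \<open>F\<close> be
  a foundation set for \<open>S\<close> and suppose (A1), (A2), (O). Since a group covered by finitely many cosets
  is covered by those of finite index, the members of \<open>F\<close> over \<open>P\<^sup>f\<^sup>i\<^sup>n\<close> already form a foundation set.
  Rather than refining \<open>F\<close> as a whole, the range projection of \<open>(h, m)\<close> is decomposed repeatedly by
  translates of (O), where the foundation sets for \<open>P\<close> consist of the cofactors of
  \<open>m\<close> in its least common multiples with the members of \<open>F\<close>.\<close>

section \<open>Star algebras and C*-seminorms\<close>

text \<open>The assumption on accurate refinements concerns \<open>P\<close> alone, and this is the
  obstacle. A member (g, p) of a foundation set F for \<open>S\<close> occupies a single coset of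
  theta_p(G). After the second coordinates of F have been refined by an accurate set, an element (h,
  q) with q in pP may still lie below no member of F, because the coset of h over p need not be
  represented in F. Such an element meets other members of F, and a further refinement has to reach
  its least common multiples with these. Each step makes the current element a multiple of one more
  second coordinate of F, and there are only finitely many of them. Finite index must be secured
  beforehand, since the assumption and the sums in (O) exist only over \<open>P_fin\<close>; hence
  the lemma on coset coverings. On the analytic side the universal algebra is a completion of
  polynomials, while ideals and generated subalgebras are defined through norm closures. Continuity
  of star homomorphisms is therefore needed twice: to factor through the boundary ideal and to
  obtain uniqueness.\<close>

context star_algebra
begin

declare smult_closed [simp] adj_closed [simp] adj_adj [simp] smult_one [simp]

lemma smult_zero_left [simp]: "x \<in> carrier A \<Longrightarrow> 0 \<odot> x = \<zero>"
  using smult_l_distr[of x 0 0] by (simp add: add.l_cancel_one')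

lemma smult_zero [simp]: "c \<odot> \<zero> = \<zero>"
  by (metis mult_zero_right smult_assoc smult_zero_left zero_closed)

lemma minus_eq_smult: "x \<in> carrier A \<Longrightarrow> \<ominus> x = (- 1) \<odot> x"
  using smult_l_distr[of x "- 1" 1] by (intro minus_equality) auto

lemma smult_minus: "x \<in> carrier A \<Longrightarrow> c \<odot> (\<ominus> x) = \<ominus> (c \<odot> x)"
  by (metis minus_eq_smult mult.commute smult_assoc smult_closed)

lemma smult_diff:
  "x \<in> carrier A \<Longrightarrow> y \<in> carrier A \<Longrightarrow> c \<odot> (x \<ominus> y) = c \<odot> x \<ominus> c \<odot> y"
  by (simp add: a_minus_def smult_r_distr smult_minus)

lemma adj_zero [simp]: "\<zero>\<^sup>\<star> = \<zero>"
  by (metis adj_closed adj_smult complex_cnj_zero smult_zero_left zero_closed)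

lemma adj_one [simp]: "\<one>\<^sup>\<star> = \<one>"
  by (metis adj_adj adj_closed adj_mult l_one one_closed r_one)

lemma adj_minus: "x \<in> carrier A \<Longrightarrow> (\<ominus> x)\<^sup>\<star> = \<ominus> x\<^sup>\<star>"
  by (simp add: minus_eq_smult adj_smult)

lemma adj_diff: "x \<in> carrier A \<Longrightarrow> y \<in> carrier A \<Longrightarrow> (x \<ominus> y)\<^sup>\<star> = x\<^sup>\<star> \<ominus> y\<^sup>\<star>"
  by (simp add: a_minus_def adj_add adj_minus)

lemma diff_self [simp]: "x \<in> carrier A \<Longrightarrow> x \<ominus> x = \<zero>"
  by (simp add: a_minus_def r_neg)

lemma diff_zero [simp]: "x \<in> carrier A \<Longrightarrow> x \<ominus> \<zero> = x"
  by (simp add: a_minus_def)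

lemma diff_eq_zero: "x \<in> carrier A \<Longrightarrow> y \<in> carrier A \<Longrightarrow> x \<ominus> y = \<zero> \<longleftrightarrow> x = y"
  by (metis a_minus_def diff_self r_right_minus_eq)

lemma diff_add_diff:
  "\<lbrakk>x \<in> carrier A; y \<in> carrier A; z \<in> carrier A\<rbrakk> \<Longrightarrow> (x \<ominus> y) \<oplus> (y \<ominus> z) = x \<ominus> z"
  unfolding a_minus_def
  by (metis (no_types, lifting) a_assoc a_inv_closed add.m_closed l_neg r_zero a_comm)

lemma l_diff_distr:
  "\<lbrakk>x \<in> carrier A; y \<in> carrier A; z \<in> carrier A\<rbrakk> \<Longrightarrow> (x \<ominus> y) \<otimes> z = x \<otimes> z \<ominus> y \<otimes> z"
  by (simp add: a_minus_def l_distr l_minus)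

lemma r_diff_distr:
  "\<lbrakk>x \<in> carrier A; y \<in> carrier A; z \<in> carrier A\<rbrakk> \<Longrightarrow> z \<otimes> (x \<ominus> y) = z \<otimes> x \<ominus> z \<otimes> y"
  by (simp add: a_minus_def r_distr r_minus)

text \<open>Multiplication by the scalar c is multiplication by the ring element
  \<open>c \<odot> \<one>\<close>, so ring ideals are automatically complex subspaces.\<close>

lemma ideal_smult: "ideal I A \<Longrightarrow> x \<in> I \<Longrightarrow> c \<odot> x \<in> I"
  using ideal.I_l_closed[of I A x "c \<odot> \<one>"] ideal.Icarr[of I A x] by (simp add: smult_mult_left)

end

lemma star_homD:
  assumes "\<phi> \<in> star_hom A B"
  shows "x \<in> carrier A \<Longrightarrow> \<phi> x \<in> carrier B"
    "x \<in> carrier A \<Longrightarrow> y \<in> carrier A \<Longrightarrow> \<phi> (x \<otimes>\<^bsub>A\<^esub> y) = \<phi> x \<otimes>\<^bsub>B\<^esub> \<phi> y"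
    "x \<in> carrier A \<Longrightarrow> y \<in> carrier A \<Longrightarrow> \<phi> (x \<oplus>\<^bsub>A\<^esub> y) = \<phi> x \<oplus>\<^bsub>B\<^esub> \<phi> y"
    "\<phi> \<one>\<^bsub>A\<^esub> = \<one>\<^bsub>B\<^esub>"
    "x \<in> carrier A \<Longrightarrow> \<phi> (c \<odot>\<^bsub>A\<^esub> x) = c \<odot>\<^bsub>B\<^esub> \<phi> x"
    "x \<in> carrier A \<Longrightarrow> \<phi> (x\<^sup>\<star>\<^bsub>A\<^esub>) = (\<phi> x)\<^sup>\<star>\<^bsub>B\<^esub>"
  using assms by (auto simp: star_hom_def ring_hom_def)

lemma star_hom_zero:
  assumes "\<phi> \<in> star_hom A B" "star_algebra A" "star_algebra B"
  shows "\<phi> \<zero>\<^bsub>A\<^esub> = \<zero>\<^bsub>B\<^esub>"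
  using assms by (auto simp: star_hom_def star_algebra_def intro: ring_hom_zero)

lemma star_hom_diff:
  assumes \<phi>: "\<phi> \<in> star_hom A B" and A: "star_algebra A" and B: "star_algebra B"
    and x: "x \<in> carrier A" and y: "y \<in> carrier A"
  shows "\<phi> (x \<ominus>\<^bsub>A\<^esub> y) = \<phi> x \<ominus>\<^bsub>B\<^esub> \<phi> y"
proof -
  interpret A: star_algebra A by fact
  interpret B: star_algebra B by fact
  show ?thesis
    using x y by (simp add: a_minus_def A.minus_eq_smult B.minus_eq_smult star_homD[OF \<phi>])
qed

lemma star_hom_comp:
  "\<phi> \<in> star_hom A B \<Longrightarrow> \<psi> \<in> star_hom B C \<Longrightarrow> \<psi> \<circ> \<phi> \<in> star_hom A C"
  by (auto simp: star_hom_def ring_hom_def Pi_iff)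

lemma star_hom_restrict:
  assumes "\<phi> \<in> star_hom A B" "star_algebra A"
  shows "restrict \<phi> (carrier A) \<in> star_hom A B"
proof -
  interpret star_algebra A by fact
  show ?thesis using assms(1) by (auto simp: star_hom_def ring_hom_def)
qed

text \<open>Apart from the existence of negatives all axioms are identities, and both kinds pass to
  the image of a surjection that respects the operations. It serves to recognise quotients as star
  algebras.\<close>

lemma star_algebra_image:
  fixes A :: "('a, 'm) star_alg_scheme" and B :: "('b, 'n) star_alg_scheme"
  assumes A: "star_algebra A" and q: "carrier B = q ` carrier A"
    and add: "\<And>x y. x \<in> carrier A \<Longrightarrow> y \<in> carrier A \<Longrightarrow> q x \<oplus>\<^bsub>B\<^esub> q y = q (x \<oplus>\<^bsub>A\<^esub> y)"
    and mult: "\<And>x y. x \<in> carrier A \<Longrightarrow> y \<in> carrier A \<Longrightarrow> q x \<otimes>\<^bsub>B\<^esub> q y = q (x \<otimes>\<^bsub>A\<^esub> y)"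
    and one: "\<one>\<^bsub>B\<^esub> = q \<one>\<^bsub>A\<^esub>" and zero: "\<zero>\<^bsub>B\<^esub> = q \<zero>\<^bsub>A\<^esub>"
    and smult: "\<And>c x. x \<in> carrier A \<Longrightarrow> c \<odot>\<^bsub>B\<^esub> q x = q (c \<odot>\<^bsub>A\<^esub> x)"
    and adj: "\<And>x. x \<in> carrier A \<Longrightarrow> (q x)\<^sup>\<star>\<^bsub>B\<^esub> = q (x\<^sup>\<star>\<^bsub>A\<^esub>)"
  shows "star_algebra B"
proof -
  interpret A: star_algebra A by fact
  have "\<exists>y\<in>carrier B. y \<oplus>\<^bsub>B\<^esub> x = \<zero>\<^bsub>B\<^esub>" if x: "x \<in> carrier B" for x
  proof -
    obtain a where a: "a \<in> carrier A" "x = q a" using x q by auto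
    then have "q (\<ominus>\<^bsub>A\<^esub> a) \<oplus>\<^bsub>B\<^esub> x = \<zero>\<^bsub>B\<^esub>" by (simp add: add zero A.l_neg)
    then show ?thesis using a q by (auto intro!: bexI[of _ "q (\<ominus>\<^bsub>A\<^esub> a)"])
  qed
  then have "ring B"
    by (intro ringI abelian_groupI monoidI)
      (auto simp: q add mult one zero A.a_assoc A.a_comm A.a_lcomm A.m_assoc A.l_distr A.r_distr)
  then show ?thesis
    by (intro star_algebra.intro star_algebra_axioms.intro)
      (auto simp: q add mult one zero smult adj A.smult_l_distr A.smult_r_distr A.smult_assoc
        A.smult_mult_left A.smult_mult_right A.adj_add A.adj_smult A.adj_mult)
qed

section \<open>Elementary inequalities for C*-seminorms\<close>

locale cstar_seminormed = star_algebra A for A :: "('a, 'm) star_alg_scheme" (structure) +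
  fixes p :: "'a \<Rightarrow> real"
  assumes seminorm: "cstar_seminorm A p"
begin

lemma p_nonneg [simp]: "x \<in> carrier A \<Longrightarrow> 0 \<le> p x"
  and p_triangle: "x \<in> carrier A \<Longrightarrow> y \<in> carrier A \<Longrightarrow> p (x \<oplus> y) \<le> p x + p y"
  and p_smult: "x \<in> carrier A \<Longrightarrow> p (c \<odot> x) = cmod c * p x"
  and p_mult: "x \<in> carrier A \<Longrightarrow> y \<in> carrier A \<Longrightarrow> p (x \<otimes> y) \<le> p x * p y"
  and p_cstar: "x \<in> carrier A \<Longrightarrow> p (x\<^sup>\<star> \<otimes> x) = (p x)\<^sup>2"
  using seminorm by (auto simp: cstar_seminorm_def)

lemma p_zero [simp]: "p \<zero> = 0"
  using p_smult[of \<zero> 0] by simp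

lemma p_minus [simp]: "x \<in> carrier A \<Longrightarrow> p (\<ominus> x) = p x"
  by (simp add: minus_eq_smult p_smult)

lemma p_diff_le: "x \<in> carrier A \<Longrightarrow> y \<in> carrier A \<Longrightarrow> p (x \<ominus> y) \<le> p x + p y"
  unfolding a_minus_def using p_triangle[of x "\<ominus> y"] by simp

lemma p_diff_commute: "x \<in> carrier A \<Longrightarrow> y \<in> carrier A \<Longrightarrow> p (x \<ominus> y) = p (y \<ominus> x)"
  by (metis a_inv_closed a_minus_def add.inv_mult_group add.m_closed minus_minus p_minus)

lemma p_diff_triangle:
  "\<lbrakk>x \<in> carrier A; y \<in> carrier A; z \<in> carrier A\<rbrakk> \<Longrightarrow> p (x \<ominus> z) \<le> p (x \<ominus> y) + p (y \<ominus> z)"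
  using p_triangle[of "x \<ominus> y" "y \<ominus> z"] by (simp add: diff_add_diff)

lemma p_le_diff: "x \<in> carrier A \<Longrightarrow> y \<in> carrier A \<Longrightarrow> p x \<le> p (x \<ominus> y) + p y"
  using p_diff_triangle[of x y \<zero>] by simp

lemma abs_p_diff: "x \<in> carrier A \<Longrightarrow> y \<in> carrier A \<Longrightarrow> \<bar>p x - p y\<bar> \<le> p (x \<ominus> y)"
  using p_le_diff[of x y] p_le_diff[of y x] p_diff_commute[of x y] by simp

lemma p_adj [simp]: assumes x: "x \<in> carrier A" shows "p (x\<^sup>\<star>) = p x"
proof -
  have *: "p y \<le> p (y\<^sup>\<star>)" if y: "y \<in> carrier A" for y
  proof (cases "p y = 0")
    case False
    have "p y * p y \<le> p (y\<^sup>\<star>) * p y"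
      using p_cstar[OF y] p_mult[of "y\<^sup>\<star>" y] y by (simp add: power2_eq_square)
    then show ?thesis using False p_nonneg[OF y] by simp
  qed (use y in simp)
  from *[of x] *[of "x\<^sup>\<star>"] x show ?thesis by simp
qed

text \<open>The C*-identity makes \<open>p \<one>\<close> an idempotent real number. The value 0
  does occur, for the zero seminorm, so only an inequality can be claimed.\<close>

lemma p_one_le: "p \<one> \<le> 1"
proof -
  have "p \<one> = p \<one> * p \<one>" using p_cstar[of \<one>] by (simp add: power2_eq_square)
  then show ?thesis by (metis dual_order.refl mult_cancel_right1 zero_le_one)
qed

lemma p_isometry_le: "x \<in> carrier A \<Longrightarrow> p (x\<^sup>\<star> \<otimes> x \<ominus> \<one>) = 0 \<Longrightarrow> p x \<le> 1"
  using p_le_diff[of "x\<^sup>\<star> \<otimes> x" \<one>] p_one_le p_cstar[of x] power2_le_imp_le[of "p x" 1] by simp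

text \<open>The projection relations hold only up to seminorm zero. They still give (p x)^2 = p(x*
  x) \<le> p x, as x* x differs from x by an element of seminorm zero.\<close>

lemma p_projection_le:
  assumes x: "x \<in> carrier A" and "p (x\<^sup>\<star> \<ominus> x) = 0" "p (x \<otimes> x \<ominus> x) = 0"
  shows "p x \<le> 1"
proof -
  have "x\<^sup>\<star> \<otimes> x \<ominus> x = (x\<^sup>\<star> \<ominus> x) \<otimes> x \<oplus> (x \<otimes> x \<ominus> x)"
    using x by (simp add: l_diff_distr diff_add_diff)
  then have "p (x\<^sup>\<star> \<otimes> x \<ominus> x) \<le> 0"
    using p_triangle[of "(x\<^sup>\<star> \<ominus> x) \<otimes> x" "x \<otimes> x \<ominus> x"] p_mult[of "x\<^sup>\<star> \<ominus> x" x] x assms by simp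
  then have "(p x)\<^sup>2 \<le> p x"
    using p_le_diff[of "x\<^sup>\<star> \<otimes> x" x] p_cstar[of x] x by simp
  then show ?thesis using p_nonneg[OF x] by (cases "p x = 0") (auto simp: power2_eq_square)
qed

lemma p_pow: assumes x: "x \<in> carrier A" and "p x \<le> K" shows "p (x [^] (n::nat)) \<le> K ^ n"
proof (induction n)
  case 0 then show ?case using p_one_le by simp
next
  case (Suc n)
  have "p (x [^] Suc n) \<le> p (x [^] n) * p x" using x by (simp add: p_mult)
  also have "\<dots> \<le> K ^ n * K"
    using Suc assms order_trans[OF p_nonneg[OF x] assms(2)] x by (intro mult_mono) auto
  finally show ?case by (simp add: mult.commute)
qed

end

sublocale cstar_algebra \<subseteq> cstar_seminormed A "cnorm A"
  by unfold_locales (rule cstar_norm)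

text \<open>This turns a representation into a C*-seminorm on its domain, the form in which the
  universal seminorm and automatic continuity can be applied to it.\<close>

lemma cstar_seminorm_comp:
  assumes \<phi>: "\<phi> \<in> star_hom A B" and A: "star_algebra A" and B: "cstar_seminormed B p"
  shows "cstar_seminorm A (p \<circ> \<phi>)"
proof -
  interpret A: star_algebra A by fact
  interpret B: cstar_seminormed B p by fact
  show ?thesis
    unfolding cstar_seminorm_def
    by (auto simp: star_homD[OF \<phi>] B.p_smult B.p_cstar intro: B.p_triangle B.p_mult)
qed

section \<open>The approximate unit\<close>

context cstar_seminormed
begin

text \<open>The witness is 1 + V + ... + V^(n-1), built by recursion. The product formula is
  telescoping. The last clause holds because V is congruent to 1 modulo \<open>I\<close>, so all n
  summands are.\<close>

lemma geometric_sum_exists: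
  assumes I: "ideal I A" and V: "V \<in> carrier A" "V \<ominus> \<one> \<in> I" and pV: "p V \<le> K" "1 \<le> K"
  shows "\<exists>g\<in>carrier A. p g \<le> n * K ^ n \<and> (V \<ominus> \<one>) \<otimes> g = V [^] (n::nat) \<ominus> \<one> \<and>
    g \<ominus> of_nat n \<odot> \<one> \<in> I"
proof (induction n)
  case 0
  show ?case using V additive_subgroup.zero_closed[OF ideal.axioms(1)[OF I]]
    by (intro bexI[of _ \<zero>]) auto
next
  case (Suc n)
  then obtain g where g: "g \<in> carrier A" "p g \<le> n * K ^ n"
    "(V \<ominus> \<one>) \<otimes> g = V [^] n \<ominus> \<one>" "g \<ominus> of_nat n \<odot> \<one> \<in> I" by blast
  interpret I: ideal I A by fact
  have "p (g \<oplus> V [^] n) \<le> p g + p (V [^] n)" using g V by (simp add: p_triangle)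
  also have "\<dots> \<le> n * K ^ n + K ^ n" using g p_pow[OF V(1) pV(1)] by (intro add_mono) auto
  also have "\<dots> = Suc n * K ^ n" by (simp add: algebra_simps)
  also have "\<dots> \<le> Suc n * K ^ Suc n"
    using pV(2) by (intro mult_left_mono power_increasing) auto
  finally have 1: "p (g \<oplus> V [^] n) \<le> Suc n * K ^ Suc n" .
  have "(V \<ominus> \<one>) \<otimes> V [^] n = V [^] Suc n \<ominus> V [^] n"
    using V(1) nat_pow_Suc2[of V n] by (simp add: l_diff_distr)
  then have 2: "(V \<ominus> \<one>) \<otimes> (g \<oplus> V [^] n) = V [^] Suc n \<ominus> \<one>"
    using g V(1) diff_add_diff[of "V [^] Suc n" "V [^] n" \<one>]
    by (simp add: r_distr a_comm del: nat_pow_Suc)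
  have "V [^] n \<ominus> \<one> \<in> I" using I.I_r_closed[OF V(2) g(1)] g(3) by simp
  with g(4) have "(g \<ominus> of_nat n \<odot> \<one>) \<oplus> (V [^] n \<ominus> \<one>) \<in> I" by simp
  also have "(g \<ominus> of_nat n \<odot> \<one>) \<oplus> (V [^] n \<ominus> \<one>) = (g \<oplus> V [^] n) \<ominus> of_nat (Suc n) \<odot> \<one>"
    using g V(1) by (simp add: a_minus_def smult_l_distr minus_add a_ac)
  finally show ?case using g V(1) 1 2 by (intro bexI[of _ "g \<oplus> V [^] n"]) auto
qed

text \<open>Averaging the powers of \<open>1 + i \<delta> y\<close>, an almost unitary element, replaces the functional
  calculus: with \<open>m\<^sup>4\<close> powers and \<open>\<delta> = m\<^sup>-\<^sup>3\<close> the average \<open>f\<close> is almost a contraction, because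
  \<open>m\<^sup>4 \<delta>\<^sup>2 \<rightarrow> 0\<close>, and telescoping makes \<open>y f\<close> small, because \<open>m\<^sup>4 \<delta> \<rightarrow> \<infinity>\<close>.\<close>

lemma approximate_unit:
  assumes I: "ideal I A" and y: "y \<in> I" "y\<^sup>\<star> = y" and e: "0 < (e::real)"
  shows "\<exists>f\<in>carrier A. \<one> \<ominus> f \<in> I \<and> p f \<le> 1 + e \<and> p (y \<otimes> f) \<le> e"
proof -
  interpret I: ideal I A by fact
  have yA [simp]: "y \<in> carrier A" using y by (simp add: I.Icarr)
  define c where "c = p y"
  have c: "0 \<le> c" by (simp add: c_def)
  \<comment> \<open>\<open>L m\<close> is the value of \<open>K ^ n\<close> below: for n = m^4 and
    delta = m^-3 the exponent n delta^2 c^2 / 2 becomes c^2 / (2 m^2). Defining it in advance allows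
    m to be chosen from the final error bounds.\<close>
  define L where "L m = exp (c\<^sup>2 / 2 * (inverse (real m) * inverse (real m)))" for m
  have i0: "(\<lambda>m. inverse (real m)) \<longlonglongrightarrow> 0" by (rule LIMSEQ_inverse_real_of_nat[THEN LIMSEQ_imp_Suc])
  have L: "L \<longlonglongrightarrow> 1"
    unfolding L_def by (rule tendsto_eq_intros i0 refl | simp)+
  have L2: "(\<lambda>m. (L m + 1) * inverse (real m)) \<longlonglongrightarrow> 0"
    by (rule tendsto_eq_intros i0 L refl | simp)+
  have "\<forall>\<^sub>F m in sequentially. L m < 1 + e \<and> (L m + 1) * inverse (real m) < e \<and> 0 < m"
    using order_tendstoD(2)[OF L, of "1 + e"] order_tendstoD(2)[OF L2 e] e
    by (intro eventually_conj eventually_gt_at_top) auto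
  then obtain m where m: "L m < 1 + e" "(L m + 1) * inverse (real m) < e" "0 < m"
    by (auto simp: eventually_sequentially)
  define \<delta> where "\<delta> = inverse (real m ^ 3)"
  define n where "n = m ^ 4"
  have \<delta>: "0 < \<delta>" and n: "0 < n" using m by (auto simp: \<delta>_def n_def)
  define K where "K = exp (\<delta>\<^sup>2 * c\<^sup>2 / 2)"
  have Kn: "K ^ n = L m"
    using m(3) by (simp add: K_def L_def n_def \<delta>_def flip: exp_of_nat_mult)
      (simp add: field_simps power2_eq_square eval_nat_numeral)
  define w where "w = (\<i> * \<delta>) \<odot> y"
  have w [simp]: "w \<in> carrier A" and wI: "w \<in> I"
    using ideal_smult[OF I y(1)] by (auto simp: w_def)
  \<comment> \<open>Since \<open>w\<close> is skew-adjoint, the terms linear in delta cancel in V* V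
    = 1 - w^2, and the norm of V exceeds 1 only to second order in delta.\<close>
  have wadj: "w\<^sup>\<star> = \<ominus> w"
    by (simp add: w_def adj_smult y minus_eq_smult flip: smult_assoc)
  define V where "V = \<one> \<oplus> w"
  have V [simp]: "V \<in> carrier A" by (simp add: V_def)
  have V1: "V \<ominus> \<one> = w" by (simp add: V_def a_minus_def a_ac r_neg)
  have "V\<^sup>\<star> \<otimes> V = \<one> \<ominus> w \<otimes> w"
    by (simp add: V_def adj_add wadj l_distr r_distr a_minus_def l_minus)
      (simp add: a_ac, simp add: a_lcomm[of w \<one>] r_neg2)
  then have "(p V)\<^sup>2 \<le> p \<one> + p (w \<otimes> w)"
    using p_cstar[of V] p_diff_le[of \<one> "w \<otimes> w"] by simp
  also have "\<dots> \<le> 1 + (\<delta> * c) * (\<delta> * c)"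
    using p_one_le p_mult[of w w] \<delta> by (intro add_mono) (auto simp: w_def p_smult c_def norm_mult)
  also have "\<dots> \<le> exp (\<delta>\<^sup>2 * c\<^sup>2)"
    using exp_ge_add_one_self[of "\<delta>\<^sup>2 * c\<^sup>2"] by (simp add: power2_eq_square mult_ac)
  also have "\<dots> = K\<^sup>2" by (simp add: K_def flip: exp_of_nat_mult)
  finally have pV: "p V \<le> K" by (rule power2_le_imp_le) (simp add: K_def)
  have K1: "1 \<le> K" by (simp add: K_def)
  obtain g where g: "g \<in> carrier A" "p g \<le> n * K ^ n" "w \<otimes> g = V [^] n \<ominus> \<one>"
      "g \<ominus> of_nat n \<odot> \<one> \<in> I"
    using geometric_sum_exists[OF I V _ pV K1, of n] wI V1 by auto
  define f where "f = inverse (of_nat n) \<odot> g"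
  have f: "f \<in> carrier A" using g by (simp add: f_def)
  have "p f = p g / n"
    using g by (simp add: f_def p_smult norm_inverse divide_inverse mult.commute)
  then have "p f \<le> K ^ n"
    using g n by (simp add: divide_le_eq mult.commute)
  then have pf: "p f \<le> 1 + e" using m Kn by simp
  have "inverse (of_nat n) \<odot> (g \<ominus> of_nat n \<odot> \<one>) = f \<ominus> \<one>"
    using g n by (simp add: smult_diff f_def flip: smult_assoc)
  then have "f \<ominus> \<one> \<in> I" using ideal_smult[OF I g(4)] by metis
  then have "\<ominus> (f \<ominus> \<one>) \<in> I" by simp
  also have "\<ominus> (f \<ominus> \<one>) = \<one> \<ominus> f" using f by (simp add: a_minus_def minus_add a_ac)
  finally have fI: "\<one> \<ominus> f \<in> I" .
  have "\<delta> * n * p (y \<otimes> f) = p (w \<otimes> g)"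
    using \<delta> n g(1)
    by (simp add: w_def f_def smult_mult_left smult_mult_right p_smult norm_mult norm_inverse)
  also have "\<dots> \<le> p (V [^] n) + p \<one>" using g by (simp add: p_diff_le)
  also have "\<dots> \<le> L m + 1" using p_pow[OF V pV, of n] Kn p_one_le by simp
  moreover have "\<delta> * n = m" using m(3) by (simp add: \<delta>_def n_def eval_nat_numeral field_simps)
  ultimately have "m * p (y \<otimes> f) \<le> L m + 1" by simp
  then have "p (y \<otimes> f) \<le> (L m + 1) * inverse (real m)" using m(3) by (simp add: field_simps)
  then show ?thesis using m(2) pf fI f by (intro bexI[of _ f]) auto
qed

end

section \<open>Quotients by closed star ideals\<close>

text \<open>Estimates for the quotient seminorm are obtained for representatives that are optimal up
  to e. This removes the e at the end.\<close>

lemma le_at_right_limit: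
  fixes f :: "real \<Rightarrow> real"
  assumes "(f \<longlongrightarrow> L) (at_right 0)" "\<And>e. 0 < e \<Longrightarrow> c \<le> f e"
  shows "c \<le> L"
proof (rule tendsto_lowerbound[OF assms(1)])
  show "\<forall>\<^sub>F e in at_right 0. c \<le> f e"
    using assms(2) by (auto simp: eventually_at_right_field intro!: exI[of _ 1])
qed simp

text \<open>The tails are bounded by a geometric series. It is used for the lifted sequence in a
  quotient and for the iteration that produces a square root.\<close>

lemma (in cstar_seminormed) geometric_cauchy:
  assumes a [simp]: "\<And>n. a n \<in> carrier A" and c: "0 \<le> c" "c < 1"
    and step: "\<And>k. p (a (Suc k) \<ominus> a k) \<le> c ^ k"
  shows "a \<in> cauchy_seqs A p"
proof -
  have near: "p (a (k + j) \<ominus> a k) \<le> c ^ k / (1 - c)" for k j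
  proof -
    \<comment> \<open>Keeping the subtracted term c^(k+j) makes the induction on j close exactly; it
      is dropped afterwards.\<close>
    have "p (a (k + j) \<ominus> a k) \<le> (c ^ k - c ^ (k + j)) / (1 - c)"
    proof (induction j)
      case (Suc j)
      have "p (a (k + Suc j) \<ominus> a k) \<le> p (a (Suc (k + j)) \<ominus> a (k + j)) + p (a (k + j) \<ominus> a k)"
        using p_diff_triangle by simp
      also have "\<dots> \<le> c ^ (k + j) + (c ^ k - c ^ (k + j)) / (1 - c)"
        by (intro add_mono step Suc)
      also have "\<dots> = (c ^ k - c ^ (k + Suc j)) / (1 - c)" using c by (simp add: field_simps)
      finally show ?case .
    qed simp
    also have "\<dots> \<le> c ^ k / (1 - c)" using c by (intro divide_right_mono) auto
    finally show ?thesis .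
  qed
  have lim: "(\<lambda>k. c ^ k / (1 - c)) \<longlonglongrightarrow> 0"
    using tendsto_divide[OF LIMSEQ_power_zero[of c] tendsto_const[of "1 - c"]] c by simp
  show ?thesis
    unfolding cauchy_seqs_def
  proof (safe, goal_cases)
    case (2 e)
    then obtain k where k: "c ^ k / (1 - c) < e / 2"
      using order_tendstoD(2)[OF lim, of "e / 2"] by (auto simp: eventually_sequentially)
    show ?case
    proof (intro exI[of _ k] allI impI)
      fix m n assume "k \<le> m" "k \<le> n"
      then have "p (a m \<ominus> a k) < e / 2" "p (a n \<ominus> a k) < e / 2"
        using order.strict_trans1[OF near k, of "m - k"] order.strict_trans1[OF near k, of "n - k"]
        by auto
      then show "p (a m \<ominus> a n) < e"
        using p_diff_triangle[of "a m" "a k" "a n"] p_diff_commute[of "a k" "a n"] by simp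
    qed
  qed simp
qed

text \<open>Self-adjointness is an assumption here. The ideals in use are kernels of seminorms or
  are generated by sets closed under the adjoint, and for these it is easy to check.\<close>

locale star_ideal = cstar_seminormed A p + ideal I A
  for A :: "('a, 'm) star_alg_scheme" (structure) and p and I +
  assumes adj_ideal: "x \<in> I \<Longrightarrow> x\<^sup>\<star> \<in> I"
begin

abbreviation "Q \<equiv> star_quot A p I"

lemma coset_eq_iff: "x \<in> carrier A \<Longrightarrow> y \<in> carrier A \<Longrightarrow> I +> x = I +> y \<longleftrightarrow> x \<ominus> y \<in> I"
  using quotient_eq_iff_same_a_r_cos[OF ideal_axioms] by simp

lemma mem_coset_iff:
  assumes x: "x \<in> carrier A"
  shows "y \<in> I +> x \<longleftrightarrow> y \<in> carrier A \<and> I +> y = I +> x"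
proof
  assume "y \<in> I +> x"
  then obtain h where h: "h \<in> I" "y = h \<oplus> x" by (auto simp: a_r_coset_def')
  then have "y \<in> carrier A" "y \<ominus> x \<in> I" using x by (simp_all add: Icarr a_minus_def a_assoc r_neg)
  then show "y \<in> carrier A \<and> I +> y = I +> x" using x coset_eq_iff by simp
qed (use a_rcos_self in blast)

lemma coset_cong_smult:
  "\<lbrakk>x \<in> carrier A; y \<in> carrier A; I +> y = I +> x\<rbrakk> \<Longrightarrow> I +> (c \<odot> y) = I +> (c \<odot> x)"
  using ideal_smult[OF ideal_axioms] by (simp add: coset_eq_iff flip: smult_diff)

lemma coset_cong_adj:
  "\<lbrakk>x \<in> carrier A; y \<in> carrier A; I +> y = I +> x\<rbrakk> \<Longrightarrow> I +> (y\<^sup>\<star>) = I +> (x\<^sup>\<star>)"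
  using adj_ideal by (simp add: coset_eq_iff flip: adj_diff)

lemma quot_carrier: "carrier Q = (\<lambda>x. I +> x) ` carrier A"
  by (auto simp: star_quot_def FactRing_def A_RCOSETS_def')

text \<open>In \<open>star_quot\<close> the scalar multiple and the adjoint of a coset are unions
  over its representatives. All these sets coincide, so the union is a single coset.\<close>

lemma quot_ops:
  shows "\<one>\<^bsub>Q\<^esub> = I +> \<one>" "\<zero>\<^bsub>Q\<^esub> = I +> \<zero>"
    "x \<in> carrier A \<Longrightarrow> y \<in> carrier A \<Longrightarrow> (I +> x) \<oplus>\<^bsub>Q\<^esub> (I +> y) = I +> (x \<oplus> y)"
    "x \<in> carrier A \<Longrightarrow> y \<in> carrier A \<Longrightarrow> (I +> x) \<otimes>\<^bsub>Q\<^esub> (I +> y) = I +> (x \<otimes> y)"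
    "x \<in> carrier A \<Longrightarrow> c \<odot>\<^bsub>Q\<^esub> (I +> x) = I +> (c \<odot> x)"
    "x \<in> carrier A \<Longrightarrow> (I +> x)\<^sup>\<star>\<^bsub>Q\<^esub> = I +> (x\<^sup>\<star>)"
proof -
  show "\<zero>\<^bsub>Q\<^esub> = I +> \<zero>"
    by (simp add: star_quot_def FactRing_def a_coset_add_zero a_subset)
  have *: "(\<Union>y\<in>I +> x. f y) = f x"
    if x: "x \<in> carrier A" and f: "\<And>y. y \<in> carrier A \<Longrightarrow> I +> y = I +> x \<Longrightarrow> f y = f x"
    for x and f :: "'a \<Rightarrow> 'a set"
  proof (rule SUP_eq_const)
    show "I +> x \<noteq> {}" using a_rcos_self[OF x] by blast
    show "f y = f x" if "y \<in> I +> x" for y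
      using \<open>y \<in> I +> x\<close> mem_coset_iff[OF x] by (intro f) auto
  qed
  show "c \<odot>\<^bsub>Q\<^esub> (I +> x) = I +> (c \<odot> x)" if x: "x \<in> carrier A" for c x
    by (simp add: star_quot_def) (rule *[OF x], erule (1) coset_cong_smult[OF x])
  show "(I +> x)\<^sup>\<star>\<^bsub>Q\<^esub> = I +> (x\<^sup>\<star>)" if x: "x \<in> carrier A" for x
    by (simp add: star_quot_def) (rule *[OF x], erule (1) coset_cong_adj[OF x])
qed (simp_all add: star_quot_def FactRing_def rcoset_mult_add a_rcos_sum)

lemma quot_star_algebra: "star_algebra Q"
  by (rule star_algebra_image[OF star_algebra_axioms quot_carrier]) (simp_all add: quot_ops)

lemma quot_hom: "(\<lambda>x. I +> x) \<in> star_hom A Q"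
  by (auto simp: star_hom_def ring_hom_def quot_ops quot_carrier)

lemma quot_diff:
  "x \<in> carrier A \<Longrightarrow> y \<in> carrier A \<Longrightarrow> (I +> x) \<ominus>\<^bsub>Q\<^esub> (I +> y) = I +> (x \<ominus> y)"
  by (simp add: star_hom_diff[OF quot_hom star_algebra_axioms quot_star_algebra])

lemma cnorm_quot: "cnorm Q X = (INF x\<in>X. p x)"
  by (simp add: star_quot_def)

text \<open>Working form of the infimum: the cosets are nonempty and the seminorm is bounded below
  by 0, so a strict bound is always attained by some representative.\<close>

lemma cnorm_quot_less_iff:
  assumes "x \<in> carrier A"
  shows "cnorm Q (I +> x) < c \<longleftrightarrow> (\<exists>y\<in>carrier A. I +> y = I +> x \<and> p y < c)"
proof -
  have "bdd_below (p ` (I +> x))" using assms by (auto intro!: bdd_belowI[of _ 0] simp: mem_coset_iff)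
  moreover have "I +> x \<noteq> {}" using a_rcos_self[OF assms] by blast
  ultimately have "cnorm Q (I +> x) < c \<longleftrightarrow> (\<exists>y\<in>I +> x. p y < c)"
    by (simp add: cnorm_quot cINF_less_iff)
  then show ?thesis using mem_coset_iff[OF assms] by blast
qed

lemma cnorm_quot_le: "y \<in> carrier A \<Longrightarrow> x \<in> carrier A \<Longrightarrow> I +> y = I +> x \<Longrightarrow> cnorm Q (I +> x) \<le> p y"
  using cnorm_quot_less_iff[of x "cnorm Q (I +> x)"] by (intro leI notI) blast

lemma cnorm_quot_nonneg: assumes "x \<in> carrier A" shows "0 \<le> cnorm Q (I +> x)"
proof (rule leI, rule notI)
  assume "cnorm Q (I +> x) < 0"
  then obtain y where "y \<in> carrier A" "p y < 0" using cnorm_quot_less_iff[OF assms] by blast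
  then show False by (simp flip: not_le)
qed

lemma cnorm_quot_approx:
  assumes "x \<in> carrier A" "0 < e"
  obtains y where "y \<in> carrier A" "I +> y = I +> x" "p y < cnorm Q (I +> x) + e"
  using cnorm_quot_less_iff[OF assms(1), of "cnorm Q (I +> x) + e"] assms(2) by auto

lemma coset_eq_mult:
  "\<lbrakk>x \<in> carrier A; y \<in> carrier A; x' \<in> carrier A; y' \<in> carrier A; I +> x' = I +> x; I +> y' = I +> y\<rbrakk>
    \<Longrightarrow> I +> (x' \<otimes> y') = I +> (x \<otimes> y)"
  using quot_ops(4)[of x' y'] quot_ops(4)[of x y] by simp

lemma coset_eq_add:
  "\<lbrakk>x \<in> carrier A; y \<in> carrier A; x' \<in> carrier A; y' \<in> carrier A; I +> x' = I +> x; I +> y' = I +> y\<rbrakk>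
    \<Longrightarrow> I +> (x' \<oplus> y') = I +> (x \<oplus> y)"
  using quot_ops(3)[of x' y'] quot_ops(3)[of x y] by simp

lemma cnorm_quot_triangle:
  assumes [simp]: "x \<in> carrier A" "y \<in> carrier A"
  shows "cnorm Q (I +> (x \<oplus> y)) \<le> cnorm Q (I +> x) + cnorm Q (I +> y)"
proof (rule le_at_right_limit[where f = "\<lambda>e. cnorm Q (I +> x) + e + (cnorm Q (I +> y) + e)"])
  fix e :: real assume e: "0 < e"
  obtain x' where x': "x' \<in> carrier A" "I +> x' = I +> x" "p x' < cnorm Q (I +> x) + e"
    using e by (rule cnorm_quot_approx[OF assms(1)])
  obtain y' where y': "y' \<in> carrier A" "I +> y' = I +> y" "p y' < cnorm Q (I +> y) + e"
    using e by (rule cnorm_quot_approx[OF assms(2)])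
  have "cnorm Q (I +> (x \<oplus> y)) \<le> p (x' \<oplus> y')"
    by (rule cnorm_quot_le) (use x' y' in \<open>simp_all add: coset_eq_add[of x y x' y']\<close>)
  also have "\<dots> \<le> p x' + p y'" using x' y' by (simp add: p_triangle)
  finally show "cnorm Q (I +> (x \<oplus> y)) \<le> cnorm Q (I +> x) + e + (cnorm Q (I +> y) + e)"
    using x' y' by simp
qed (rule tendsto_eq_intros refl | simp)+

lemma cnorm_quot_mult:
  assumes [simp]: "x \<in> carrier A" "y \<in> carrier A"
  shows "cnorm Q (I +> (x \<otimes> y)) \<le> cnorm Q (I +> x) * cnorm Q (I +> y)"
proof (rule le_at_right_limit[where f = "\<lambda>e. (cnorm Q (I +> x) + e) * (cnorm Q (I +> y) + e)"])
  fix e :: real assume e: "0 < e"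
  obtain x' where x': "x' \<in> carrier A" "I +> x' = I +> x" "p x' < cnorm Q (I +> x) + e"
    using e by (rule cnorm_quot_approx[OF assms(1)])
  obtain y' where y': "y' \<in> carrier A" "I +> y' = I +> y" "p y' < cnorm Q (I +> y) + e"
    using e by (rule cnorm_quot_approx[OF assms(2)])
  have "cnorm Q (I +> (x \<otimes> y)) \<le> p (x' \<otimes> y')"
    by (rule cnorm_quot_le) (use x' y' in \<open>simp_all add: coset_eq_mult[of x y x' y']\<close>)
  also have "\<dots> \<le> p x' * p y'" using x' y' by (simp add: p_mult)
  also have "\<dots> \<le> (cnorm Q (I +> x) + e) * (cnorm Q (I +> y) + e)"
    using x' y' e cnorm_quot_nonneg[of x] by (intro mult_mono) auto
  finally show "cnorm Q (I +> (x \<otimes> y)) \<le> (cnorm Q (I +> x) + e) * (cnorm Q (I +> y) + e)" .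
qed (rule tendsto_eq_intros refl | simp)+

text \<open>Only one inequality needs representatives. Applied to the inverse scalar it gives the
  other one.\<close>

lemma cnorm_quot_smult:
  assumes [simp]: "x \<in> carrier A"
  shows "cnorm Q (I +> (c \<odot> x)) = cmod c * cnorm Q (I +> x)"
proof -
  have le: "cnorm Q (I +> (c \<odot> x)) \<le> cmod c * cnorm Q (I +> x)" if x [simp]: "x \<in> carrier A" for c x
  proof (rule le_at_right_limit[where f = "\<lambda>e. cmod c * (cnorm Q (I +> x) + e)"])
    fix e :: real assume e: "0 < e"
    obtain x' where x': "x' \<in> carrier A" "I +> x' = I +> x" "p x' < cnorm Q (I +> x) + e"
      using e by (rule cnorm_quot_approx[OF x])
    have "cnorm Q (I +> (c \<odot> x)) \<le> p (c \<odot> x')"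
      by (rule cnorm_quot_le) (use x' in \<open>simp_all add: coset_cong_smult[of x x']\<close>)
    also have "\<dots> \<le> cmod c * (cnorm Q (I +> x) + e)"
      using x' by (simp add: p_smult mult_left_mono)
    finally show "cnorm Q (I +> (c \<odot> x)) \<le> cmod c * (cnorm Q (I +> x) + e)" .
  qed (rule tendsto_eq_intros refl | simp)+
  show ?thesis
  proof (cases "c = 0")
    case True
    then show ?thesis using cnorm_quot_le[of \<zero> \<zero>] cnorm_quot_nonneg[of \<zero>] by simp
  next
    case False
    have "cnorm Q (I +> x) \<le> cmod (inverse c) * cnorm Q (I +> (c \<odot> x))"
      using le[of "c \<odot> x" "inverse c"] False by (simp flip: smult_assoc)
    then show ?thesis using le[of x c] False by (simp add: norm_divide field_simps)
  qed
qed

lemma cnorm_quot_adj_le: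
  assumes [simp]: "x \<in> carrier A"
  shows "cnorm Q (I +> (x\<^sup>\<star>)) \<le> cnorm Q (I +> x)"
proof (rule le_at_right_limit[where f = "\<lambda>e. cnorm Q (I +> x) + e"])
  fix e :: real assume e: "0 < e"
  obtain x' where x': "x' \<in> carrier A" "I +> x' = I +> x" "p x' < cnorm Q (I +> x) + e"
    using e by (rule cnorm_quot_approx[OF assms(1)])
  have "cnorm Q (I +> (x\<^sup>\<star>)) \<le> p (x'\<^sup>\<star>)"
    by (rule cnorm_quot_le) (use x' in \<open>simp_all add: coset_cong_adj[of x x']\<close>)
  then show "cnorm Q (I +> (x\<^sup>\<star>)) \<le> cnorm Q (I +> x) + e" using x' by simp
qed (rule tendsto_eq_intros refl | simp)+

text \<open>A nearly optimal representative of x* x can be taken of the form x* x + y with y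
  self-adjoint in \<open>I\<close>. For an approximate unit f for y, the element x f represents x
  because 1 - f lies in \<open>I\<close>. Then p(x f)^2 = p(f* x* x f), and replacing x* x by x* x +
  y costs only p(f* y f), which is small.\<close>

lemma cnorm_quot_cstar_ge:
  assumes x [simp]: "x \<in> carrier A"
  shows "(cnorm Q (I +> x))\<^sup>2 \<le> cnorm Q (I +> (x\<^sup>\<star> \<otimes> x))"
proof (rule le_at_right_limit
    [where f = "\<lambda>e. (1 + e) * ((cnorm Q (I +> (x\<^sup>\<star> \<otimes> x)) + e) * (1 + e)) + (1 + e) * e"])
  fix e :: real assume e: "0 < e"
  obtain z where z: "z \<in> carrier A" "I +> z = I +> (x\<^sup>\<star> \<otimes> x)"
    "p z < cnorm Q (I +> (x\<^sup>\<star> \<otimes> x)) + e"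
    using e by (rule cnorm_quot_approx[of "x\<^sup>\<star> \<otimes> x", rotated]) auto
  define y0 where "y0 = z \<ominus> x\<^sup>\<star> \<otimes> x"
  have y0: "y0 \<in> I" "y0 \<in> carrier A" using z by (auto simp: y0_def coset_eq_iff)
  \<comment> \<open>The approximate unit requires a self-adjoint element. Passing to the
    self-adjoint part of \<open>z\<close> leaves x* x unchanged and does not increase the
    seminorm.\<close>
  define y where "y = (1/2) \<odot> (y0 \<oplus> y0\<^sup>\<star>)"
  have y: "y \<in> I" using y0 by (simp add: y_def ideal_smult[OF ideal_axioms] adj_ideal)
  have yA [simp]: "y \<in> carrier A" using y by (rule Icarr)
  have "y\<^sup>\<star> = y" using y0 by (simp add: y_def adj_smult adj_add a_comm)
  then obtain f where f: "f \<in> carrier A" "\<one> \<ominus> f \<in> I" "p f \<le> 1 + e" "p (y \<otimes> f) \<le> e"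
    using approximate_unit[OF ideal_axioms y _ e] by blast
  have z_eq: "z = x\<^sup>\<star> \<otimes> x \<oplus> y0" using z(1) by (simp add: y0_def a_minus_def a_lcomm r_neg)
  have half: "(1/2) \<odot> (w \<oplus> w) = w" if "w \<in> carrier A" for w
    using that smult_l_distr[of w "1/2" "1/2"] by (simp add: smult_r_distr)
  have "z \<oplus> z\<^sup>\<star> = (x\<^sup>\<star> \<otimes> x \<oplus> x\<^sup>\<star> \<otimes> x) \<oplus> (y0 \<oplus> y0\<^sup>\<star>)"
    using y0 by (simp add: z_eq adj_add adj_mult a_ac)
  then have h: "(1/2) \<odot> (z \<oplus> z\<^sup>\<star>) = x\<^sup>\<star> \<otimes> x \<oplus> y"
    using y0 half[of "x\<^sup>\<star> \<otimes> x"] by (simp add: y_def smult_r_distr)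
  have "p (x\<^sup>\<star> \<otimes> x \<oplus> y) \<le> p z"
    using z(1) p_triangle[of z "z\<^sup>\<star>"] by (simp add: h[symmetric] p_smult)
  then have py: "p (x\<^sup>\<star> \<otimes> x \<oplus> y) \<le> cnorm Q (I +> (x\<^sup>\<star> \<otimes> x)) + e" using z(3) by simp
  have "x \<otimes> (\<one> \<ominus> f) \<in> I" using f by (simp add: I_l_closed)
  also have "x \<otimes> (\<one> \<ominus> f) = x \<ominus> x \<otimes> f" using f by (simp add: r_diff_distr)
  finally have "I +> (x \<otimes> f) = I +> x" using f coset_eq_iff[of x "x \<otimes> f"] by simp
  then have "(cnorm Q (I +> x))\<^sup>2 \<le> (p (x \<otimes> f))\<^sup>2"
    using f cnorm_quot_nonneg[of x] by (intro power_mono cnorm_quot_le) auto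
  also have "\<dots> = p (f\<^sup>\<star> \<otimes> ((x\<^sup>\<star> \<otimes> x) \<otimes> f))"
    using f p_cstar[of "x \<otimes> f"] by (simp add: adj_mult m_assoc)
  also have "f\<^sup>\<star> \<otimes> ((x\<^sup>\<star> \<otimes> x) \<otimes> f) = f\<^sup>\<star> \<otimes> ((x\<^sup>\<star> \<otimes> x \<oplus> y) \<otimes> f) \<ominus> f\<^sup>\<star> \<otimes> (y \<otimes> f)"
    using f by (simp add: l_distr r_distr a_minus_def a_assoc r_neg)
  also have "p \<dots> \<le> p (f\<^sup>\<star>) * (p (x\<^sup>\<star> \<otimes> x \<oplus> y) * p f) + p (f\<^sup>\<star>) * p (y \<otimes> f)"
    using f
    by (intro order_trans[OF p_diff_le] add_mono order_trans[OF p_mult] mult_left_mono p_mult) auto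
  also have "\<dots> \<le> (1 + e) * ((cnorm Q (I +> (x\<^sup>\<star> \<otimes> x)) + e) * (1 + e)) + (1 + e) * e"
    using f e py cnorm_quot_nonneg[of "x\<^sup>\<star> \<otimes> x"] by (intro add_mono mult_mono mult_nonneg_nonneg) auto
  finally show "(cnorm Q (I +> x))\<^sup>2
    \<le> (1 + e) * ((cnorm Q (I +> (x\<^sup>\<star> \<otimes> x)) + e) * (1 + e)) + (1 + e) * e" .
qed (rule tendsto_eq_intros refl | simp)+

lemma cnorm_quot_seminorm: "cstar_seminorm Q (cnorm Q)"
proof -
  have "cnorm Q (I +> (x\<^sup>\<star> \<otimes> x)) \<le> (cnorm Q (I +> x))\<^sup>2" if "x \<in> carrier A" for x
    using that cnorm_quot_mult[of "x\<^sup>\<star>" x] cnorm_quot_adj_le[of x] cnorm_quot_nonneg[of x]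
    by (simp add: power2_eq_square) (meson mult_right_mono order_trans)
  then show ?thesis
    by (auto simp: cstar_seminorm_def quot_carrier quot_ops cnorm_quot_nonneg cnorm_quot_triangle
      cnorm_quot_smult cnorm_quot_mult cnorm_quot_cstar_ge intro!: antisym)
qed

text \<open>Closedness and completeness are stated for the seminorm \<open>p\<close>, so the result
  covers quotients of C*-algebras as well as the algebra of Cauchy sequences modulo null sequences.
  For completeness of the quotient a rapidly converging subsequence is lifted to a Cauchy sequence
  upstairs.\<close>

theorem quot_cstar_algebra:
  assumes closed: "\<And>x. x \<in> carrier A \<Longrightarrow> (\<And>e. 0 < e \<Longrightarrow> \<exists>y\<in>I. p (x \<ominus> y) < e) \<Longrightarrow> x \<in> I"
    and complete: "\<And>f. f \<in> cauchy_seqs A p \<Longrightarrow>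
      \<exists>x\<in>carrier A. (\<lambda>n. p (f n \<ominus> x)) \<longlonglongrightarrow> 0"
  shows "cstar_algebra Q"
proof -
  interpret Q: cstar_seminormed Q "cnorm Q"
    by (intro cstar_seminormed.intro quot_star_algebra cstar_seminormed_axioms.intro cnorm_quot_seminorm)
  have definite: "X = \<zero>\<^bsub>Q\<^esub>" if XQ: "X \<in> carrier Q" and X0: "cnorm Q X = 0" for X
  proof -
    obtain x where x [simp]: "x \<in> carrier A" and X: "X = I +> x" using XQ by (auto simp: quot_carrier)
    have "x \<in> I"
    proof (rule closed[OF x])
      fix e :: real assume "0 < e"
      then obtain y where y: "y \<in> carrier A" "I +> y = I +> x" "p y < e"
        using cnorm_quot_approx[OF x, of e] X0 X by auto
      then have "x \<ominus> y \<in> I" by (simp add: coset_eq_iff[symmetric])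
      moreover have "x \<ominus> (x \<ominus> y) = y"
        using y by (simp add: a_minus_def minus_add a_assoc[symmetric] r_neg)
      ultimately show "\<exists>y\<in>I. p (x \<ominus> y) < e" using y by (intro bexI[of _ "x \<ominus> y"]) auto
    qed
    then show ?thesis using coset_eq_iff[of x \<zero>] by (simp add: X quot_ops)
  qed
  have "\<exists>X\<in>carrier Q. converges_to Q F X" if F: "F \<in> cauchy_seqs Q (cnorm Q)" for F
  proof -
    have "\<forall>n. \<exists>x\<in>carrier A. F n = I +> x" using F unfolding cauchy_seqs_def quot_carrier by blast
    then obtain a where a [simp]: "\<And>n. a n \<in> carrier A" and Fa: "\<And>n. F n = I +> a n" by metis
    have "\<exists>N. \<forall>m\<ge>N. \<forall>n\<ge>N. cnorm Q (I +> (a m \<ominus> a n)) < (1/2) ^ k" for k :: nat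
    proof -
      have "0 < (1/2 :: real) ^ k" by simp
      then show ?thesis using F by (auto simp: cauchy_seqs_def Fa quot_diff)
    qed
    then obtain M where M:
      "\<And>k m n. M k \<le> m \<Longrightarrow> M k \<le> n \<Longrightarrow> cnorm Q (I +> (a m \<ominus> a n)) < (1/2) ^ k" by metis
    \<comment> \<open>The partial sums dominate all of \<open>M 0\<close>, ..., \<open>M k\<close>,
      so both \<open>r k\<close> and \<open>r (Suc k)\<close> are admissible indices for the
      precision (1/2)^k.\<close>
    define r where "r k = (\<Sum>j\<le>k. M j)" for k
    have r: "M k \<le> r k" for k unfolding r_def by (intro member_le_sum) auto
    have r': "M k \<le> r (Suc k)" for k using r[of k] by (simp add: r_def)
    \<comment> \<open>Small differences of cosets have small representatives. Adding these up,
      instead of using the given representatives \<open>a (r k)\<close>, produces a sequence that is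
      Cauchy for \<open>p\<close> itself.\<close>
    have "\<exists>d\<in>carrier A. I +> d = I +> (a (r (Suc k)) \<ominus> a (r k)) \<and> p d < (1/2) ^ k" for k
      using M[OF r' r] by (simp add: cnorm_quot_less_iff)
    then obtain d where d [simp]: "\<And>k. d k \<in> carrier A"
      and dr: "\<And>k. I +> d k = I +> (a (r (Suc k)) \<ominus> a (r k))" and pd: "\<And>k. p (d k) < (1/2) ^ k"
      by metis
    define x where "x = rec_nat (a (r 0)) (\<lambda>k y. y \<oplus> d k)"
    have x0: "x 0 = a (r 0)" and xS: "x (Suc k) = x k \<oplus> d k" for k by (simp_all add: x_def)
    have x [simp]: "x k \<in> carrier A" for k by (induction k) (simp_all add: x0 xS)
    have xa: "I +> x k = I +> a (r k)" for k
    proof (induction k)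
      case (Suc k)
      have "I +> x (Suc k) = I +> (a (r k) \<oplus> (a (r (Suc k)) \<ominus> a (r k)))"
        unfolding xS by (rule coset_eq_add) (simp_all add: Suc dr)
      also have "a (r k) \<oplus> (a (r (Suc k)) \<ominus> a (r k)) = a (r (Suc k))"
        by (simp add: a_minus_def a_lcomm[of "a (r k)" "a (r (Suc k))"] r_neg)
      finally show ?case .
    qed (simp add: x0)
    have "p (x (Suc k) \<ominus> x k) \<le> (1/2) ^ k" for k
    proof -
      have "x (Suc k) \<ominus> x k = d k" by (simp add: xS a_minus_def a_comm[of "x k"] a_assoc r_neg)
      then show ?thesis using pd[of k] by simp
    qed
    then have "x \<in> cauchy_seqs A p" by (intro geometric_cauchy[where c = "1/2"]) auto
    then obtain y where y [simp]: "y \<in> carrier A" and lim: "(\<lambda>n. p (x n \<ominus> y)) \<longlonglongrightarrow> 0"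
      using complete by blast
    have "converges_to Q F (I +> y)"
      unfolding converges_to_def
    proof (rule LIMSEQ_I)
      fix e :: real assume e: "0 < e"
      obtain K where K: "\<And>n. K \<le> n \<Longrightarrow> p (x n \<ominus> y) < e / 2"
        using LIMSEQ_D[OF lim, of "e / 2"] e by auto
      obtain k0 where k0: "(1/2 :: real) ^ k0 < e / 2" using real_arch_pow_inv[of "e/2" "1/2"] e by auto
      define k where "k = max K k0"
      have k: "(1/2 :: real) ^ k < e / 2"
        by (rule le_less_trans[OF power_decreasing k0]) (simp_all add: k_def)
      have "cnorm Q (F n \<ominus>\<^bsub>Q\<^esub> (I +> y)) < e" if "M k \<le> n" for n
      proof -
        have "cnorm Q (F n \<ominus>\<^bsub>Q\<^esub> (I +> y)) \<le>
          cnorm Q (F n \<ominus>\<^bsub>Q\<^esub> (I +> x k)) + cnorm Q ((I +> x k) \<ominus>\<^bsub>Q\<^esub> (I +> y))"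
          by (rule Q.p_diff_triangle) (auto simp: Fa quot_carrier)
        moreover have "cnorm Q (F n \<ominus>\<^bsub>Q\<^esub> (I +> x k)) < (1/2) ^ k"
          using M[OF that r] by (simp add: Fa xa quot_diff)
        moreover have "cnorm Q ((I +> x k) \<ominus>\<^bsub>Q\<^esub> (I +> y)) \<le> p (x k \<ominus> y)"
          by (simp add: quot_diff cnorm_quot_le)
        moreover have "p (x k \<ominus> y) < e / 2" using K[of k] by (simp add: k_def)
        ultimately show ?thesis using k by simp
      qed
      moreover have "F n \<ominus>\<^bsub>Q\<^esub> (I +> y) \<in> carrier Q" for n by (simp add: Fa quot_diff) (auto simp: quot_carrier)
      ultimately show "\<exists>N. \<forall>n\<ge>N. norm (cnorm Q (F n \<ominus>\<^bsub>Q\<^esub> (I +> y)) - 0) < e"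
        using Q.p_nonneg by fastforce
    qed
    then show ?thesis using y by (auto simp: quot_carrier)
  qed
  with definite show ?thesis
    by (intro cstar_algebra.intro quot_star_algebra cstar_algebra_axioms.intro cnorm_quot_seminorm) auto
qed

lemma quot_lift:
  assumes \<phi>: "\<phi> \<in> star_hom A B" and B: "star_algebra B" and zero: "\<And>x. x \<in> I \<Longrightarrow> \<phi> x = \<zero>\<^bsub>B\<^esub>"
  shows "\<exists>\<psi>\<in>star_hom Q B. \<forall>x\<in>carrier A. \<psi> (I +> x) = \<phi> x"
proof -
  interpret B: star_algebra B by fact
  define \<psi> where "\<psi> X = \<phi> (SOME x. x \<in> X)" for X
  have *: "\<psi> (I +> x) = \<phi> x" if x: "x \<in> carrier A" for x
  proof -
    have "(SOME y. y \<in> I +> x) \<in> I +> x" using a_rcos_self[OF x] by (rule someI)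
    then obtain y where y: "y = (SOME y. y \<in> I +> x)" "y \<in> carrier A" "y \<ominus> x \<in> I"
      using x by (auto simp: mem_coset_iff coset_eq_iff)
    have "\<phi> y \<ominus>\<^bsub>B\<^esub> \<phi> x = \<zero>\<^bsub>B\<^esub>"
      using zero[OF y(3)] x y by (simp add: star_hom_diff[OF \<phi> star_algebra_axioms B])
    then show ?thesis using x y by (simp add: \<psi>_def B.diff_eq_zero star_homD[OF \<phi>])
  qed
  have "\<psi> \<in> star_hom Q B"
    by (auto simp: star_hom_def ring_hom_def quot_carrier quot_ops * star_homD[OF \<phi>])
  with * show ?thesis by blast
qed

end

section \<open>Limits and Hausdorff completions\<close>

lemma LIMSEQ_0_le:
  fixes f g :: "nat \<Rightarrow> real"
  assumes "g \<longlonglongrightarrow> 0" "\<And>n. 0 \<le> f n" "\<And>n. f n \<le> g n"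
  shows "f \<longlonglongrightarrow> 0"
  by (rule tendsto_sandwich[of "\<lambda>_. 0" _ _ g]) (use assms in auto)

context star_algebra
begin

lemma add_diff_add:
  "\<lbrakk>a \<in> carrier A; b \<in> carrier A; c \<in> carrier A; d \<in> carrier A\<rbrakk> \<Longrightarrow>
    (a \<oplus> b) \<ominus> (c \<oplus> d) = (a \<ominus> c) \<oplus> (b \<ominus> d)"
  by (simp add: a_minus_def minus_add a_ac)

lemma mult_diff_mult:
  "\<lbrakk>a \<in> carrier A; b \<in> carrier A; c \<in> carrier A; d \<in> carrier A\<rbrakk> \<Longrightarrow>
    a \<otimes> b \<ominus> c \<otimes> d = (a \<ominus> c) \<otimes> b \<oplus> c \<otimes> (b \<ominus> d)"
  by (simp add: l_diff_distr r_diff_distr diff_add_diff)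

end

context cstar_seminormed
begin

lemma p_add_diff_add:
  "\<lbrakk>a \<in> carrier A; b \<in> carrier A; c \<in> carrier A; d \<in> carrier A\<rbrakk> \<Longrightarrow>
    p ((a \<oplus> b) \<ominus> (c \<oplus> d)) \<le> p (a \<ominus> c) + p (b \<ominus> d)"
  by (simp add: add_diff_add p_triangle)

lemma p_mult_diff_mult:
  assumes "a \<in> carrier A" "b \<in> carrier A" "c \<in> carrier A" "d \<in> carrier A"
  shows "p (a \<otimes> b \<ominus> c \<otimes> d) \<le> p (a \<ominus> c) * p b + p c * p (b \<ominus> d)"
  unfolding mult_diff_mult[OF assms]
  using assms p_mult[of "a \<ominus> c" b] p_mult[of c "b \<ominus> d"] p_triangle[of "(a \<ominus> c) \<otimes> b" "c \<otimes> (b \<ominus> d)"]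
  by simp

lemma p_smult_diff_smult:
  "\<lbrakk>a \<in> carrier A; b \<in> carrier A\<rbrakk> \<Longrightarrow> p (c \<odot> a \<ominus> c \<odot> b) = cmod c * p (a \<ominus> b)"
  by (simp add: p_smult flip: smult_diff)

lemma p_adj_diff_adj:
  "\<lbrakk>a \<in> carrier A; b \<in> carrier A\<rbrakk> \<Longrightarrow> p (a\<^sup>\<star> \<ominus> b\<^sup>\<star>) = p (a \<ominus> b)"
  by (simp flip: adj_diff)

context
  fixes f g :: "nat \<Rightarrow> 'a" and x y
  assumes f [simp]: "\<And>n. f n \<in> carrier A" and g [simp]: "\<And>n. g n \<in> carrier A"
    and x [simp]: "x \<in> carrier A" and y [simp]: "y \<in> carrier A"
    and fx: "(\<lambda>n. p (f n \<ominus> x)) \<longlonglongrightarrow> 0" and gy: "(\<lambda>n. p (g n \<ominus> y)) \<longlonglongrightarrow> 0"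
begin

lemma lim_add: "(\<lambda>n. p (f n \<oplus> g n \<ominus> (x \<oplus> y))) \<longlonglongrightarrow> 0"
  by (rule LIMSEQ_0_le[where g = "\<lambda>n. p (f n \<ominus> x) + p (g n \<ominus> y)"])
    (auto intro!: tendsto_eq_intros fx gy p_add_diff_add)

lemma lim_mult: "(\<lambda>n. p (f n \<otimes> g n \<ominus> x \<otimes> y)) \<longlonglongrightarrow> 0"
proof (rule LIMSEQ_0_le)
  show "(\<lambda>n. p (f n \<ominus> x) * (p (g n \<ominus> y) + p y) + p x * p (g n \<ominus> y)) \<longlonglongrightarrow> 0"
    by (rule tendsto_eq_intros fx gy refl | simp)+
  show "p (f n \<otimes> g n \<ominus> x \<otimes> y) \<le> p (f n \<ominus> x) * (p (g n \<ominus> y) + p y) + p x * p (g n \<ominus> y)" for n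
    by (rule order_trans[OF p_mult_diff_mult])
      (auto intro!: mult_left_mono p_le_diff)
qed auto

lemma lim_smult: "(\<lambda>n. p (c \<odot> f n \<ominus> c \<odot> x)) \<longlonglongrightarrow> 0"
  using tendsto_mult_left[OF fx, of "cmod c"] by (simp add: p_smult_diff_smult)

lemma lim_adj: "(\<lambda>n. p ((f n)\<^sup>\<star> \<ominus> x\<^sup>\<star>)) \<longlonglongrightarrow> 0"
  using fx by (simp add: p_adj_diff_adj)

text \<open>A seminorm determines limits only up to elements of seminorm zero. The hypothesis
  \<open>f = g\<close> identifies the two sequences fixed in the context.\<close>

lemma lim_unique_p: assumes "f = g" shows "p (x \<ominus> y) = 0"
proof -
  have "(\<lambda>n. p (f n \<ominus> x) + p (g n \<ominus> y)) \<longlonglongrightarrow> 0"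
    by (rule tendsto_eq_intros fx gy refl | simp)+
  then have "(\<lambda>n. p (x \<ominus> y)) \<longlonglongrightarrow> 0"
  proof (rule LIMSEQ_0_le)
    show "p (x \<ominus> y) \<le> p (f n \<ominus> x) + p (g n \<ominus> y)" for n
      using p_diff_triangle[of x "f n" y] p_diff_commute[of x "f n"] assms by simp
  qed simp
  then show ?thesis by (simp add: LIMSEQ_const_iff)
qed

end

text \<open>As convergence along a product filter the Cauchy condition is accessible to the usual
  arithmetic of limits.\<close>

lemma cauchy_seqs_iff: "f \<in> cauchy_seqs A p \<longleftrightarrow> (\<forall>n. f n \<in> carrier A) \<and>
    ((\<lambda>z. p (f (fst z) \<ominus> f (snd z))) \<longlongrightarrow> 0) (sequentially \<times>\<^sub>F sequentially)"
proof (cases "\<forall>n. f n \<in> carrier A")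
  case True
  then have "\<bar>p (f m \<ominus> f n)\<bar> = p (f m \<ominus> f n)" for m n by simp
  with True show ?thesis
    by (simp add: cauchy_seqs_def tendsto_iff eventually_prod_sequentially dist_real_def) blast
qed (auto simp: cauchy_seqs_def)

lemma cauchy_seqsD:
  "f \<in> cauchy_seqs A p \<Longrightarrow> f n \<in> carrier A"
  "f \<in> cauchy_seqs A p \<Longrightarrow>
    ((\<lambda>z. p (f (fst z) \<ominus> f (snd z))) \<longlongrightarrow> 0) (sequentially \<times>\<^sub>F sequentially)"
  by (auto simp: cauchy_seqs_iff)

lemma cauchy_seqsE:
  assumes "f \<in> cauchy_seqs A p" "0 < e"
  obtains N where "\<And>m n. N \<le> m \<Longrightarrow> N \<le> n \<Longrightarrow> p (f m \<ominus> f n) < e"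
  using assms unfolding cauchy_seqs_def by blast

lemma cauchy_seqsI:
  assumes "\<And>n. f n \<in> carrier A" "(g \<longlongrightarrow> 0) (sequentially \<times>\<^sub>F sequentially)"
    "\<And>m n. p (f m \<ominus> f n) \<le> g (m, n)"
  shows "f \<in> cauchy_seqs A p"
  unfolding cauchy_seqs_iff
  by (intro conjI allI assms(1) tendsto_sandwich[OF _ _ tendsto_const assms(2)] always_eventually)
    (use assms(1,3) in auto)

lemma cauchy_norm_convergent: assumes f: "f \<in> cauchy_seqs A p" shows "convergent (\<lambda>n. p (f n))"
proof (rule Cauchy_convergent, rule CauchyI)
  fix e :: real assume "0 < e"
  then obtain N where "\<And>m n. N \<le> m \<Longrightarrow> N \<le> n \<Longrightarrow> p (f m \<ominus> f n) < e"
    using f unfolding cauchy_seqs_def by blast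
  then show "\<exists>N. \<forall>m\<ge>N. \<forall>n\<ge>N. norm (p (f m) - p (f n)) < e"
    unfolding real_norm_def
    by (intro exI[of _ N] allI impI le_less_trans[OF abs_p_diff]) (auto simp: cauchy_seqsD(1)[OF f])
qed

lemma cauchy_bounded:
  assumes "f \<in> cauchy_seqs A p"
  obtains K where "0 \<le> K" "\<And>n. p (f n) \<le> K"
proof -
  obtain K where "\<And>n. norm (p (f n)) \<le> K"
    using convergent_imp_Bseq[OF cauchy_norm_convergent[OF assms]] by (auto simp: Bseq_def)
  then have "p (f n) \<le> K" for n by (metis abs_le_D1 real_norm_def)
  moreover from this[of 0] have "0 \<le> K"
    using order_trans[OF p_nonneg] cauchy_seqsD(1)[OF assms] by blast
  ultimately show ?thesis using that by blast
qed

lemma cauchy_const: "x \<in> carrier A \<Longrightarrow> (\<lambda>n. x) \<in> cauchy_seqs A p"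
  by (simp add: cauchy_seqs_iff)

lemma cauchy_add:
  assumes f: "f \<in> cauchy_seqs A p" and g: "g \<in> cauchy_seqs A p"
  shows "(\<lambda>n. f n \<oplus> g n) \<in> cauchy_seqs A p"
proof (rule cauchy_seqsI)
  show "((\<lambda>z. p (f (fst z) \<ominus> f (snd z)) + p (g (fst z) \<ominus> g (snd z))) \<longlongrightarrow> 0)
      (sequentially \<times>\<^sub>F sequentially)"
    by (rule tendsto_eq_intros cauchy_seqsD(2)[OF f] cauchy_seqsD(2)[OF g] refl | simp)+
qed (use f g in \<open>auto simp: cauchy_seqsD intro!: p_add_diff_add\<close>)

lemma cauchy_mult:
  assumes f: "f \<in> cauchy_seqs A p" and g: "g \<in> cauchy_seqs A p"
  shows "(\<lambda>n. f n \<otimes> g n) \<in> cauchy_seqs A p"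
proof -
  obtain K L where K: "\<And>n. p (f n) \<le> K" and L: "\<And>n. p (g n) \<le> L"
    using cauchy_bounded[OF f] cauchy_bounded[OF g] by metis
  note [simp] = cauchy_seqsD(1)[OF f] cauchy_seqsD(1)[OF g]
  show ?thesis
  proof (rule cauchy_seqsI)
    show "((\<lambda>z. p (f (fst z) \<ominus> f (snd z)) * L + K * p (g (fst z) \<ominus> g (snd z))) \<longlongrightarrow> 0)
        (sequentially \<times>\<^sub>F sequentially)"
      by (rule tendsto_eq_intros cauchy_seqsD(2)[OF f] cauchy_seqsD(2)[OF g] refl | simp)+
    show "p (f m \<otimes> g m \<ominus> f n \<otimes> g n) \<le>
        p (f (fst (m, n)) \<ominus> f (snd (m, n))) * L + K * p (g (fst (m, n)) \<ominus> g (snd (m, n)))" for m n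
      by (rule order_trans[OF p_mult_diff_mult])
        (auto intro!: add_mono mult_mono K L order_trans[OF p_nonneg K])
  qed simp
qed

lemma cauchy_smult: "f \<in> cauchy_seqs A p \<Longrightarrow> (\<lambda>n. c \<odot> f n) \<in> cauchy_seqs A p"
  using tendsto_mult_left[OF cauchy_seqsD(2), of f "cmod c"]
  by (auto simp: cauchy_seqs_iff p_smult_diff_smult)

lemma cauchy_adj: "f \<in> cauchy_seqs A p \<Longrightarrow> (\<lambda>n. (f n)\<^sup>\<star>) \<in> cauchy_seqs A p"
  by (auto simp: cauchy_seqs_iff p_adj_diff_adj)

abbreviation "C \<equiv> cauchy_alg A p"

lemma cauchy_alg_star_algebra: "star_algebra C"
proof -
  have "\<exists>g\<in>carrier C. g \<oplus>\<^bsub>C\<^esub> f = \<zero>\<^bsub>C\<^esub>" if f: "f \<in> carrier C" for f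
    using f cauchy_smult[of f "- 1"] cauchy_seqsD(1)[of f]
    by (intro bexI[of _ "\<lambda>n. (- 1) \<odot> f n"])
      (auto simp: cauchy_alg_def l_neg simp flip: minus_eq_smult)
  then have "ring C"
    by (intro ringI abelian_groupI monoidI)
      (auto simp: cauchy_alg_def cauchy_seqsD cauchy_const cauchy_add cauchy_mult
        a_assoc a_comm a_lcomm m_assoc l_distr r_distr)
  then show ?thesis
    by (intro star_algebra.intro star_algebra_axioms.intro)
      (auto simp: cauchy_alg_def cauchy_seqsD cauchy_smult cauchy_adj smult_l_distr smult_r_distr
        smult_assoc smult_mult_left smult_mult_right adj_add adj_smult adj_mult)
qed

lemma cauchy_diff:
  assumes "f \<in> carrier C" "g \<in> carrier C"
  shows "f \<ominus>\<^bsub>C\<^esub> g = (\<lambda>n. f n \<ominus> g n)"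
proof -
  interpret C: star_algebra C by (rule cauchy_alg_star_algebra)
  show ?thesis using assms unfolding a_minus_def C.minus_eq_smult[OF assms(2)]
    by (auto simp: cauchy_alg_def minus_eq_smult cauchy_seqsD)
qed

abbreviation "P f \<equiv> lim (\<lambda>n. p (f n))"

lemma P_lim: "f \<in> carrier C \<Longrightarrow> (\<lambda>n. p (f n)) \<longlonglongrightarrow> P f"
  using cauchy_norm_convergent by (simp add: cauchy_alg_def convergent_LIMSEQ_iff)

lemma cauchy_alg_seminorm: "cstar_seminorm C P"
proof -
  interpret C: star_algebra C by (rule cauchy_alg_star_algebra)
  have val: "f n \<in> carrier A" if "f \<in> carrier C" for f n
    using that by (simp add: cauchy_alg_def cauchy_seqsD)
  show ?thesis
    unfolding cstar_seminorm_def
  proof (intro conjI ballI allI)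
    fix f g c assume f: "f \<in> carrier C" and g: "g \<in> carrier C"
    show "P (f \<oplus>\<^bsub>C\<^esub> g) \<le> P f + P g"
      by (rule LIMSEQ_le[OF P_lim tendsto_add[OF P_lim P_lim]])
        (use f g in \<open>auto simp: cauchy_alg_def cauchy_seqsD intro!: p_triangle cauchy_add\<close>)
    show "P (f \<otimes>\<^bsub>C\<^esub> g) \<le> P f * P g"
      by (rule LIMSEQ_le[OF P_lim tendsto_mult[OF P_lim P_lim]])
        (use f g in \<open>auto simp: cauchy_alg_def cauchy_seqsD intro!: p_mult cauchy_mult\<close>)
  next
    fix f assume f: "f \<in> carrier C"
    show "0 \<le> P f"
      by (rule LIMSEQ_le_const[OF P_lim[OF f]]) (use f val in auto)
    show "P (c \<odot>\<^bsub>C\<^esub> f) = cmod c * P f" for c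
    proof (rule LIMSEQ_unique[OF P_lim])
      show "(\<lambda>n. p ((c \<odot>\<^bsub>C\<^esub> f) n)) \<longlonglongrightarrow> cmod c * P f"
        using tendsto_mult_left[OF P_lim[OF f]] f by (simp add: cauchy_alg_def p_smult cauchy_seqsD)
    qed (use f in simp)
    show "P (f\<^sup>\<star>\<^bsub>C\<^esub> \<otimes>\<^bsub>C\<^esub> f) = (P f)\<^sup>2"
    proof (rule LIMSEQ_unique[OF P_lim])
      show "(\<lambda>n. p ((f\<^sup>\<star>\<^bsub>C\<^esub> \<otimes>\<^bsub>C\<^esub> f) n)) \<longlonglongrightarrow> (P f)\<^sup>2"
        using tendsto_power[OF P_lim[OF f], of 2] f by (simp add: cauchy_alg_def p_cstar cauchy_seqsD)
    qed (use f in simp)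
  qed
qed

lemma kernel_star_ideal: "star_ideal A p {x \<in> carrier A. p x = 0}"
proof -
  let ?I = "{x \<in> carrier A. p x = 0}"
  have le0: "x \<in> carrier A \<Longrightarrow> p x \<le> 0 \<Longrightarrow> p x = 0" for x by (simp add: antisym)
  have "ideal ?I A"
  proof (rule idealI[OF ring_axioms])
    show "subgroup ?I (add_monoid A)"
    proof (rule add.subgroupI)
      show "x \<oplus> y \<in> ?I" if "x \<in> ?I" "y \<in> ?I" for x y
        using that p_triangle[of x y] by (auto intro: le0)
    qed (auto intro: exI[of _ \<zero>])
  qed (use p_mult le0 in fastforce)+
  then show ?thesis
    by (intro star_ideal.intro cstar_seminormed_axioms star_ideal_axioms.intro) auto
qed

end

text \<open>Two representatives differ by an element of seminorm zero, so \<open>p\<close> is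
  constant on the coset.\<close>

lemma (in star_ideal) cnorm_quot_kernel:
  assumes "\<And>x. x \<in> I \<Longrightarrow> p x = 0" and x: "x \<in> carrier A"
  shows "cnorm Q (I +> x) = p x"
proof (rule antisym[OF cnorm_quot_le[OF x x refl]])
  show "p x \<le> cnorm Q (I +> x)"
  proof (rule ccontr)
    assume "\<not> p x \<le> cnorm Q (I +> x)"
    then obtain y where y: "y \<in> carrier A" "I +> y = I +> x" "p y < p x"
      using cnorm_quot_less_iff[OF x, of "p x"] by auto
    then have "x \<ominus> y \<in> I" using coset_eq_iff[OF x y(1)] by simp
    then show False using p_le_diff[OF x y(1)] y(3) assms(1) by simp
  qed
qed

section \<open>The completion as Cauchy sequences modulo null sequences\<close>

context cstar_seminormed
begin

text \<open>Diagonal argument: the limit takes from the n-th Cauchy sequence an entry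
  \<open>N n\<close> beyond which that sequence varies by less than 1/(n+1).\<close>

lemma cauchy_alg_complete:
  assumes F: "F \<in> cauchy_seqs C P"
  shows "\<exists>g\<in>carrier C. (\<lambda>n. P (F n \<ominus>\<^bsub>C\<^esub> g)) \<longlonglongrightarrow> 0"
proof -
  interpret C: cstar_seminormed C P
    by (intro cstar_seminormed.intro cauchy_alg_star_algebra cstar_seminormed_axioms.intro cauchy_alg_seminorm)
  have FC [simp]: "F n \<in> carrier C" for n using F by (simp add: cauchy_seqs_def)
  then have FA [simp]: "F n k \<in> carrier A" for n k by (simp add: cauchy_alg_def cauchy_seqsD)
  have "\<exists>N. \<forall>i\<ge>N. \<forall>j\<ge>N. p (F n i \<ominus> F n j) < inverse (real (Suc n))" for n
    using FC[of n] unfolding cauchy_alg_def cauchy_seqs_def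
    by (auto simp del: FC of_nat_Suc)
  then obtain N where N: "\<And>n i j. N n \<le> i \<Longrightarrow> N n \<le> j \<Longrightarrow> p (F n i \<ominus> F n j) < inverse (real (Suc n))"
    by metis
  define g where "g n = F n (N n)" for n
  have g [simp]: "g n \<in> carrier A" for n by (simp add: g_def)
  have inv0: "(\<lambda>n. inverse (real (Suc n))) \<longlonglongrightarrow> 0" by (rule LIMSEQ_inverse_real_of_nat)
  \<comment> \<open>Entries of two sequences at different positions are compared through a common
    late position k. Letting k tend to infinity turns the middle term into the limit
    seminorm.\<close>
  have near: "p (g m \<ominus> g n) \<le> inverse (real (Suc m)) + inverse (real (Suc n)) + P (F m \<ominus>\<^bsub>C\<^esub> F n)" for m n
  proof (rule LIMSEQ_le)
    show "(\<lambda>k. p (g m \<ominus> g n)) \<longlonglongrightarrow> p (g m \<ominus> g n)" by simp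
    show "(\<lambda>k. inverse (real (Suc m)) + inverse (real (Suc n)) + p ((F m \<ominus>\<^bsub>C\<^esub> F n) k))
        \<longlonglongrightarrow> inverse (real (Suc m)) + inverse (real (Suc n)) + P (F m \<ominus>\<^bsub>C\<^esub> F n)"
      by (intro tendsto_intros P_lim) simp
    show "\<exists>K. \<forall>k\<ge>K. p (g m \<ominus> g n)
        \<le> inverse (real (Suc m)) + inverse (real (Suc n)) + p ((F m \<ominus>\<^bsub>C\<^esub> F n) k)"
    proof (intro exI[of _ "max (N m) (N n)"] allI impI)
      fix k assume k: "max (N m) (N n) \<le> k"
      have "p (g m \<ominus> g n) \<le> p (g m \<ominus> F m k) + (p (F m k \<ominus> F n k) + p (F n k \<ominus> g n))"
        using p_diff_triangle[of "g m" "F m k" "g n"] p_diff_triangle[of "F m k" "F n k" "g n"] by simp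
      moreover have "p (g m \<ominus> F m k) < inverse (real (Suc m))" "p (F n k \<ominus> g n) < inverse (real (Suc n))"
        unfolding g_def using k by (auto intro!: N simp del: of_nat_Suc)
      ultimately show "p (g m \<ominus> g n)
          \<le> inverse (real (Suc m)) + inverse (real (Suc n)) + p ((F m \<ominus>\<^bsub>C\<^esub> F n) k)"
        by (simp add: cauchy_diff)
    qed
  qed
  have fs: "filterlim fst sequentially (sequentially \<times>\<^sub>F sequentially)"
    "filterlim snd sequentially (sequentially \<times>\<^sub>F sequentially)"
    unfolding filterlim_iff by (auto simp: eventually_prod_sequentially eventually_sequentially)
  have g_cauchy: "g \<in> cauchy_seqs A p"
  proof (rule cauchy_seqsI)
    show "((\<lambda>z. inverse (real (Suc (fst z))) + inverse (real (Suc (snd z))) + P (F (fst z) \<ominus>\<^bsub>C\<^esub> F (snd z)))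
        \<longlongrightarrow> 0) (sequentially \<times>\<^sub>F sequentially)"
      by (rule tendsto_eq_intros filterlim_compose[OF inv0 fs(1)]
          filterlim_compose[OF inv0 fs(2)] C.cauchy_seqsD(2)[OF F] refl | simp)+
  qed (use near in auto)
  then have gC: "g \<in> carrier C" by (simp add: cauchy_alg_def)
  have "(\<lambda>n. P (F n \<ominus>\<^bsub>C\<^esub> g)) \<longlonglongrightarrow> 0"
  proof (rule LIMSEQ_I)
    fix e :: real assume e: "0 < e"
    obtain M1 where M1: "\<And>n. M1 \<le> n \<Longrightarrow> inverse (real (Suc n)) < e / 3"
      using LIMSEQ_D[OF inv0, of "e / 3"] e by (auto simp del: of_nat_Suc)
    have "0 < e / 3" using e by simp
    then obtain M2 where M2: "\<And>m n. M2 \<le> m \<Longrightarrow> M2 \<le> n \<Longrightarrow> p (g m \<ominus> g n) < e / 3"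
      using cauchy_seqsE[OF g_cauchy] by blast
    have "P (F n \<ominus>\<^bsub>C\<^esub> g) \<le> e / 3 + e / 3" if n: "max M1 M2 \<le> n" for n
    proof (rule LIMSEQ_le_const2[OF P_lim])
      show "\<exists>K. \<forall>k\<ge>K. p ((F n \<ominus>\<^bsub>C\<^esub> g) k) \<le> e / 3 + e / 3"
      proof (intro exI[of _ "max M2 (N n)"] allI impI)
        fix k assume k: "max M2 (N n) \<le> k"
        have "p (F n k \<ominus> g k) \<le> p (F n k \<ominus> g n) + p (g n \<ominus> g k)" by (simp add: p_diff_triangle)
        moreover have "p (F n k \<ominus> g n) < inverse (real (Suc n))"
          unfolding g_def using k by (auto intro!: N simp del: of_nat_Suc)
        ultimately show "p ((F n \<ominus>\<^bsub>C\<^esub> g) k) \<le> e / 3 + e / 3"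
          using M1[of n] M2[of n k] n k gC by (simp add: cauchy_diff)
      qed
    qed (use gC in simp)
    moreover have "0 \<le> P (F n \<ominus>\<^bsub>C\<^esub> g)" for n using gC by simp
    ultimately show "\<exists>M. \<forall>n\<ge>M. norm (P (F n \<ominus>\<^bsub>C\<^esub> g) - 0) < e"
      using e by (intro exI[of _ "max M1 M2"]) (fastforce simp: abs_of_nonneg)
  qed
  with gC show ?thesis by blast
qed

lemma null_seqs_star_ideal: "star_ideal C P (null_seqs A p)"
proof -
  interpret C: cstar_seminormed C P
    by (intro cstar_seminormed.intro cauchy_alg_star_algebra cstar_seminormed_axioms.intro cauchy_alg_seminorm)
  have "(\<lambda>n. p (f n)) \<longlonglongrightarrow> 0 \<longleftrightarrow> P f = 0" if "f \<in> carrier C" for f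
    using P_lim[OF that] by (metis limI)
  then have "null_seqs A p = {f \<in> carrier C. P f = 0}"
    by (auto simp: null_seqs_def cauchy_alg_def)
  then show ?thesis using C.kernel_star_ideal by simp
qed

lemma P_null: "f \<in> null_seqs A p \<Longrightarrow> P f = 0"
  by (simp add: null_seqs_def limI)

theorem completion_cstar_algebra: "cstar_algebra (completion A p)"
proof -
  interpret N: star_ideal C P "null_seqs A p" by (rule null_seqs_star_ideal)
  show ?thesis unfolding completion_def
  proof (rule N.quot_cstar_algebra[OF _ cauchy_alg_complete])
    fix f assume f: "f \<in> carrier C" and small: "\<And>e. 0 < e \<Longrightarrow> \<exists>g\<in>null_seqs A p. P (f \<ominus>\<^bsub>C\<^esub> g) < e"
    have "P f \<le> 0"
    proof (rule field_le_epsilon)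
      fix e :: real assume "0 < e"
      then obtain g where g: "g \<in> null_seqs A p" "P (f \<ominus>\<^bsub>C\<^esub> g) < e" using small by blast
      then show "P f \<le> 0 + e" using N.p_le_diff[OF f N.Icarr[OF g(1)]] P_null[OF g(1)] by simp
    qed
    then have "P f = 0" using N.p_nonneg[OF f] by simp
    then show "f \<in> null_seqs A p" using P_lim[OF f] f by (simp add: null_seqs_def cauchy_alg_def)
  qed
qed

lemma completion_emb_hom: "completion_emb A p \<in> star_hom A (completion A p)"
proof -
  interpret N: star_ideal C P "null_seqs A p" by (rule null_seqs_star_ideal)
  have "(\<lambda>x n. x) \<in> star_hom A C"
    by (auto simp: star_hom_def ring_hom_def cauchy_alg_def cauchy_const)
  from star_hom_comp[OF this N.quot_hom] show ?thesis
    by (simp add: completion_def comp_def completion_emb_def[abs_def])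
qed

lemma cnorm_completion_emb: "x \<in> carrier A \<Longrightarrow> cnorm (completion A p) (completion_emb A p x) = p x"
proof -
  interpret N: star_ideal C P "null_seqs A p" by (rule null_seqs_star_ideal)
  assume "x \<in> carrier A"
  then show ?thesis
    using N.cnorm_quot_kernel[OF P_null, of "\<lambda>n. x"]
    by (simp add: completion_def completion_emb_def cauchy_alg_def cauchy_const)
qed

text \<open>A Cauchy sequence that represents \<open>X\<close> approximates it: the n-th constant
  sequence is at distance lim_k p(f n - f k), and this tends to 0.\<close>

lemma completion_dense:
  assumes "X \<in> carrier (completion A p)"
  shows "\<exists>f. (\<forall>n. f n \<in> carrier A) \<and> converges_to (completion A p) (\<lambda>n. completion_emb A p (f n)) X"
proof -
  interpret N: star_ideal C P "null_seqs A p" by (rule null_seqs_star_ideal)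
  obtain f where f: "f \<in> carrier C" "X = null_seqs A p +>\<^bsub>C\<^esub> f"
    using assms by (auto simp: completion_def N.quot_carrier)
  have fc: "f \<in> cauchy_seqs A p" using f by (simp add: cauchy_alg_def)
  have c: "(\<lambda>k. f n) \<in> carrier C" for n using cauchy_seqsD(1)[OF fc] by (simp add: cauchy_alg_def cauchy_const)
  have d: "(\<lambda>k. f n \<ominus> f k) \<in> carrier C" for n
    using N.minus_closed[OF c f(1), of n] cauchy_diff[OF c f(1), of n] by simp
  have *: "cnorm (completion A p) (completion_emb A p (f n) \<ominus>\<^bsub>completion A p\<^esub> X) = P (\<lambda>k. f n \<ominus> f k)" for n
    unfolding completion_def completion_emb_def f(2)
    using f(1) c[of n] d[of n] N.cnorm_quot_kernel[OF P_null d] by (simp add: N.quot_diff cauchy_diff)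
  have "(\<lambda>n. P (\<lambda>k. f n \<ominus> f k)) \<longlonglongrightarrow> 0"
  proof (rule LIMSEQ_I)
    fix e :: real assume e: "0 < e"
    have "0 < e / 2" using e by simp
    then obtain M where M: "\<And>m n. M \<le> m \<Longrightarrow> M \<le> n \<Longrightarrow> p (f m \<ominus> f n) < e / 2"
      using cauchy_seqsE[OF fc] by blast
    have "P (\<lambda>k. f n \<ominus> f k) \<le> e / 2" if "M \<le> n" for n
      by (rule LIMSEQ_le_const2[OF P_lim[OF d]]) (use M that in \<open>force intro: less_imp_le\<close>)
    moreover have "0 \<le> P (\<lambda>k. f n \<ominus> f k)" for n using N.p_nonneg[OF d] .
    ultimately show "\<exists>M. \<forall>n\<ge>M. norm (P (\<lambda>k. f n \<ominus> f k) - 0) < e"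
      using e by (intro exI[of _ M]) (fastforce simp: abs_of_nonneg)
  qed
  then show ?thesis
    by (intro exI[of _ f]) (simp add: converges_to_def * cauchy_seqsD(1)[OF fc])
qed

text \<open>The bound \<open>le\<close> maps Cauchy sequences to Cauchy sequences of
  \<open>B\<close>, and the extension takes their limits. Null sequences go to zero, so it descends
  to the completion.\<close>

theorem completion_lift:
  assumes B: "cstar_algebra B" and \<phi>: "\<phi> \<in> star_hom A B"
    and le: "\<And>x. x \<in> carrier A \<Longrightarrow> cnorm B (\<phi> x) \<le> p x"
  shows "\<exists>\<psi>\<in>star_hom (completion A p) B. \<forall>x\<in>carrier A. \<psi> (completion_emb A p x) = \<phi> x"
proof -
  interpret B: cstar_algebra B by fact
  interpret N: star_ideal C P "null_seqs A p" by (rule null_seqs_star_ideal)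
  note \<phi>_simps [simp] = star_homD[OF \<phi>] star_hom_diff[OF \<phi> star_algebra_axioms B.star_algebra_axioms]
  define L where "L f = (SOME y. y \<in> carrier B \<and> converges_to B (\<lambda>n. \<phi> (f n)) y)" for f
  have L: "L f \<in> carrier B \<and> (\<lambda>n. cnorm B (\<phi> (f n) \<ominus>\<^bsub>B\<^esub> L f)) \<longlonglongrightarrow> 0" if "f \<in> carrier C" for f
  proof -
    have f: "f \<in> cauchy_seqs A p" using that by (simp add: cauchy_alg_def)
    have "(\<lambda>n. \<phi> (f n)) \<in> cauchy_seqs B (cnorm B)"
    proof (rule B.cauchy_seqsI)
      show "((\<lambda>z. p (f (fst z) \<ominus> f (snd z))) \<longlongrightarrow> 0) (sequentially \<times>\<^sub>F sequentially)"
        by (rule cauchy_seqsD(2)[OF f])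
      show "cnorm B (\<phi> (f m) \<ominus>\<^bsub>B\<^esub> \<phi> (f n)) \<le> p (f (fst (m, n)) \<ominus> f (snd (m, n)))" for m n
        using le[of "f m \<ominus> f n"] cauchy_seqsD(1)[OF f] by simp
    qed (simp add: cauchy_seqsD(1)[OF f])
    then have "\<exists>y. y \<in> carrier B \<and> converges_to B (\<lambda>n. \<phi> (f n)) y" using B.complete by blast
    from someI_ex[OF this] show ?thesis by (simp add: L_def converges_to_def)
  qed
  \<comment> \<open>Any limit is the value of \<open>L\<close>, so each homomorphism law reduces to
    exhibiting the expected limit.\<close>
  have LI: "L f = y" if f: "f \<in> carrier C" and y: "y \<in> carrier B"
    and lim: "(\<lambda>n. cnorm B (\<phi> (f n) \<ominus>\<^bsub>B\<^esub> y)) \<longlonglongrightarrow> 0" for f y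
  proof -
    have "\<phi> (f n) \<in> carrier B" for n using f by (simp add: cauchy_alg_def cauchy_seqsD)
    then have "cnorm B (L f \<ominus>\<^bsub>B\<^esub> y) = 0"
      using B.lim_unique_p[of "\<lambda>n. \<phi> (f n)" "\<lambda>n. \<phi> (f n)" "L f" y] L[OF f] y lim by blast
    then show ?thesis
      using B.cnorm_definite[of "L f \<ominus>\<^bsub>B\<^esub> y"] L[OF f] y by (simp add: B.diff_eq_zero)
  qed
  have val [simp]: "f n \<in> carrier A" if "f \<in> carrier C" for f n
    using that by (simp add: cauchy_alg_def cauchy_seqsD)
  have "L \<in> star_hom C B"
    unfolding star_hom_def
  proof (intro CollectI conjI ballI allI ring_hom_memI)
    fix f g assume f: "f \<in> carrier C" and g: "g \<in> carrier C"
    show "L (f \<otimes>\<^bsub>C\<^esub> g) = L f \<otimes>\<^bsub>B\<^esub> L g"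
      using B.lim_mult[of "\<lambda>n. \<phi> (f n)" "\<lambda>n. \<phi> (g n)" "L f" "L g"] L[OF f] L[OF g] f g
      by (intro LI) (simp_all, simp_all add: cauchy_alg_def cauchy_seqsD)
    show "L (f \<oplus>\<^bsub>C\<^esub> g) = L f \<oplus>\<^bsub>B\<^esub> L g"
      using B.lim_add[of "\<lambda>n. \<phi> (f n)" "\<lambda>n. \<phi> (g n)" "L f" "L g"] L[OF f] L[OF g] f g
      by (intro LI) (simp_all, simp_all add: cauchy_alg_def cauchy_seqsD)
  next
    fix f c assume f: "f \<in> carrier C"
    show "L f \<in> carrier B" using L[OF f] by simp
    show "L (c \<odot>\<^bsub>C\<^esub> f) = c \<odot>\<^bsub>B\<^esub> L f"
      using B.lim_smult[of "\<lambda>n. \<phi> (f n)" "\<lambda>n. \<phi> (f n)" "L f" "L f" c] L[OF f] f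
      by (intro LI) (simp_all, simp_all add: cauchy_alg_def cauchy_seqsD)
    show "L (f\<^sup>\<star>\<^bsub>C\<^esub>) = (L f)\<^sup>\<star>\<^bsub>B\<^esub>"
      using B.lim_adj[of "\<lambda>n. \<phi> (f n)" "\<lambda>n. \<phi> (f n)" "L f" "L f"] L[OF f] f
      by (intro LI) (simp_all, simp_all add: cauchy_alg_def cauchy_seqsD)
  next
    show "L \<one>\<^bsub>C\<^esub> = \<one>\<^bsub>B\<^esub>" by (intro LI) (simp_all, simp_all add: cauchy_alg_def)
  qed
  moreover have "L f = \<zero>\<^bsub>B\<^esub>" if "f \<in> null_seqs A p" for f
  proof (rule LI)
    show f: "f \<in> carrier C" using that by (rule N.Icarr)
    have "(\<lambda>n. p (f n)) \<longlonglongrightarrow> 0" using that by (simp add: null_seqs_def)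
    then show "(\<lambda>n. cnorm B (\<phi> (f n) \<ominus>\<^bsub>B\<^esub> \<zero>\<^bsub>B\<^esub>)) \<longlonglongrightarrow> 0"
      by (rule LIMSEQ_0_le) (simp_all add: f le)
  qed simp
  ultimately obtain \<psi> where \<psi>: "\<psi> \<in> star_hom (completion A p) B"
    "\<And>f. f \<in> carrier C \<Longrightarrow> \<psi> (null_seqs A p +>\<^bsub>C\<^esub> f) = L f"
    using N.quot_lift[OF _ B.star_algebra_axioms, of L] by (auto simp: completion_def)
  have "L (\<lambda>n. x) = \<phi> x" if "x \<in> carrier A" for x
    using that by (intro LI) (auto simp: cauchy_alg_def cauchy_const)
  then show ?thesis
    using \<psi> by (intro bexI[of _ \<psi>]) (auto simp: completion_emb_def cauchy_alg_def cauchy_const)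
qed

end

section \<open>Automatic continuity\<close>

lemma (in cstar_algebra) limit_unique:
  assumes "\<And>n. f n \<in> carrier A" "x \<in> carrier A" "y \<in> carrier A"
    and "(\<lambda>n. cnorm A (f n \<ominus> x)) \<longlonglongrightarrow> 0" "(\<lambda>n. cnorm A (f n \<ominus> y)) \<longlonglongrightarrow> 0"
  shows "x = y"
proof -
  have "cnorm A (x \<ominus> y) = 0" using lim_unique_p[of f f x y] assms by blast
  then show ?thesis using cnorm_definite[of "x \<ominus> y"] assms(2,3) by (simp add: diff_eq_zero)
qed

lemma (in star_algebra) half_add: "w \<in> carrier A \<Longrightarrow> (1/2) \<odot> (w \<oplus> w) = w"
  using smult_l_distr[of w "1/2" "1/2"] by (simp add: smult_r_distr)

text \<open>The square root of \<open>1 - h\<^sup>2\<close> is \<open>1 - z\<close> for the fixed point \<open>z\<close> of the contraction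
  \<open>z \<mapsto> (h\<^sup>2 + z\<^sup>2) / 2\<close>.\<close>

lemma (in cstar_algebra) sqrt_one_minus_square:
  assumes h [simp]: "h \<in> carrier A" and h_adj: "h\<^sup>\<star> = h" and h_less: "cnorm A h < 1"
  shows "\<exists>w\<in>carrier A. w\<^sup>\<star> = w \<and> w \<otimes> h = h \<otimes> w \<and> h \<otimes> h \<oplus> w \<otimes> w = \<one>"
proof -
  define a where "a = h \<otimes> h"
  define c where "c = cnorm A a"
  have a [simp]: "a \<in> carrier A" by (simp add: a_def)
  have "c = (cnorm A h)\<^sup>2" using p_cstar[of h] by (simp add: c_def a_def h_adj)
  then have c: "0 \<le> c" "c < 1" using h_less by (auto simp: abs_square_less_1)
  \<comment> \<open>Starting at 0 makes every iterate a real polynomial in \<open>a\<close>, hence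
    self-adjoint and commuting with \<open>h\<close>. The iterates stay in the ball of radius c < 1,
    since (c + c^2)/2 \<le> c, and there the map contracts with factor c.\<close>
  define z where "z = rec_nat \<zero> (\<lambda>n x. (1/2) \<odot> (a \<oplus> x \<otimes> x))"
  have z0: "z 0 = \<zero>" and zS: "z (Suc n) = (1/2) \<odot> (a \<oplus> z n \<otimes> z n)" for n by (simp_all add: z_def)
  have z [simp]: "z n \<in> carrier A" for n by (induction n) (simp_all add: z0 zS)
  have z_adj: "(z n)\<^sup>\<star> = z n" for n
    by (induction n) (simp_all add: z0 zS adj_smult adj_add adj_mult a_def h_adj)
  have z_comm: "z n \<otimes> h = h \<otimes> z n" for n
  proof (induction n)
    case (Suc n)
    have "z n \<otimes> z n \<otimes> h = h \<otimes> (z n \<otimes> z n)" by (metis Suc h m_assoc z)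
    then show ?case
      by (simp add: zS smult_mult_left smult_mult_right l_distr r_distr a_def m_assoc)
  qed (simp add: z0)
  have z_norm: "cnorm A (z n) \<le> c" for n
  proof (induction n)
    case (Suc n)
    have "cnorm A (a \<oplus> z n \<otimes> z n) \<le> c + c * c"
      using Suc c by (intro order_trans[OF p_triangle] add_mono order_trans[OF p_mult] mult_mono)
        (auto simp: c_def)
    also have "c * c \<le> c" using c by (simp add: mult_left_le)
    finally show ?case by (simp add: zS p_smult)
  qed (simp add: z0 c)
  have z_step: "cnorm A (z (Suc n) \<ominus> z n) \<le> c ^ n" for n
  proof (induction n)
    case 0
    show ?case using z_norm[of 1] c by (simp add: z0)
  next
    case (Suc n)
    have "(1/2) \<odot> (a \<oplus> x) \<ominus> (1/2) \<odot> (a \<oplus> y) = (1/2) \<odot> (x \<ominus> y)"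
      if "x \<in> carrier A" "y \<in> carrier A" for x y
      using that by (simp add: add_diff_add flip: smult_diff)
    from this[of "z (Suc n) \<otimes> z (Suc n)" "z n \<otimes> z n"]
    have "z (Suc (Suc n)) \<ominus> z (Suc n) = (1/2) \<odot> (z (Suc n) \<otimes> z (Suc n) \<ominus> z n \<otimes> z n)"
      by (simp flip: zS)
    then have "cnorm A (z (Suc (Suc n)) \<ominus> z (Suc n))
        = 1/2 * cnorm A (z (Suc n) \<otimes> z (Suc n) \<ominus> z n \<otimes> z n)"
      by (simp add: p_smult)
    also have "\<dots> \<le> 1/2 * (c ^ n * c + c * c ^ n)"
      using Suc z_norm c
      by (intro mult_left_mono order_trans[OF p_mult_diff_mult] add_mono mult_mono) auto
    finally show ?case by (simp add: mult.commute)
  qed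
  have "z \<in> cauchy_seqs A (cnorm A)"
    by (rule geometric_cauchy[OF z c z_step])
  then obtain y where y [simp]: "y \<in> carrier A" and lim: "(\<lambda>n. cnorm A (z n \<ominus> y)) \<longlonglongrightarrow> 0"
    using complete by (auto simp: converges_to_def)
  have const: "(\<lambda>n. cnorm A (x \<ominus> x)) \<longlonglongrightarrow> 0" if "x \<in> carrier A" for x using that by simp
  have "(\<lambda>n. cnorm A ((z n)\<^sup>\<star> \<ominus> y\<^sup>\<star>)) \<longlonglongrightarrow> 0"
    by (rule lim_adj[where g = z and y = y]) (simp_all add: lim)
  then have y_adj: "y\<^sup>\<star> = y" using lim limit_unique[of z "y\<^sup>\<star>" y] by (simp add: z_adj)
  have "(\<lambda>n. cnorm A (z n \<otimes> h \<ominus> y \<otimes> h)) \<longlonglongrightarrow> 0"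
    by (rule lim_mult) (simp_all add: lim)
  moreover have "(\<lambda>n. cnorm A (h \<otimes> z n \<ominus> h \<otimes> y)) \<longlonglongrightarrow> 0"
    by (rule lim_mult) (simp_all add: lim)
  ultimately have y_comm: "y \<otimes> h = h \<otimes> y"
    using limit_unique[of "\<lambda>n. h \<otimes> z n" "y \<otimes> h" "h \<otimes> y"] by (simp add: z_comm)
  have zz: "(\<lambda>n. cnorm A (z n \<otimes> z n \<ominus> y \<otimes> y)) \<longlonglongrightarrow> 0"
    by (rule lim_mult) (simp_all add: lim)
  have azz: "(\<lambda>n. cnorm A (a \<oplus> z n \<otimes> z n \<ominus> (a \<oplus> y \<otimes> y))) \<longlonglongrightarrow> 0"
    by (rule lim_add) (simp_all add: zz)
  have "(\<lambda>n. cnorm A (z (Suc n) \<ominus> (1/2) \<odot> (a \<oplus> y \<otimes> y))) \<longlonglongrightarrow> 0"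
    unfolding zS by (rule lim_smult[OF _ _ _ _ azz azz]) simp_all
  moreover have "(\<lambda>n. cnorm A (z (Suc n) \<ominus> y)) \<longlonglongrightarrow> 0" using lim by (rule LIMSEQ_Suc)
  ultimately have fix_y: "y = (1/2) \<odot> (a \<oplus> y \<otimes> y)"
    using limit_unique[of "\<lambda>n. z (Suc n)" y "(1/2) \<odot> (a \<oplus> y \<otimes> y)"] by simp
  \<comment> \<open>This is (1 - y)^2 = 1 - a with the square multiplied out, which is why the root
    will be 1 - y.\<close>
  have yy: "y \<oplus> y = a \<oplus> y \<otimes> y"
    using half_add[of "a \<oplus> y \<otimes> y"] by (metis a add.m_closed fix_y m_closed smult_r_distr y)
  define w where "w = \<one> \<ominus> y"
  have w: "w \<in> carrier A" "w\<^sup>\<star> = w" by (simp_all add: w_def adj_diff y_adj)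
  have comm: "w \<otimes> h = h \<otimes> w" by (simp add: w_def l_diff_distr r_diff_distr y_comm)
  have "w \<otimes> w = \<one> \<ominus> (y \<oplus> y) \<oplus> y \<otimes> y"
    by (simp add: w_def l_diff_distr r_diff_distr) (simp add: a_minus_def minus_add a_ac)
  then have "w \<otimes> w = \<one> \<ominus> a"
    by (simp add: yy) (simp add: a_minus_def minus_add a_assoc l_neg)
  then have "h \<otimes> h \<oplus> w \<otimes> w = \<one>" by (simp add: a_def a_minus_def a_lcomm[of "h \<otimes> h" \<one>] r_neg)
  with w comm show ?thesis by blast
qed

text \<open>With \<open>w\<close> the square root of \<open>1 - h\<^sup>2\<close> the element \<open>h + i w\<close> is unitary, so that every
  C*-seminorm of it is at most 1.\<close>

theorem (in cstar_algebra) seminorm_le_cnorm: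
  assumes p: "cstar_seminorm A p" and x: "x \<in> carrier A"
  shows "p x \<le> cnorm A x"
proof -
  interpret p: cstar_seminormed A p
    by (intro cstar_seminormed.intro star_algebra_axioms cstar_seminormed_axioms.intro p)
  have one: "p h \<le> 1" if h [simp]: "h \<in> carrier A" and hs: "h\<^sup>\<star> = h" "cnorm A h < 1" for h
  proof -
    obtain w where w [simp]: "w \<in> carrier A" and ws: "w\<^sup>\<star> = w" "w \<otimes> h = h \<otimes> w" "h \<otimes> h \<oplus> w \<otimes> w = \<one>"
      using sqrt_one_minus_square[OF h hs] by blast
    define W where "W = \<i> \<odot> w"
    have W [simp]: "W \<in> carrier A" by (simp add: W_def)
    have Wh: "W \<otimes> h = h \<otimes> W" by (simp add: W_def smult_mult_left smult_mult_right ws)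
    have WW: "W \<otimes> W = \<ominus> (w \<otimes> w)"
      by (simp add: W_def smult_mult_left smult_mult_right minus_eq_smult flip: smult_assoc)
    define u where "u = h \<oplus> W"
    have u [simp]: "u \<in> carrier A" by (simp add: u_def)
    have us: "u\<^sup>\<star> = h \<ominus> W"
      by (simp add: u_def W_def adj_add adj_smult hs ws minus_eq_smult a_minus_def flip: smult_assoc)
    have "u\<^sup>\<star> \<otimes> u = (h \<otimes> h \<ominus> h \<otimes> W) \<oplus> (h \<otimes> W \<ominus> \<ominus> (w \<otimes> w))"
      unfolding us by (simp add: u_def l_diff_distr r_distr Wh WW)
    also have "\<dots> = \<one>"
      using ws(3) by (simp add: a_minus_def a_assoc r_neg1)
    finally have "(p u)\<^sup>2 \<le> 1\<^sup>2" using p.p_cstar[OF u] p.p_one_le by simp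
    then have pu: "p u \<le> 1" by (rule power2_le_imp_le) simp
    have "u \<oplus> u\<^sup>\<star> = h \<oplus> h"
      unfolding us by (simp add: u_def a_minus_def a_assoc a_lcomm[of W h] r_neg)
    then have "h = (1/2) \<odot> (u \<oplus> u\<^sup>\<star>)" by (simp add: half_add)
    then have "p h = 1/2 * p (u \<oplus> u\<^sup>\<star>)" by (metis (no_types) add.m_closed adj_closed norm_divide norm_numeral norm_one p.p_smult u)
    also have "\<dots> \<le> 1/2 * (p u + p u)" using p.p_triangle[of u "u\<^sup>\<star>"] by simp
    finally show ?thesis using pu by simp
  qed
  \<comment> \<open>The unitary argument needs norm strictly below 1, so \<open>h\<close> is divided
    by a number slightly larger than its norm.\<close>
  have sa: "p h \<le> cnorm A h" if h [simp]: "h \<in> carrier A" and hs: "h\<^sup>\<star> = h" for h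
  proof (rule field_le_epsilon)
    fix e :: real assume e: "0 < e"
    define t where "t = cnorm A h + e"
    have t: "0 < t" "cnorm A h < t" using e by (auto simp: t_def add_nonneg_pos)
    have "p (complex_of_real (inverse t) \<odot> h) \<le> 1"
    proof (rule one)
      show "(complex_of_real (inverse t) \<odot> h)\<^sup>\<star> = complex_of_real (inverse t) \<odot> h" by (simp add: adj_smult hs)
      show "cnorm A (complex_of_real (inverse t) \<odot> h) < 1" using t by (simp add: p_smult norm_divide field_simps)
    qed simp
    then have "inverse t * p h \<le> 1" using t by (simp add: p.p_smult norm_inverse)
    then have "p h \<le> t" using t by (simp add: field_simps)
    then show "p h \<le> cnorm A h + e" by (simp add: t_def)
  qed
  \<comment> \<open>The C*-identity for both seminorms reduces the general case to the self-adjoint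
    element x* x.\<close>
  have "(p x)\<^sup>2 \<le> (cnorm A x)\<^sup>2"
    using sa[of "x\<^sup>\<star> \<otimes> x"] x by (simp add: adj_mult p_cstar p.p_cstar)
  then show ?thesis by (rule power2_le_imp_le) (simp add: x)
qed

text \<open>The norm of \<open>B\<close> pulled back along \<phi> is a C*-seminorm on
  \<open>A\<close>.\<close>

theorem star_hom_contractive:
  assumes A: "cstar_algebra A" and B: "cstar_algebra B" and \<phi>: "\<phi> \<in> star_hom A B" and x: "x \<in> carrier A"
  shows "cnorm B (\<phi> x) \<le> cnorm A x"
proof -
  interpret A: cstar_algebra A by fact
  interpret B: cstar_algebra B by fact
  show ?thesis
    using A.seminorm_le_cnorm[OF cstar_seminorm_comp[OF \<phi> A.star_algebra_axioms B.cstar_seminormed_axioms] x]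
    by simp
qed

text \<open>The elements on which \<phi> and \<psi> agree form a star subalgebra, and contractivity
  makes it norm closed.\<close>

lemma star_hom_eq_on_generated:
  assumes A: "cstar_algebra A" and B: "cstar_algebra B"
    and \<phi>: "\<phi> \<in> star_hom A B" and \<psi>: "\<psi> \<in> star_hom A B"
    and X: "X \<subseteq> carrier A" "\<And>x. x \<in> X \<Longrightarrow> \<phi> x = \<psi> x"
  shows "x \<in> cstar_generated A X \<Longrightarrow> \<phi> x = \<psi> x"
proof -
  interpret A: cstar_algebra A by fact
  interpret B: cstar_algebra B by fact
  let ?E = "{x \<in> carrier A. \<phi> x = \<psi> x}"
  note hom = star_homD[OF \<phi>] star_homD[OF \<psi>]
  have "subring ?E A"
    by (rule A.subringI) (auto simp: hom A.minus_eq_smult)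
  moreover have "norm_closed A ?E"
    unfolding norm_closed_def
  proof (intro allI impI)
    fix f x assume f: "\<forall>n. f n \<in> ?E" and x: "x \<in> carrier A" and lim: "converges_to A f x"
    have "(\<lambda>n. cnorm B (\<chi> (f n) \<ominus>\<^bsub>B\<^esub> \<chi> x)) \<longlonglongrightarrow> 0" if \<chi>: "\<chi> \<in> star_hom A B" for \<chi>
      using lim unfolding converges_to_def
    proof (rule LIMSEQ_0_le)
      show "cnorm B (\<chi> (f n) \<ominus>\<^bsub>B\<^esub> \<chi> x) \<le> cnorm A (f n \<ominus>\<^bsub>A\<^esub> x)" for n
        using star_hom_contractive[OF A B \<chi>, of "f n \<ominus>\<^bsub>A\<^esub> x"] f x
        by (simp add: star_hom_diff[OF \<chi> A.star_algebra_axioms B.star_algebra_axioms])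
    qed (use f x star_homD(1)[OF \<chi>] in auto)
    from this[OF \<phi>] this[OF \<psi>] have "\<phi> x = \<psi> x"
      using f x by (intro B.limit_unique[of "\<lambda>n. \<phi> (f n)"]) (auto simp: hom)
    then show "x \<in> ?E" using x by simp
  qed
  ultimately have "cstar_generated A X \<subseteq> ?E"
    unfolding cstar_generated_def using X by (intro Inter_lower) (auto simp: hom)
  then show "x \<in> cstar_generated A X \<Longrightarrow> \<phi> x = \<psi> x" by blast
qed

section \<open>Closed ideals generated by sets of relations\<close>

context cstar_algebra
begin

lemma closed_ideal_ideal: "X \<subseteq> carrier A \<Longrightarrow> ideal (closed_ideal A X) A"
  unfolding closed_ideal_def
  by (rule i_Intersect) (auto intro!: exI[of _ "carrier A"] simp: oneideal norm_closed_def)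

lemma closed_ideal_superset: "X \<subseteq> closed_ideal A X"
  by (auto simp: closed_ideal_def)

lemma closed_ideal_closed: "norm_closed A (closed_ideal A X)"
  unfolding closed_ideal_def norm_closed_def by blast

lemma norm_closedD:
  "norm_closed A D \<Longrightarrow> (\<And>n. f n \<in> D) \<Longrightarrow> x \<in> carrier A \<Longrightarrow> converges_to A f x \<Longrightarrow> x \<in> D"
  unfolding norm_closed_def by (drule spec[of _ f], drule spec[of _ x]) auto

lemma closed_ideal_least: "ideal I A \<Longrightarrow> norm_closed A I \<Longrightarrow> X \<subseteq> I \<Longrightarrow> closed_ideal A X \<subseteq> I"
  by (auto simp: closed_ideal_def)

text \<open>The elements whose adjoint lies in the closed ideal form again a closed ideal containing
  \<open>X\<close>, so by minimality they include the whole ideal.\<close>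

lemma closed_ideal_star_ideal:
  assumes X: "X \<subseteq> carrier A" "\<And>x. x \<in> X \<Longrightarrow> x\<^sup>\<star> \<in> X"
  shows "star_ideal A (cnorm A) (closed_ideal A X)"
proof -
  let ?I = "closed_ideal A X"
  interpret I: ideal ?I A by (rule closed_ideal_ideal[OF X(1)])
  let ?J = "{x \<in> carrier A. x\<^sup>\<star> \<in> ?I}"
  have "ideal ?J A"
  proof (rule idealI[OF ring_axioms])
    show "subgroup ?J (add_monoid A)"
      by (rule add.subgroupI) (auto simp: adj_add adj_minus intro!: exI[of _ \<zero>])
  qed (auto simp: adj_mult I.I_l_closed I.I_r_closed)
  moreover have "norm_closed A ?J"
    unfolding norm_closed_def
  proof (intro allI impI)
    fix f x assume f: "\<forall>n. f n \<in> ?J" and x: "x \<in> carrier A" and lim: "converges_to A f x"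
    have "converges_to A (\<lambda>n. (f n)\<^sup>\<star>) (x\<^sup>\<star>)"
      using lim f x by (simp add: converges_to_def p_adj_diff_adj)
    then have "x\<^sup>\<star> \<in> ?I" using f x norm_closedD[OF closed_ideal_closed, where f = "\<lambda>n. (f n)\<^sup>\<star>" and x = "x\<^sup>\<star>"] by simp
    then show "x \<in> ?J" using x by simp
  qed
  moreover have "X \<subseteq> ?J" using X closed_ideal_superset by blast
  ultimately have "?I \<subseteq> ?J" by (rule closed_ideal_least)
  then show ?thesis
    by (intro star_ideal.intro cstar_seminormed_axioms I.ideal_axioms star_ideal_axioms.intro) blast
qed

theorem closed_ideal_quot_cstar_algebra:
  assumes X: "X \<subseteq> carrier A" "\<And>x. x \<in> X \<Longrightarrow> x\<^sup>\<star> \<in> X"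
  shows "cstar_algebra (star_quot A (cnorm A) (closed_ideal A X))"
proof -
  interpret I: star_ideal A "cnorm A" "closed_ideal A X" by (rule closed_ideal_star_ideal[OF X])
  show ?thesis
  proof (rule I.quot_cstar_algebra)
    fix x assume x: "x \<in> carrier A"
      and small: "\<And>e. 0 < e \<Longrightarrow> \<exists>y\<in>closed_ideal A X. cnorm A (x \<ominus> y) < e"
    have "\<exists>y\<in>closed_ideal A X. cnorm A (x \<ominus> y) < inverse (real (Suc n))" for n
      by (rule small) simp
    then obtain f where f: "\<And>n. f n \<in> closed_ideal A X"
      "\<And>n. cnorm A (x \<ominus> f n) < inverse (real (Suc n))" by metis
    have "converges_to A f x"
      unfolding converges_to_def
    proof (rule LIMSEQ_0_le[OF LIMSEQ_inverse_real_of_nat])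
      show "cnorm A (f n \<ominus> x) \<le> inverse (real (Suc n))" for n
        using f(2)[of n] p_diff_commute[OF x I.Icarr[OF f(1)[of n]]] by simp
    qed (use x I.Icarr[OF f(1)] in simp)
    then show "x \<in> closed_ideal A X" by (rule norm_closedD[OF closed_ideal_closed f(1) x])
  next
    fix f assume "f \<in> cauchy_seqs A (cnorm A)"
    then show "\<exists>x\<in>carrier A. (\<lambda>n. cnorm A (f n \<ominus> x)) \<longlonglongrightarrow> 0"
      using complete by (simp add: converges_to_def)
  qed
qed

text \<open>The kernel of \<phi> is an ideal that contains \<open>X\<close>. It is norm closed
  because \<phi> is contractive, so it contains the closed ideal.\<close>

theorem closed_ideal_quot_lift:
  assumes X: "X \<subseteq> carrier A" "\<And>x. x \<in> X \<Longrightarrow> x\<^sup>\<star> \<in> X"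
    and B: "cstar_algebra B" and \<phi>: "\<phi> \<in> star_hom A B" and zero: "\<And>x. x \<in> X \<Longrightarrow> \<phi> x = \<zero>\<^bsub>B\<^esub>"
  shows "\<exists>\<psi>\<in>star_hom (star_quot A (cnorm A) (closed_ideal A X)) B.
    \<forall>x\<in>carrier A. \<psi> (closed_ideal A X +> x) = \<phi> x"
proof -
  interpret B: cstar_algebra B by fact
  interpret I: star_ideal A "cnorm A" "closed_ideal A X" by (rule closed_ideal_star_ideal[OF X])
  note hom [simp] = star_homD[OF \<phi>] star_hom_zero[OF \<phi> star_algebra_axioms B.star_algebra_axioms]
    star_hom_diff[OF \<phi> star_algebra_axioms B.star_algebra_axioms]
  let ?K = "{x \<in> carrier A. \<phi> x = \<zero>\<^bsub>B\<^esub>}"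
  have "ideal ?K A"
  proof (rule idealI[OF ring_axioms])
    show "subgroup ?K (add_monoid A)"
      by (rule add.subgroupI) (auto simp: minus_eq_smult intro!: exI[of _ \<zero>])
  qed auto
  moreover have "norm_closed A ?K"
    unfolding norm_closed_def
  proof (intro allI impI)
    fix f x assume f: "\<forall>n. f n \<in> ?K" and x: "x \<in> carrier A" and lim: "converges_to A f x"
    have "(\<lambda>n. cnorm B (\<phi> x)) \<longlonglongrightarrow> 0"
      using lim unfolding converges_to_def
    proof (rule LIMSEQ_0_le)
      fix n
      have "cnorm B (\<phi> x) = cnorm B (\<phi> (x \<ominus> f n))" using f x by simp
      also have "\<dots> \<le> cnorm A (x \<ominus> f n)"
        using f x by (intro star_hom_contractive[OF cstar_algebra_axioms B \<phi>]) simp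
      also have "\<dots> = cnorm A (f n \<ominus> x)" using f x by (simp add: p_diff_commute)
      finally show "cnorm B (\<phi> x) \<le> cnorm A (f n \<ominus> x)" .
    qed (simp add: x)
    then show "x \<in> ?K" using x B.cnorm_definite[of "\<phi> x"] by (simp add: LIMSEQ_const_iff)
  qed
  moreover have "X \<subseteq> ?K" using X zero by blast
  ultimately have "closed_ideal A X \<subseteq> ?K" by (rule closed_ideal_least)
  then show ?thesis by (intro I.quot_lift[OF \<phi> B.star_algebra_axioms]) blast
qed

end

section \<open>The free star algebra\<close>

definition words :: "'i set \<Rightarrow> ('i \<times> bool) list set" where
  "words I = {w. fst ` set w \<subseteq> I}"

lemma words_simps [simp]:
  "[] \<in> words I" "x # w \<in> words I \<longleftrightarrow> fst x \<in> I \<and> w \<in> words I"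
  "v @ w \<in> words I \<longleftrightarrow> v \<in> words I \<and> w \<in> words I"
  by (auto simp: words_def)

definition adj_word :: "('i \<times> bool) list \<Rightarrow> ('i \<times> bool) list" where
  "adj_word w = rev (map (\<lambda>(i, b). (i, \<not> b)) w)"

definition single :: "complex \<Rightarrow> ('i \<times> bool) list \<Rightarrow> 'i free_elem" where
  "single c w = (\<lambda>v. if v = w then c else 0)"

lemma adj_word_simps [simp]:
  "adj_word [] = []" "adj_word (x # w) = adj_word w @ [(fst x, \<not> snd x)]"
  "length (adj_word w) = length w" "adj_word (adj_word w) = w"
  by (auto simp: adj_word_def case_prod_beta rev_map comp_def)

lemma adj_word_mem [simp]: "adj_word w \<in> words I \<longleftrightarrow> w \<in> words I"
  by (induction w) auto

lemma adj_word_eq_iff: "adj_word v = w \<longleftrightarrow> v = adj_word w"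
  by auto

lemma take_adj_word: "k \<le> length w \<Longrightarrow> take k (adj_word w) = adj_word (drop (length w - k) w)"
  and drop_adj_word: "k \<le> length w \<Longrightarrow> drop k (adj_word w) = adj_word (take (length w - k) w)"
  by (simp_all add: adj_word_def take_rev drop_rev take_map drop_map)

lemma free_star_alg_carrier:
  "carrier (free_star_alg I) = {f. finite {w. f w \<noteq> 0} \<and> {w. f w \<noteq> 0} \<subseteq> words I}"
  by (auto simp: free_star_alg_def words_def)

lemma free_mem_words: "f \<in> carrier (free_star_alg I) \<Longrightarrow> f w \<noteq> 0 \<Longrightarrow> w \<in> words I"
  by (auto simp: free_star_alg_carrier)

lemma free_star_alg_ops:
  "mult (free_star_alg I) f g = (\<lambda>w. \<Sum>k\<le>length w. f (take k w) * g (drop k w))"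
  "\<one>\<^bsub>free_star_alg I\<^esub> = single 1 []"
  "\<zero>\<^bsub>free_star_alg I\<^esub> = (\<lambda>w. 0)"
  "add (free_star_alg I) f g = (\<lambda>w. f w + g w)"
  "smult (free_star_alg I) c f = (\<lambda>w. c * f w)"
  "adj (free_star_alg I) f = (\<lambda>w. cnj (f (adj_word w)))"
  by (auto simp: free_star_alg_def adj_word_def single_def)

lemma single_mem: "w \<in> words I \<Longrightarrow> single c w \<in> carrier (free_star_alg I)"
  by (auto simp: free_star_alg_carrier single_def)

lemma letter_eq_single: "letter i = single 1 [(i, False)]"
  by (auto simp: letter_def single_def)

lemma letter_mem: "i \<in> I \<Longrightarrow> letter i \<in> carrier (free_star_alg I)"
  by (simp add: letter_eq_single single_mem)

lemma free_mult_closed: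
  assumes f: "f \<in> carrier (free_star_alg I)" and g: "g \<in> carrier (free_star_alg I)"
  shows "f \<otimes>\<^bsub>free_star_alg I\<^esub> g \<in> carrier (free_star_alg I)"
proof -
  let ?h = "f \<otimes>\<^bsub>free_star_alg I\<^esub> g"
  let ?S = "(\<lambda>(u, v). u @ v) ` ({w. f w \<noteq> 0} \<times> {w. g w \<noteq> 0})"
  have "{w. ?h w \<noteq> 0} \<subseteq> ?S"
  proof safe
    fix w assume "?h w \<noteq> 0"
    then obtain k where "f (take k w) * g (drop k w) \<noteq> 0"
      by (auto simp: free_star_alg_ops elim: sum.not_neutral_contains_not_neutral)
    then show "w \<in> ?S" by (auto intro!: image_eqI[of _ _ "(take k w, drop k w)"])
  qed
  moreover have "finite ?S" "?S \<subseteq> words I" using f g by (auto simp: free_star_alg_carrier)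
  ultimately show ?thesis by (auto simp: free_star_alg_carrier intro: finite_subset)
qed

lemma free_add_closed:
  assumes f: "f \<in> carrier (free_star_alg I)" and g: "g \<in> carrier (free_star_alg I)"
  shows "f \<oplus>\<^bsub>free_star_alg I\<^esub> g \<in> carrier (free_star_alg I)"
proof -
  have "{w. f w + g w \<noteq> 0} \<subseteq> {w. f w \<noteq> 0} \<union> {w. g w \<noteq> 0}" by auto
  then show ?thesis
    using f g unfolding free_star_alg_carrier free_star_alg_ops
    by (blast intro: finite_subset)
qed

lemma free_smult_closed:
  "f \<in> carrier (free_star_alg I) \<Longrightarrow> c \<odot>\<^bsub>free_star_alg I\<^esub> f \<in> carrier (free_star_alg I)"
  by (auto simp: free_star_alg_carrier free_star_alg_ops elim: finite_subset[rotated])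

lemma free_adj_closed:
  assumes f: "f \<in> carrier (free_star_alg I)"
  shows "f\<^sup>\<star>\<^bsub>free_star_alg I\<^esub> \<in> carrier (free_star_alg I)"
proof -
  have "{w. f (adj_word w) \<noteq> 0} = adj_word ` {w. f w \<noteq> 0}"
    by (auto intro!: image_eqI[of _ adj_word "adj_word _"])
  then show ?thesis using f by (auto simp: free_star_alg_carrier free_star_alg_ops)
qed

text \<open>Both sides sum over all cuts of the word w into three consecutive pieces. On the left
  the outer cut is chosen first, which gives a triangular index set that has to be
  reindexed.\<close>

lemma free_mult_assoc:
  "(f \<otimes>\<^bsub>free_star_alg I\<^esub> g) \<otimes>\<^bsub>free_star_alg I\<^esub> h = f \<otimes>\<^bsub>free_star_alg I\<^esub> (g \<otimes>\<^bsub>free_star_alg I\<^esub> h)"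
proof
  fix w :: "('a \<times> bool) list"
  let ?n = "length w"
  let ?\<phi> = "\<lambda>j i. f (take j w) * (g (take i (drop j w)) * h (drop (i + j) w))"
  have "((f \<otimes>\<^bsub>free_star_alg I\<^esub> g) \<otimes>\<^bsub>free_star_alg I\<^esub> h) w = (\<Sum>k\<le>?n. \<Sum>j\<le>k. ?\<phi> j (k - j))"
    unfolding free_star_alg_ops sum_distrib_right
    by (intro sum.cong) (auto simp: min_def drop_take mult.assoc)
  also have "\<dots> = (\<Sum>(j, i)\<in>{(j, i). j + i \<le> ?n}. ?\<phi> j i)"
    by (rule sum.triangle_reindex_eq[symmetric])
  also have "{(j, i). j + i \<le> ?n} = Sigma {..?n} (\<lambda>j. {..?n - j})" by auto
  also have "(\<Sum>(j, i)\<in>\<dots>. ?\<phi> j i) = (\<Sum>j\<le>?n. \<Sum>i\<le>?n - j. ?\<phi> j i)"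
    by (rule sum.Sigma[symmetric]) auto
  also have "\<dots> = (f \<otimes>\<^bsub>free_star_alg I\<^esub> (g \<otimes>\<^bsub>free_star_alg I\<^esub> h)) w"
    unfolding free_star_alg_ops sum_distrib_left by (intro sum.cong) auto
  finally show "((f \<otimes>\<^bsub>free_star_alg I\<^esub> g) \<otimes>\<^bsub>free_star_alg I\<^esub> h) w =
    (f \<otimes>\<^bsub>free_star_alg I\<^esub> (g \<otimes>\<^bsub>free_star_alg I\<^esub> h)) w" .
qed

lemma free_one_mult: "\<one>\<^bsub>free_star_alg I\<^esub> \<otimes>\<^bsub>free_star_alg I\<^esub> f = f"
proof
  fix w
  have "(\<one>\<^bsub>free_star_alg I\<^esub> \<otimes>\<^bsub>free_star_alg I\<^esub> f) w = (\<Sum>k\<le>length w. if k = 0 then f w else 0)"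
    unfolding free_star_alg_ops by (intro sum.cong) (auto simp: single_def)
  then show "(\<one>\<^bsub>free_star_alg I\<^esub> \<otimes>\<^bsub>free_star_alg I\<^esub> f) w = f w" by simp
qed

lemma free_mult_one: "f \<otimes>\<^bsub>free_star_alg I\<^esub> \<one>\<^bsub>free_star_alg I\<^esub> = f"
proof
  fix w
  have "(f \<otimes>\<^bsub>free_star_alg I\<^esub> \<one>\<^bsub>free_star_alg I\<^esub>) w = (\<Sum>k\<le>length w. if k = length w then f w else 0)"
    unfolding free_star_alg_ops by (intro sum.cong) (auto simp: single_def)
  then show "(f \<otimes>\<^bsub>free_star_alg I\<^esub> \<one>\<^bsub>free_star_alg I\<^esub>) w = f w" by simp
qed

text \<open>Reversing a word turns the cut at k into the cut at \<open>length w - k\<close>.\<close>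

lemma free_adj_mult:
  "(f \<otimes>\<^bsub>free_star_alg I\<^esub> g)\<^sup>\<star>\<^bsub>free_star_alg I\<^esub> = g\<^sup>\<star>\<^bsub>free_star_alg I\<^esub> \<otimes>\<^bsub>free_star_alg I\<^esub> f\<^sup>\<star>\<^bsub>free_star_alg I\<^esub>"
proof
  fix w
  have "((f \<otimes>\<^bsub>free_star_alg I\<^esub> g)\<^sup>\<star>\<^bsub>free_star_alg I\<^esub>) w =
    (\<Sum>k\<le>length w. cnj (f (adj_word (drop (length w - k) w))) * cnj (g (adj_word (take (length w - k) w))))"
    by (simp add: free_star_alg_ops take_adj_word drop_adj_word)
  also have "\<dots> = (\<Sum>k\<le>length w. cnj (f (adj_word (drop k w))) * cnj (g (adj_word (take k w))))"
    by (rule sum.reindex_bij_witness[where i = "\<lambda>k. length w - k" and j = "\<lambda>k. length w - k"]) auto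
  also have "\<dots> = (g\<^sup>\<star>\<^bsub>free_star_alg I\<^esub> \<otimes>\<^bsub>free_star_alg I\<^esub> f\<^sup>\<star>\<^bsub>free_star_alg I\<^esub>) w"
    by (simp add: free_star_alg_ops mult.commute)
  finally show "((f \<otimes>\<^bsub>free_star_alg I\<^esub> g)\<^sup>\<star>\<^bsub>free_star_alg I\<^esub>) w =
    (g\<^sup>\<star>\<^bsub>free_star_alg I\<^esub> \<otimes>\<^bsub>free_star_alg I\<^esub> f\<^sup>\<star>\<^bsub>free_star_alg I\<^esub>) w" .
qed

theorem free_star_alg_star_algebra: "star_algebra (free_star_alg I)"
proof -
  let ?F = "free_star_alg I"
  have "\<exists>g\<in>carrier ?F. g \<oplus>\<^bsub>?F\<^esub> f = \<zero>\<^bsub>?F\<^esub>" if f: "f \<in> carrier ?F" for f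
    using free_smult_closed[OF f, of "- 1"]
    by (intro bexI[of _ "(- 1) \<odot>\<^bsub>?F\<^esub> f"]) (auto simp: free_star_alg_ops)
  moreover have "\<one>\<^bsub>?F\<^esub> \<in> carrier ?F" "\<zero>\<^bsub>?F\<^esub> \<in> carrier ?F"
    by (simp_all add: free_star_alg_ops single_mem) (simp add: free_star_alg_carrier)
  ultimately have "ring ?F"
    by (intro ringI abelian_groupI monoidI)
      (simp_all add: free_mult_assoc free_one_mult free_mult_one free_mult_closed free_add_closed,
        simp_all add: free_star_alg_ops algebra_simps sum.distrib)
  then show ?thesis
    by (intro star_algebra.intro star_algebra_axioms.intro free_smult_closed free_adj_closed free_adj_mult)
      (simp_all add: free_star_alg_ops algebra_simps sum_distrib_left)
qed

lemma free_single_mult_single: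
  "single c v \<otimes>\<^bsub>free_star_alg I\<^esub> single d w = single (c * d) (v @ w)"
proof
  fix x
  have "(single c v \<otimes>\<^bsub>free_star_alg I\<^esub> single d w) x
      = (\<Sum>k\<le>length x. if k = length v \<and> x = v @ w then c * d else 0)"
    unfolding free_star_alg_ops
  proof (intro sum.cong refl)
    fix k assume k: "k \<in> {..length x}"
    have "take k x = v \<and> drop k x = w \<longleftrightarrow> k = length v \<and> x = v @ w"
      using k by (auto simp: append_eq_conv_conj)
    then show "single c v (take k x) * single d w (drop k x) = (if k = length v \<and> x = v @ w then c * d else 0)"
      by (auto simp: single_def)
  qed
  then show "(single c v \<otimes>\<^bsub>free_star_alg I\<^esub> single d w) x = single (c * d) (v @ w) x"
    by (auto simp: single_def)
qed

lemma free_adj_single: "(single c w)\<^sup>\<star>\<^bsub>free_star_alg I\<^esub> = single (cnj c) (adj_word w)"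
  by (auto simp: free_star_alg_ops single_def adj_word_eq_iff)

lemma free_smult_single: "d \<odot>\<^bsub>free_star_alg I\<^esub> single c w = single (d * c) w"
  by (auto simp: free_star_alg_ops single_def)

text \<open>Monomials are split off one by one. The induction runs over a finite set of words
  containing the support, so a removed coefficient may be zero.\<close>

lemma free_induct_single [consumes 1, case_names zero add]:
  assumes f: "f \<in> carrier (free_star_alg I)"
    and zero: "Q \<zero>\<^bsub>free_star_alg I\<^esub>"
    and add: "\<And>c w f. w \<in> words I \<Longrightarrow> f \<in> carrier (free_star_alg I) \<Longrightarrow> Q f \<Longrightarrow>
      Q (single c w \<oplus>\<^bsub>free_star_alg I\<^esub> f)"
  shows "Q f"
proof -
  have "Q f" if "finite S" "{w. f w \<noteq> 0} \<subseteq> S" "S \<subseteq> words I" for S f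
    using that
  proof (induction S arbitrary: f)
    case empty
    then have "f = \<zero>\<^bsub>free_star_alg I\<^esub>" by (auto simp: free_star_alg_ops)
    then show ?case using zero by simp
  next
    case (insert x S)
    let ?g = "f(x := 0)"
    have "{w. ?g w \<noteq> 0} \<subseteq> S" using insert.prems(1) by auto
    then have "Q ?g" "?g \<in> carrier (free_star_alg I)"
      using insert by (auto simp: free_star_alg_carrier intro: finite_subset)
    moreover have "f = single (f x) x \<oplus>\<^bsub>free_star_alg I\<^esub> ?g" by (auto simp: free_star_alg_ops single_def)
    ultimately show ?case using add[of x ?g "f x"] insert.prems(2) by auto
  qed
  then show ?thesis using f by (auto simp: free_star_alg_carrier)
qed

lemma free_induct [consumes 1, case_names one letter add mult smult adj]:
  assumes f: "f \<in> carrier (free_star_alg I)"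
    and one: "Q \<one>\<^bsub>free_star_alg I\<^esub>"
    and letter: "\<And>i. i \<in> I \<Longrightarrow> Q (letter i)"
    and add: "\<And>f g. \<lbrakk>f \<in> carrier (free_star_alg I); g \<in> carrier (free_star_alg I); Q f; Q g\<rbrakk> \<Longrightarrow>
      Q (f \<oplus>\<^bsub>free_star_alg I\<^esub> g)"
    and mult: "\<And>f g. \<lbrakk>f \<in> carrier (free_star_alg I); g \<in> carrier (free_star_alg I); Q f; Q g\<rbrakk> \<Longrightarrow>
      Q (f \<otimes>\<^bsub>free_star_alg I\<^esub> g)"
    and smult: "\<And>c f. \<lbrakk>f \<in> carrier (free_star_alg I); Q f\<rbrakk> \<Longrightarrow> Q (c \<odot>\<^bsub>free_star_alg I\<^esub> f)"
    and adj: "\<And>f. \<lbrakk>f \<in> carrier (free_star_alg I); Q f\<rbrakk> \<Longrightarrow> Q (f\<^sup>\<star>\<^bsub>free_star_alg I\<^esub>)"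
  shows "Q f"
proof -
  interpret F: star_algebra "free_star_alg I" by (rule free_star_alg_star_algebra)
  have word: "Q (single 1 w)" if "w \<in> words I" for w
    using that
  proof (induction w)
    case Nil
    then show ?case using one by (simp add: free_star_alg_ops)
  next
    case (Cons x w)
    have i: "fst x \<in> I" using Cons.prems by simp
    have "Q (single 1 [x])"
    proof (cases "snd x")
      case True
      have "single 1 [x] = (letter (fst x))\<^sup>\<star>\<^bsub>free_star_alg I\<^esub>"
        using True by (simp add: letter_eq_single free_adj_single) (metis prod.collapse)
      then show ?thesis using adj letter letter_mem i by metis
    next
      case False
      then have "single 1 [x] = letter (fst x)" by (simp add: letter_eq_single) (metis prod.collapse)
      then show ?thesis using letter i by metis
    qed
    then show ?case
      using mult[of "single 1 [x]" "single 1 w"] Cons by (simp add: single_mem free_single_mult_single)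
  qed
  show ?thesis
    using f
  proof (induction f rule: free_induct_single)
    case zero
    \<comment> \<open>There is no premise for the zero polynomial; it is obtained as the unit
      multiplied by the scalar 0.\<close>
    then show ?case using smult[OF F.one_closed one, of 0] by simp
  next
    case (add c w f)
    then have "Q (single c w)"
      using smult[OF single_mem word, of w c] by (simp add: free_smult_single)
    then show ?case using add by (intro assms(4) single_mem)
  qed
qed

subsection \<open>Homomorphisms out of the free star algebra\<close>

context star_algebra
begin

lemma smult_finsum:
  "finite W \<Longrightarrow> f \<in> W \<rightarrow> carrier A \<Longrightarrow> c \<odot> (\<Oplus>w\<in>W. f w) = (\<Oplus>w\<in>W. c \<odot> f w)"
  by (induction W rule: finite_induct) (auto simp: smult_r_distr Pi_iff)

definition eval_letter :: "('i \<Rightarrow> 'a) \<Rightarrow> 'i \<times> bool \<Rightarrow> 'a" where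
  "eval_letter b x = (if snd x then (b (fst x))\<^sup>\<star> else b (fst x))"

definition eval_word :: "('i \<Rightarrow> 'a) \<Rightarrow> ('i \<times> bool) list \<Rightarrow> 'a" where
  "eval_word b w = foldr (\<lambda>x a. eval_letter b x \<otimes> a) w \<one>"

definition free_eval :: "('i \<Rightarrow> 'a) \<Rightarrow> 'i free_elem \<Rightarrow> 'a" where
  "free_eval b f = (\<Oplus>w\<in>{w. f w \<noteq> 0}. f w \<odot> eval_word b w)"

context
  fixes I :: "'i set" and b :: "'i \<Rightarrow> 'a"
  assumes b: "\<And>i. i \<in> I \<Longrightarrow> b i \<in> carrier A"
begin

lemma eval_letter_closed: "fst x \<in> I \<Longrightarrow> eval_letter b x \<in> carrier A"
  by (simp add: eval_letter_def b)

lemma eval_word_closed: "w \<in> words I \<Longrightarrow> eval_word b w \<in> carrier A"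
  by (induction w) (auto simp: eval_word_def eval_letter_closed)

lemma eval_word_append:
  "v \<in> words I \<Longrightarrow> w \<in> words I \<Longrightarrow> eval_word b (v @ w) = eval_word b v \<otimes> eval_word b w"
proof (induction v)
  case Nil
  then show ?case using eval_word_closed[of w] by (simp add: eval_word_def)
next
  case (Cons x v)
  then show ?case
    using eval_word_closed[of v] eval_word_closed[of w] eval_letter_closed[of x]
    by (simp add: eval_word_def m_assoc)
qed

lemma eval_word_adj: "w \<in> words I \<Longrightarrow> eval_word b (adj_word w) = (eval_word b w)\<^sup>\<star>"
proof (induction w)
  case Nil
  then show ?case by (simp add: eval_word_def)
next
  case (Cons x w)
  then have x: "eval_letter b x \<in> carrier A" "eval_letter b (fst x, \<not> snd x) = (eval_letter b x)\<^sup>\<star>"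
    by (auto simp: eval_letter_def b)
  have "eval_word b (adj_word (x # w)) = (eval_word b w)\<^sup>\<star> \<otimes> (eval_letter b x)\<^sup>\<star>"
    using Cons x by (simp add: eval_word_append) (simp add: eval_word_def)
  also have "\<dots> = (eval_word b (x # w))\<^sup>\<star>"
    using Cons.prems x eval_word_closed[of w] by (simp add: eval_word_def adj_mult)
  finally show ?case .
qed

text \<open>Words outside the support contribute zero. Allowing a larger index set lets polynomials
  with different supports be summed over the same words.\<close>

lemma free_eval_eq:
  assumes "finite W" "{w. f w \<noteq> 0} \<subseteq> W" "W \<subseteq> words I"
  shows "free_eval b f = (\<Oplus>w\<in>W. f w \<odot> eval_word b w)"
  unfolding free_eval_def
  by (rule add.finprod_mono_neutral_cong_left) (use assms in \<open>auto simp: eval_word_closed[OF subsetD[OF assms(3)]]\<close>)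

lemma free_eval_closed: assumes f: "f \<in> carrier (free_star_alg I)" shows "free_eval b f \<in> carrier A"
  unfolding free_eval_def
  by (rule finsum_closed) (auto simp: eval_word_closed[OF free_mem_words[OF f]])

lemma free_eval_add:
  assumes f: "f \<in> carrier (free_star_alg I)" and g: "g \<in> carrier (free_star_alg I)"
  shows "free_eval b (f \<oplus>\<^bsub>free_star_alg I\<^esub> g) = free_eval b f \<oplus> free_eval b g"
proof -
  let ?W = "{w. f w \<noteq> 0} \<union> {w. g w \<noteq> 0}"
  have W: "finite ?W" "?W \<subseteq> words I" using f g by (auto simp: free_star_alg_carrier)
  have ev: "eval_word b w \<in> carrier A" if "w \<in> ?W" for w
    using W(2) that by (intro eval_word_closed) blast
  have "free_eval b (f \<oplus>\<^bsub>free_star_alg I\<^esub> g) = (\<Oplus>w\<in>?W. (f w + g w) \<odot> eval_word b w)"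
    using W by (subst free_eval_eq[of ?W]) (auto simp: free_star_alg_ops)
  also have "\<dots> = (\<Oplus>w\<in>?W. f w \<odot> eval_word b w \<oplus> g w \<odot> eval_word b w)"
    using W by (intro finsum_cong') (auto simp: smult_l_distr ev)
  also have "\<dots> = (\<Oplus>w\<in>?W. f w \<odot> eval_word b w) \<oplus> (\<Oplus>w\<in>?W. g w \<odot> eval_word b w)"
    using W by (intro finsum_addf) (auto simp: ev)
  also have "\<dots> = free_eval b f \<oplus> free_eval b g"
    using W by (subst (1 2) free_eval_eq[of ?W]) auto
  finally show ?thesis .
qed

lemma free_eval_smult:
  assumes f: "f \<in> carrier (free_star_alg I)"
  shows "free_eval b (c \<odot>\<^bsub>free_star_alg I\<^esub> f) = c \<odot> free_eval b f"
proof -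
  let ?W = "{w. f w \<noteq> 0}"
  have W: "finite ?W" "?W \<subseteq> words I" using f by (auto simp: free_star_alg_carrier)
  have "free_eval b (c \<odot>\<^bsub>free_star_alg I\<^esub> f) = (\<Oplus>w\<in>?W. (c * f w) \<odot> eval_word b w)"
    using W by (subst free_eval_eq[of ?W]) (auto simp: free_star_alg_ops)
  also have "\<dots> = (\<Oplus>w\<in>?W. c \<odot> (f w \<odot> eval_word b w))"
    using W by (intro finsum_cong') (auto simp: smult_assoc eval_word_closed[OF free_mem_words[OF f]])
  also have "\<dots> = c \<odot> (\<Oplus>w\<in>?W. f w \<odot> eval_word b w)"
    using W by (intro smult_finsum[symmetric]) (auto simp: eval_word_closed[OF free_mem_words[OF f]])
  finally show ?thesis by (simp add: free_eval_def)
qed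

lemma free_eval_single: "w \<in> words I \<Longrightarrow> free_eval b (single c w) = c \<odot> eval_word b w"
  by (subst free_eval_eq[of "{w}"]) (auto simp: single_def eval_word_closed finsum_singleton)

lemma free_eval_zero: "free_eval b \<zero>\<^bsub>free_star_alg I\<^esub> = \<zero>"
  by (simp add: free_eval_def free_star_alg_ops)

text \<open>By bilinearity it suffices to treat monomials, which multiply by concatenation. The
  inner induction varies the right factor for a fixed monomial on the left, the outer one varies the
  left factor.\<close>

lemma free_eval_mult:
  assumes f: "f \<in> carrier (free_star_alg I)" and g: "g \<in> carrier (free_star_alg I)"
  shows "free_eval b (f \<otimes>\<^bsub>free_star_alg I\<^esub> g) = free_eval b f \<otimes> free_eval b g"
proof -
  interpret F: star_algebra "free_star_alg I" by (rule free_star_alg_star_algebra)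
  have 1: "free_eval b (single c v \<otimes>\<^bsub>free_star_alg I\<^esub> g) = (c \<odot> eval_word b v) \<otimes> free_eval b g"
    if v: "v \<in> words I" for c v
    using g
  proof (induction g rule: free_induct_single)
    case zero
    then show ?case using v by (simp add: single_mem free_eval_zero eval_word_closed)
  next
    case (add d w g)
    have "free_eval b (single c v \<otimes>\<^bsub>free_star_alg I\<^esub> (single d w \<oplus>\<^bsub>free_star_alg I\<^esub> g))
        = free_eval b (single (c * d) (v @ w)) \<oplus> free_eval b (single c v \<otimes>\<^bsub>free_star_alg I\<^esub> g)"
      using v add single_mem[OF v, of c] single_mem[OF add(1), of d]
        single_mem[of "v @ w" I "c * d"]
      by (subst F.r_distr) (auto simp: free_single_mult_single free_eval_add)
    also have "free_eval b (single (c * d) (v @ w)) = (c \<odot> eval_word b v) \<otimes> free_eval b (single d w)"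
      using v add by (simp add: free_eval_single eval_word_append eval_word_closed smult_mult_left
        smult_mult_right mult.commute flip: smult_assoc)
    finally show ?case
      using v add single_mem[OF add(1), of d]
      by (simp add: free_eval_add r_distr free_eval_closed eval_word_closed)
  qed
  show ?thesis
    using f
  proof (induction f rule: free_induct_single)
    case zero
    then show ?case using g by (simp add: free_eval_zero free_eval_closed)
  next
    case (add c v f)
    then show ?case
      using g single_mem[OF add(1), of c]
      by (simp add: F.l_distr free_eval_add 1 free_eval_single l_distr free_eval_closed eval_word_closed)
  qed
qed

lemma free_eval_adj:
  assumes f: "f \<in> carrier (free_star_alg I)"
  shows "free_eval b (f\<^sup>\<star>\<^bsub>free_star_alg I\<^esub>) = (free_eval b f)\<^sup>\<star>"
proof -
  interpret F: star_algebra "free_star_alg I" by (rule free_star_alg_star_algebra)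
  show ?thesis
    using f
  proof (induction f rule: free_induct_single)
    case zero
    then show ?case by (simp add: free_eval_zero)
  next
    case (add c w f)
    have "adj_word w \<in> words I" using add by simp
    then show ?case
      using add single_mem[OF add(1), of c] single_mem[of "adj_word w" I "cnj c"]
      by (simp add: F.adj_add free_adj_single free_eval_add free_eval_single adj_add adj_smult
        eval_word_adj eval_word_closed free_eval_closed)
  qed
qed

theorem free_eval_hom: "free_eval b \<in> star_hom (free_star_alg I) A"
proof -
  have "free_eval b \<one>\<^bsub>free_star_alg I\<^esub> = \<one>"
    using free_eval_single[of "[]" 1] by (simp add: free_star_alg_ops eval_word_def)
  then show ?thesis
    by (auto simp: star_hom_def free_eval_smult free_eval_adj intro!: ring_hom_memI free_eval_closed
      free_eval_mult free_eval_add)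
qed

lemma free_eval_letter: "i \<in> I \<Longrightarrow> free_eval b (letter i) = b i"
  by (simp add: letter_eq_single free_eval_single) (simp add: eval_word_def eval_letter_def b)

end

end

section \<open>Universal C*-algebras\<close>

lemma star_hom_mem_of_letters:
  assumes \<phi>: "\<phi> \<in> star_hom (free_star_alg I) B"
    and D: "\<one>\<^bsub>B\<^esub> \<in> D" "\<And>x y. x \<in> D \<Longrightarrow> y \<in> D \<Longrightarrow> x \<oplus>\<^bsub>B\<^esub> y \<in> D" "\<And>x y. x \<in> D \<Longrightarrow> y \<in> D \<Longrightarrow> x \<otimes>\<^bsub>B\<^esub> y \<in> D"
      "\<And>c x. x \<in> D \<Longrightarrow> c \<odot>\<^bsub>B\<^esub> x \<in> D" "\<And>x. x \<in> D \<Longrightarrow> x\<^sup>\<star>\<^bsub>B\<^esub> \<in> D"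
    and letters: "\<And>i. i \<in> I \<Longrightarrow> \<phi> (letter i) \<in> D"
    and f: "f \<in> carrier (free_star_alg I)"
  shows "\<phi> f \<in> D"
  using f by (induction f rule: free_induct) (auto simp: star_homD[OF \<phi>] D letters)

locale bounded_relations =
  fixes I :: "'i set" and R :: "'i free_elem set"
  assumes R_carrier: "R \<subseteq> carrier (free_star_alg I)"
    and bounded: "i \<in> I \<Longrightarrow> \<exists>K. \<forall>p. cstar_seminorm (free_star_alg I) p \<longrightarrow> (\<forall>r\<in>R. p r = 0) \<longrightarrow> p (letter i) \<le> K"
begin

abbreviation "F \<equiv> free_star_alg I"
abbreviation "U \<equiv> universal_cstar I R"
abbreviation "N \<equiv> universal_seminorm F R"
abbreviation "emb \<equiv> completion_emb F N"
abbreviation "adm p \<equiv> cstar_seminorm F p \<and> (\<forall>r\<in>R. p r = 0)"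

lemma F_star_algebra: "star_algebra F"
  by (rule free_star_alg_star_algebra)

lemma adm_seminormed: "adm p \<Longrightarrow> cstar_seminormed F p"
  by (simp add: cstar_seminormed_def F_star_algebra cstar_seminormed_axioms_def)

text \<open>The zero seminorm keeps the set under the supremum nonempty, as \<open>N_least\<close>
  requires, and yields nonnegativity of \<open>N\<close>.\<close>

lemma adm_zero: "adm (\<lambda>x. 0)"
  by (simp add: cstar_seminorm_def)

text \<open>A C*-seminorm is at most 1 on the unit and is controlled on sums, products, scalar
  multiples and adjoints by its values on the parts. Bounds on the generators thus spread to all
  polynomials, uniformly in p.\<close>

lemma adm_bounded: assumes "x \<in> carrier F" shows "\<exists>K. \<forall>p. adm p \<longrightarrow> p x \<le> K"
  using assms
proof (induction x rule: free_induct)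
  case one
  then show ?case using cstar_seminormed.p_one_le[OF adm_seminormed] by blast
next
  case (letter i)
  then show ?case using bounded by blast
next
  case (add f g)
  then obtain K L where KL: "\<And>p. adm p \<Longrightarrow> p f \<le> K" "\<And>p. adm p \<Longrightarrow> p g \<le> L" by metis
  have "p (f \<oplus>\<^bsub>F\<^esub> g) \<le> K + L" if "adm p" for p
    using cstar_seminormed.p_triangle[OF adm_seminormed[OF that] add(1,2)] KL[OF that] by linarith
  then show ?case by blast
next
  case (mult f g)
  then obtain K L where KL: "\<And>p. adm p \<Longrightarrow> p f \<le> K" "\<And>p. adm p \<Longrightarrow> p g \<le> L" by metis
  have "p (f \<otimes>\<^bsub>F\<^esub> g) \<le> K * L" if "adm p" for p
  proof -
    interpret p: cstar_seminormed F p by (rule adm_seminormed[OF that])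
    show ?thesis
      using p.p_mult[OF mult(1,2)] mult_mono[OF KL(1)[OF that] KL(2)[OF that]]
        order_trans[OF p.p_nonneg[OF mult(1)] KL(1)[OF that]] p.p_nonneg[OF mult(2)] by linarith
  qed
  then show ?case by blast
next
  case (smult c f)
  then obtain K where K: "\<And>p. adm p \<Longrightarrow> p f \<le> K" by metis
  have "p (c \<odot>\<^bsub>F\<^esub> f) \<le> cmod c * K" if "adm p" for p
    using cstar_seminormed.p_smult[OF adm_seminormed[OF that] smult(1)] K[OF that]
    by (simp add: mult_left_mono)
  then show ?case by blast
next
  case (adj f)
  then show ?case using cstar_seminormed.p_adj[OF adm_seminormed] by metis
qed

lemma N_upper: assumes "x \<in> carrier F" "adm p" shows "p x \<le> N x"
proof -
  obtain K where "\<And>p. adm p \<Longrightarrow> p x \<le> K" using adm_bounded[OF assms(1)] by blast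
  then have "bdd_above {p x | p. adm p}" by (auto intro!: bdd_aboveI[of _ K])
  then show ?thesis unfolding universal_seminorm_def by (rule cSup_upper[rotated]) (use assms in blast)
qed

lemma N_least: assumes "\<And>p. adm p \<Longrightarrow> p x \<le> c" shows "N x \<le> c"
  unfolding universal_seminorm_def by (rule cSup_least) (use adm_zero assms in blast)+

lemma N_nonneg: "x \<in> carrier F \<Longrightarrow> 0 \<le> N x"
  using N_upper[OF _ adm_zero] by simp

text \<open>The inequalities pass to the supremum. Homogeneity is an equality by scaling back with
  the inverse. In the C*-identity the bound p x \<le> sqrt (N (x* x)) holds for every admissible p,
  so the supremum is taken before squaring.\<close>

lemma N_seminorm: "cstar_seminorm F N"
proof -
  interpret F: star_algebra F by (rule F_star_algebra)
  show ?thesis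
    unfolding cstar_seminorm_def
  proof (intro conjI ballI allI N_nonneg)
    fix x y assume x: "x \<in> carrier F" and y: "y \<in> carrier F"
    show "N (x \<oplus>\<^bsub>F\<^esub> y) \<le> N x + N y"
    proof (rule N_least)
      fix p assume p: "adm p"
      then show "p (x \<oplus>\<^bsub>F\<^esub> y) \<le> N x + N y"
        using cstar_seminormed.p_triangle[OF adm_seminormed[OF p] x y] N_upper[OF x p] N_upper[OF y p]
        by linarith
    qed
    show "N (x \<otimes>\<^bsub>F\<^esub> y) \<le> N x * N y"
    proof (rule N_least)
      fix p assume p: "adm p"
      interpret p: cstar_seminormed F p by (rule adm_seminormed[OF p])
      show "p (x \<otimes>\<^bsub>F\<^esub> y) \<le> N x * N y"
        using p.p_mult[OF x y] mult_mono[OF N_upper[OF x p] N_upper[OF y p] N_nonneg[OF x] p.p_nonneg[OF y]]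
        by linarith
    qed
  next
    fix x c assume x: "x \<in> carrier F"
    have le: "N (c \<odot>\<^bsub>F\<^esub> x) \<le> cmod c * N x" if x: "x \<in> carrier F" for c x
    proof (rule N_least)
      fix p assume p: "adm p"
      then show "p (c \<odot>\<^bsub>F\<^esub> x) \<le> cmod c * N x"
        using cstar_seminormed.p_smult[OF adm_seminormed[OF p] x, of c] N_upper[OF x p]
        by (simp add: mult_left_mono)
    qed
    show "N (c \<odot>\<^bsub>F\<^esub> x) = cmod c * N x"
    proof (cases "c = 0")
      case True
      then show ?thesis using le[OF x, of 0] N_nonneg[of "0 \<odot>\<^bsub>F\<^esub> x"] x by simp
    next
      case False
      have "N x \<le> cmod (inverse c) * N (c \<odot>\<^bsub>F\<^esub> x)"
        using le[of "c \<odot>\<^bsub>F\<^esub> x" "inverse c"] False x by (simp flip: F.smult_assoc)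
      then show ?thesis using le[OF x, of c] False by (simp add: norm_divide field_simps)
    qed
    show "N (x\<^sup>\<star>\<^bsub>F\<^esub> \<otimes>\<^bsub>F\<^esub> x) = (N x)\<^sup>2"
    proof (rule antisym)
      show "N (x\<^sup>\<star>\<^bsub>F\<^esub> \<otimes>\<^bsub>F\<^esub> x) \<le> (N x)\<^sup>2"
      proof (rule N_least)
        fix p assume p: "adm p"
        interpret p: cstar_seminormed F p by (rule adm_seminormed[OF p])
        show "p (x\<^sup>\<star>\<^bsub>F\<^esub> \<otimes>\<^bsub>F\<^esub> x) \<le> (N x)\<^sup>2"
          using N_upper[OF x p] x by (simp add: p.p_cstar power_mono)
      qed
      have "N x \<le> sqrt (N (x\<^sup>\<star>\<^bsub>F\<^esub> \<otimes>\<^bsub>F\<^esub> x))"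
      proof (rule N_least)
        fix p assume p: "adm p"
        interpret p: cstar_seminormed F p by (rule adm_seminormed[OF p])
        show "p x \<le> sqrt (N (x\<^sup>\<star>\<^bsub>F\<^esub> \<otimes>\<^bsub>F\<^esub> x))"
          using N_upper[OF _ p, of "x\<^sup>\<star>\<^bsub>F\<^esub> \<otimes>\<^bsub>F\<^esub> x"] x by (intro real_le_rsqrt) (simp add: p.p_cstar)
      qed
      then show "(N x)\<^sup>2 \<le> N (x\<^sup>\<star>\<^bsub>F\<^esub> \<otimes>\<^bsub>F\<^esub> x)"
        using N_nonneg[OF x] N_nonneg[of "x\<^sup>\<star>\<^bsub>F\<^esub> \<otimes>\<^bsub>F\<^esub> x"] x power_mono[of "N x" "sqrt (N (x\<^sup>\<star>\<^bsub>F\<^esub> \<otimes>\<^bsub>F\<^esub> x))" 2]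
        by simp
    qed
  qed auto
qed

lemma N_relation: "r \<in> R \<Longrightarrow> N r = 0"
  using R_carrier by (intro antisym N_least N_nonneg) auto

sublocale N: cstar_seminormed F N
  by (intro cstar_seminormed.intro F_star_algebra cstar_seminormed_axioms.intro N_seminorm)

theorem universal_cstar_algebra: "cstar_algebra U"
  unfolding universal_cstar_def by (rule N.completion_cstar_algebra)

lemma emb_hom: "emb \<in> star_hom F U"
  unfolding universal_cstar_def by (rule N.completion_emb_hom)

lemma emb_relation: assumes "r \<in> R" shows "emb r = \<zero>\<^bsub>U\<^esub>"
proof -
  interpret U: cstar_algebra U by (rule universal_cstar_algebra)
  have r: "r \<in> carrier F" using assms R_carrier by blast
  then have "cnorm U (emb r) = 0"
    using N.cnorm_completion_emb[OF r] N_relation[OF assms] by (simp add: universal_cstar_def)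
  then show ?thesis using star_homD(1)[OF emb_hom r] U.cnorm_definite by blast
qed

text \<open>The norm of \<open>B\<close> pulled back along \<phi> is an admissible seminorm, hence
  at most \<open>N\<close>, and \<phi> extends to the completion.\<close>

theorem universal_cstar_lift:
  assumes B: "cstar_algebra B" and \<phi>: "\<phi> \<in> star_hom F B" and zero: "\<And>r. r \<in> R \<Longrightarrow> \<phi> r = \<zero>\<^bsub>B\<^esub>"
  shows "\<exists>\<psi>\<in>star_hom U B. \<forall>x\<in>carrier F. \<psi> (emb x) = \<phi> x"
proof -
  interpret B: cstar_algebra B by fact
  have "adm (cnorm B \<circ> \<phi>)"
    using cstar_seminorm_comp[OF \<phi> F_star_algebra B.cstar_seminormed_axioms] zero by simp
  then have "cnorm B (\<phi> x) \<le> N x" if "x \<in> carrier F" for x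
    using N_upper[OF that] by fastforce
  then show ?thesis
    unfolding universal_cstar_def by (intro N.completion_lift[OF B \<phi>])
qed

end

section \<open>The boundary quotient of a right LCM semigroup\<close>

text \<open>The defining relations of C*(T) for families in an arbitrary star algebra. The same
  predicate serves the universal algebra, the boundary quotient and every target of a
  homomorphism.\<close>

definition lcm_rep ::
  "('s, 'm) monoid_scheme \<Rightarrow> ('b, 'k) star_alg_scheme \<Rightarrow> ('s \<Rightarrow> 'b) \<Rightarrow> ('s set \<Rightarrow> 'b) \<Rightarrow> bool" where
  "lcm_rep T B v e \<longleftrightarrow>
    (\<forall>s\<in>carrier T. v s \<in> carrier B \<and> (v s)\<^sup>\<star>\<^bsub>B\<^esub> \<otimes>\<^bsub>B\<^esub> v s = \<one>\<^bsub>B\<^esub>) \<and>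
    (\<forall>X\<in>constructible_ideals T. e X \<in> carrier B \<and> (e X)\<^sup>\<star>\<^bsub>B\<^esub> = e X \<and> e X \<otimes>\<^bsub>B\<^esub> e X = e X) \<and>
    (\<forall>s\<in>carrier T. \<forall>t\<in>carrier T. v s \<otimes>\<^bsub>B\<^esub> v t = v (s \<otimes>\<^bsub>T\<^esub> t)) \<and>
    (\<forall>s\<in>carrier T. \<forall>X\<in>constructible_ideals T.
      v s \<otimes>\<^bsub>B\<^esub> e X \<otimes>\<^bsub>B\<^esub> (v s)\<^sup>\<star>\<^bsub>B\<^esub> = e (s <#\<^bsub>T\<^esub> X)) \<and>
    e (carrier T) = \<one>\<^bsub>B\<^esub> \<and> e {} = \<zero>\<^bsub>B\<^esub> \<and>
    (\<forall>X\<in>constructible_ideals T. \<forall>Y\<in>constructible_ideals T. e X \<otimes>\<^bsub>B\<^esub> e Y = e (X \<inter> Y))"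

text \<open>The product runs along a list because the ambient ring is not commutative. Where factors
  must be interchanged, their commutation is proved separately.\<close>

definition defect_prod ::
  "('b, 'k) star_alg_scheme \<Rightarrow> ('s \<Rightarrow> 'b) \<Rightarrow> 's list \<Rightarrow> 'b" where
  "defect_prod B f xs = foldr (\<lambda>s a. (\<one>\<^bsub>B\<^esub> \<ominus>\<^bsub>B\<^esub> f s) \<otimes>\<^bsub>B\<^esub> a) xs \<one>\<^bsub>B\<^esub>"

context star_algebra
begin

lemma defect_prod_closed:
  "(\<And>s. s \<in> set xs \<Longrightarrow> f s \<in> carrier A) \<Longrightarrow> defect_prod A f xs \<in> carrier A"
  by (induction xs) (simp_all add: defect_prod_def)

lemma defect_prod_append:
  "(\<And>s. s \<in> set (xs @ ys) \<Longrightarrow> f s \<in> carrier A) \<Longrightarrow>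
    defect_prod A f (xs @ ys) = defect_prod A f xs \<otimes> defect_prod A f ys"
proof (induction xs)
  case Nil
  then show ?case using defect_prod_closed[of ys f] by (simp add: defect_prod_def)
next
  case (Cons x xs)
  then show ?case
    using defect_prod_closed[of xs f] defect_prod_closed[of ys f]
    by (simp add: defect_prod_def m_assoc)
qed

text \<open>Reversing an enumeration of a foundation set gives another enumeration of it, so this
  makes the set of boundary relations closed under the adjoint.\<close>

lemma defect_prod_adj:
  "(\<And>s. s \<in> set xs \<Longrightarrow> f s \<in> carrier A \<and> (f s)\<^sup>\<star> = f s) \<Longrightarrow>
    (defect_prod A f xs)\<^sup>\<star> = defect_prod A f (rev xs)"
proof (induction xs)
  case Nil
  then show ?case by (simp add: defect_prod_def)
next
  case (Cons x xs)
  have x: "f x \<in> carrier A" "(f x)\<^sup>\<star> = f x" and xs: "\<And>s. s \<in> set xs \<Longrightarrow> f s \<in> carrier A"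
    using Cons.prems by auto
  have "(defect_prod A f (x # xs))\<^sup>\<star> = ((\<one> \<ominus> f x) \<otimes> defect_prod A f xs)\<^sup>\<star>" by (simp add: defect_prod_def)
  also have "\<dots> = (defect_prod A f xs)\<^sup>\<star> \<otimes> (\<one> \<ominus> f x)"
    using defect_prod_closed[of xs f] x xs by (simp add: adj_mult adj_diff)
  also have "\<dots> = defect_prod A f (rev xs @ [x])"
    using Cons x xs by (subst defect_prod_append) (auto simp: defect_prod_def)
  finally show ?case by simp
qed

end

lemma star_hom_defect_prod:
  assumes \<phi>: "\<phi> \<in> star_hom A B" "star_algebra A" "star_algebra B"
    and f: "\<And>s. s \<in> set xs \<Longrightarrow> f s \<in> carrier A"
  shows "\<phi> (defect_prod A f xs) = defect_prod B (\<lambda>s. \<phi> (f s)) xs"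
  using f
proof (induction xs)
  case Nil
  then show ?case by (simp add: defect_prod_def star_homD[OF \<phi>(1)])
next
  case (Cons x xs)
  interpret A: star_algebra A by fact
  show ?case
    using Cons A.defect_prod_closed[of xs f]
    by (simp add: defect_prod_def star_homD[OF \<phi>(1)] star_hom_diff[OF \<phi>])
qed

lemma foundation_set_subset: "foundation_set T F \<Longrightarrow> F \<subseteq> carrier T"
  by (simp add: foundation_set_def)

context right_lcm
begin

lemma principal_iff: "x \<in> principal T s \<longleftrightarrow> (\<exists>t\<in>carrier T. x = s \<otimes> t)"
  by (auto simp: l_coset_def)

lemma principal_one [simp]: "principal T \<one> = carrier T"
  by (force simp: principal_iff)

lemma self_mem_principal: "s \<in> carrier T \<Longrightarrow> s \<in> principal T s"
  by (auto simp: principal_iff intro!: bexI[of _ \<one>])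

lemma principal_subset: "s \<in> carrier T \<Longrightarrow> principal T s \<subseteq> carrier T"
  by (auto simp: principal_iff)

lemma principal_translate: "s \<in> carrier T \<Longrightarrow> t \<in> carrier T \<Longrightarrow> s <# principal T t = principal T (s \<otimes> t)"
  by (auto simp: l_coset_def m_assoc)

lemma l_coset_empty [simp]: "s <# {} = {}"
  by (simp add: l_coset_def)

lemma constructible_idealsE:
  assumes "X \<in> constructible_ideals T"
  obtains "X = {}" | s where "s \<in> carrier T" "X = principal T s"
  using assms by (auto simp: constructible_ideals_def)

lemma constructible_ideals_simps [simp]:
  "{} \<in> constructible_ideals T" "carrier T \<in> constructible_ideals T"
  "s \<in> carrier T \<Longrightarrow> principal T s \<in> constructible_ideals T"
  by (auto simp: constructible_ideals_def intro!: image_eqI[of _ _ \<one>])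

lemma constructible_ideals_translate [simp]:
  "s \<in> carrier T \<Longrightarrow> X \<in> constructible_ideals T \<Longrightarrow> s <# X \<in> constructible_ideals T"
  by (auto elim!: constructible_idealsE simp: principal_translate)

lemma constructible_ideals_Int [simp]:
  assumes "X \<in> constructible_ideals T" "Y \<in> constructible_ideals T"
  shows "X \<inter> Y \<in> constructible_ideals T"
  using assms
proof (elim constructible_idealsE)
  fix s t assume "s \<in> carrier T" "t \<in> carrier T" "X = principal T s" "Y = principal T t"
  then show ?thesis using lcm[of s t] by auto
qed auto

text \<open>This is the covariance relation for the ideal \<open>carrier T\<close>, whose projection
  is the unit. The projections are therefore determined by the isometries.\<close>

lemma lcm_rep_e:
  assumes "star_algebra B" "lcm_rep T B v e" "s \<in> carrier T"
  shows "e (principal T s) = v s \<otimes>\<^bsub>B\<^esub> (v s)\<^sup>\<star>\<^bsub>B\<^esub>"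
proof -
  interpret B: star_algebra B by fact
  have v: "v s \<in> carrier B" and one: "e (carrier T) = \<one>\<^bsub>B\<^esub>"
    and e: "v s \<otimes>\<^bsub>B\<^esub> e (carrier T) \<otimes>\<^bsub>B\<^esub> (v s)\<^sup>\<star>\<^bsub>B\<^esub> = e (principal T s)"
    using assms(2,3) constructible_ideals_simps(2) unfolding lcm_rep_def by blast+
  show ?thesis using e v by (simp add: one)
qed

abbreviation "F \<equiv> free_star_alg (lcm_gens T)"

lemma letters_mem [simp]:
  "s \<in> carrier T \<Longrightarrow> letter (Isom s) \<in> carrier F"
  "X \<in> constructible_ideals T \<Longrightarrow> letter (Proj X) \<in> carrier F"
  by (auto simp: lcm_gens_def intro!: letter_mem)

lemma lcm_rels_carrier: "lcm_rels T \<subseteq> carrier F"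
proof -
  interpret F: star_algebra F by (rule free_star_alg_star_algebra)
  show ?thesis unfolding lcm_rels_def Let_def by auto
qed

lemma lcm_rels_zero_iff:
  assumes B: "star_algebra B" and \<phi>: "\<phi> \<in> star_hom F B"
  shows "(\<forall>r\<in>lcm_rels T. \<phi> r = \<zero>\<^bsub>B\<^esub>) \<longleftrightarrow>
    lcm_rep T B (\<lambda>s. \<phi> (letter (Isom s))) (\<lambda>X. \<phi> (letter (Proj X)))"
proof -
  interpret F: star_algebra F by (rule free_star_alg_star_algebra)
  interpret B: star_algebra B by fact
  note hom [simp] = star_homD[OF \<phi>] star_hom_diff[OF \<phi> F.star_algebra_axioms B]
  have all_iff: "(\<forall>r\<in>{f x |x. Q x}. \<phi> r = \<zero>\<^bsub>B\<^esub>) \<longleftrightarrow> (\<forall>x. Q x \<longrightarrow> R x)"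
    if "\<And>x. Q x \<Longrightarrow> \<phi> (f x) = \<zero>\<^bsub>B\<^esub> \<longleftrightarrow> R x" for f and Q R :: "'x \<Rightarrow> bool"
    using that by blast
  have all_iff2: "(\<forall>r\<in>{f x y |x y. Q x y}. \<phi> r = \<zero>\<^bsub>B\<^esub>) \<longleftrightarrow> (\<forall>x y. Q x y \<longrightarrow> R x y)"
    if "\<And>x y. Q x y \<Longrightarrow> \<phi> (f x y) = \<zero>\<^bsub>B\<^esub> \<longleftrightarrow> R x y" for f and Q R :: "'x \<Rightarrow> 'y \<Rightarrow> bool"
    using that by blast
  let ?v = "\<lambda>s. \<phi> (letter (Isom s))" and ?e = "\<lambda>X. \<phi> (letter (Proj X))" and ?J = "constructible_ideals T"
  \<comment> \<open>The bracketing follows the nesting of the unions in \<open>lcm_rels\<close>, so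
    that each family of relations is matched with one conjunct.\<close>
  have "(\<forall>r\<in>lcm_rels T. \<phi> r = \<zero>\<^bsub>B\<^esub>) \<longleftrightarrow>
      (((((((\<forall>s. s \<in> carrier T \<longrightarrow> (?v s)\<^sup>\<star>\<^bsub>B\<^esub> \<otimes>\<^bsub>B\<^esub> ?v s = \<one>\<^bsub>B\<^esub>) \<and>
      (\<forall>X. X \<in> ?J \<longrightarrow> (?e X)\<^sup>\<star>\<^bsub>B\<^esub> = ?e X)) \<and>
      (\<forall>X. X \<in> ?J \<longrightarrow> ?e X \<otimes>\<^bsub>B\<^esub> ?e X = ?e X)) \<and>
      (\<forall>s t. s \<in> carrier T \<and> t \<in> carrier T \<longrightarrow> ?v s \<otimes>\<^bsub>B\<^esub> ?v t = ?v (s \<otimes> t))) \<and>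
      (\<forall>s X. s \<in> carrier T \<and> X \<in> ?J \<longrightarrow> ?v s \<otimes>\<^bsub>B\<^esub> ?e X \<otimes>\<^bsub>B\<^esub> (?v s)\<^sup>\<star>\<^bsub>B\<^esub> = ?e (s <# X))) \<and>
      ?e (carrier T) = \<one>\<^bsub>B\<^esub>) \<and> ?e {} = \<zero>\<^bsub>B\<^esub>) \<and>
      (\<forall>X Y. X \<in> ?J \<and> Y \<in> ?J \<longrightarrow> ?e X \<otimes>\<^bsub>B\<^esub> ?e Y = ?e (X \<inter> Y))"
    unfolding lcm_rels_def Let_def ball_Un
    by (intro arg_cong2[where f = "(\<and>)"] all_iff all_iff2) (simp_all add: B.diff_eq_zero)
  also have "\<dots> \<longleftrightarrow> lcm_rep T B ?v ?e"
    unfolding lcm_rep_def by (auto simp: letters_mem)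
  finally show ?thesis .
qed

lemma lcm_bounded: "bounded_relations (lcm_gens T) (lcm_rels T)"
proof
  fix i assume "i \<in> lcm_gens T"
  then consider s where "s \<in> carrier T" "i = Isom s" | X where "X \<in> constructible_ideals T" "i = Proj X"
    by (auto simp: lcm_gens_def)
  then show "\<exists>K. \<forall>p. cstar_seminorm F p \<longrightarrow> (\<forall>r\<in>lcm_rels T. p r = 0) \<longrightarrow> p (letter i) \<le> K"
  proof cases
    case 1
    have "p (letter i) \<le> 1" if p: "cstar_seminorm F p" "\<forall>r\<in>lcm_rels T. p r = 0" for p
    proof -
      interpret p: cstar_seminormed F p
        using p(1) by (intro cstar_seminormed.intro free_star_alg_star_algebra cstar_seminormed_axioms.intro)
      show ?thesis
        using p(2) 1 by (intro p.p_isometry_le) (auto simp: lcm_rels_def Let_def)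
    qed
    then show ?thesis by blast
  next
    case 2
    have "p (letter i) \<le> 1" if p: "cstar_seminorm F p" "\<forall>r\<in>lcm_rels T. p r = 0" for p
    proof -
      interpret p: cstar_seminormed F p
        using p(1) by (intro cstar_seminormed.intro free_star_alg_star_algebra cstar_seminormed_axioms.intro)
      show ?thesis
        using p(2) 2 by (intro p.p_projection_le) (auto simp: lcm_rels_def Let_def)
    qed
    then show ?thesis by blast
  qed
qed (rule lcm_rels_carrier)

end

text \<open>A separate name for \<open>right_lcm\<close>, so that the C*-algebras below accompany
  only those semigroups for which they are wanted: here \<open>S\<close>, but not
  \<open>P\<close>.\<close>

locale right_lcm_cstar = right_lcm T for T :: "('s, 'm) monoid_scheme" (structure)
begin

sublocale U: bounded_relations "lcm_gens T" "lcm_rels T"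
  by (rule lcm_bounded)

sublocale L: cstar_algebra "lcm_cstar T"
  unfolding lcm_cstar_def by (rule U.universal_cstar_algebra)

lemma emb_hom: "U.emb \<in> star_hom F (lcm_cstar T)"
  unfolding lcm_cstar_def by (rule U.emb_hom)

lemma lcm_v_eq: "lcm_v T s = U.emb (letter (Isom s))"
  and lcm_e_eq: "lcm_e T X = U.emb (letter (Proj X))"
  by (simp_all add: lcm_v_def lcm_e_def universal_gen_def)

lemma lcm_cstar_rep: "lcm_rep T (lcm_cstar T) (lcm_v T) (lcm_e T)"
  using lcm_rels_zero_iff[OF L.star_algebra_axioms emb_hom] U.emb_relation
  by (simp add: lcm_v_eq[abs_def] lcm_e_eq[abs_def] lcm_cstar_def)

lemma lcm_e_carrier:
  "X \<in> constructible_ideals T \<Longrightarrow> lcm_e T X \<in> carrier (lcm_cstar T)"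
  "X \<in> constructible_ideals T \<Longrightarrow> (lcm_e T X)\<^sup>\<star>\<^bsub>lcm_cstar T\<^esub> = lcm_e T X"
  "s \<in> carrier T \<Longrightarrow> lcm_v T s \<in> carrier (lcm_cstar T)"
  using lcm_cstar_rep by (auto simp: lcm_rep_def)

lemma boundary_rels_eq: "boundary_rels T =
  {defect_prod (lcm_cstar T) (\<lambda>s. lcm_e T (principal T s)) xs | xs. distinct xs \<and> foundation_set T (set xs)}"
  by (simp add: boundary_rels_def Let_def defect_prod_def)

lemma boundary_rels_carrier: "boundary_rels T \<subseteq> carrier (lcm_cstar T)"
  by (auto simp: boundary_rels_eq lcm_e_carrier dest!: foundation_set_subset intro!: L.defect_prod_closed)

lemma boundary_rels_adj:
  assumes "x \<in> boundary_rels T"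
  shows "x\<^sup>\<star>\<^bsub>lcm_cstar T\<^esub> \<in> boundary_rels T"
proof -
  obtain xs where xs: "distinct xs" "foundation_set T (set xs)"
    "x = defect_prod (lcm_cstar T) (\<lambda>s. lcm_e T (principal T s)) xs"
    using assms by (auto simp: boundary_rels_eq)
  have "x\<^sup>\<star>\<^bsub>lcm_cstar T\<^esub> = defect_prod (lcm_cstar T) (\<lambda>s. lcm_e T (principal T s)) (rev xs)"
    unfolding xs(3) using foundation_set_subset[OF xs(2)]
    by (intro L.defect_prod_adj) (auto simp: lcm_e_carrier)
  then show ?thesis using xs by (auto simp: boundary_rels_eq intro!: exI[of _ "rev xs"])
qed

abbreviation "BQ \<equiv> boundary_quotient T"
abbreviation "BI \<equiv> closed_ideal (lcm_cstar T) (boundary_rels T)"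
abbreviation "\<kappa> x \<equiv> BI +>\<^bsub>lcm_cstar T\<^esub> x"

definition boundary_e :: "'s set \<Rightarrow> 's lcm_gen univ_elem set" where
  "boundary_e X = \<kappa> (lcm_e T X)"

sublocale BI: star_ideal "lcm_cstar T" "cnorm (lcm_cstar T)" BI
  by (rule L.closed_ideal_star_ideal[OF boundary_rels_carrier boundary_rels_adj])

theorem boundary_quotient_cstar_algebra: "cstar_algebra BQ"
  unfolding boundary_quotient_def
  by (rule L.closed_ideal_quot_cstar_algebra[OF boundary_rels_carrier boundary_rels_adj])

lemma \<kappa>_hom: "\<kappa> \<in> star_hom (lcm_cstar T) BQ"
  unfolding boundary_quotient_def by (rule BI.quot_hom)

lemma boundary_hom: "\<kappa> \<circ> U.emb \<in> star_hom F BQ"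
  by (rule star_hom_comp[OF emb_hom \<kappa>_hom])

lemma boundary_rep: "lcm_rep T BQ (boundary_v T) boundary_e"
proof -
  interpret B: cstar_algebra BQ by (rule boundary_quotient_cstar_algebra)
  have "(\<kappa> \<circ> U.emb) r = \<zero>\<^bsub>BQ\<^esub>" if "r \<in> lcm_rels T" for r
    using U.emb_relation[OF that] star_hom_zero[OF \<kappa>_hom L.star_algebra_axioms B.star_algebra_axioms]
    by (simp add: lcm_cstar_def)
  then show ?thesis
    using lcm_rels_zero_iff[OF B.star_algebra_axioms boundary_hom]
    by (simp add: boundary_v_def[abs_def] boundary_e_def[abs_def] lcm_v_eq lcm_e_eq)
qed

lemma boundary_defect:
  assumes "distinct xs" "foundation_set T (set xs)"
  shows "defect_prod BQ (\<lambda>s. boundary_e (principal T s)) xs = \<zero>\<^bsub>BQ\<^esub>"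
proof -
  interpret B: cstar_algebra BQ by (rule boundary_quotient_cstar_algebra)
  let ?x = "defect_prod (lcm_cstar T) (\<lambda>s. lcm_e T (principal T s)) xs"
  have "?x \<in> boundary_rels T" using assms by (auto simp: boundary_rels_eq)
  then have x: "?x \<in> BI" using L.closed_ideal_superset by blast
  have "defect_prod BQ (\<lambda>s. boundary_e (principal T s)) xs = \<kappa> ?x"
    unfolding boundary_e_def using foundation_set_subset[OF assms(2)]
    by (intro star_hom_defect_prod[OF \<kappa>_hom L.star_algebra_axioms B.star_algebra_axioms, symmetric])
      (auto simp: lcm_e_carrier)
  also have "\<dots> = \<kappa> \<zero>\<^bsub>lcm_cstar T\<^esub>"
    using BI.coset_eq_iff[OF BI.Icarr[OF x] L.zero_closed] x BI.Icarr[OF x] by simp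
  also have "\<dots> = \<zero>\<^bsub>BQ\<^esub>"
    by (rule star_hom_zero[OF \<kappa>_hom L.star_algebra_axioms B.star_algebra_axioms])
  finally show ?thesis .
qed

text \<open>Evaluation of polynomials at the given elements kills the relations of C*(T), hence
  descends to that algebra; the homomorphism obtained kills the boundary relations and descends once
  more.\<close>

theorem boundary_quotient_lift:
  assumes B: "cstar_algebra B" and rep: "lcm_rep T B v e"
    and defect: "\<And>xs. distinct xs \<Longrightarrow> foundation_set T (set xs) \<Longrightarrow>
      defect_prod B (\<lambda>s. e (principal T s)) xs = \<zero>\<^bsub>B\<^esub>"
  shows "\<exists>\<psi>\<in>star_hom BQ B. \<forall>s\<in>carrier T. \<psi> (boundary_v T s) = v s"
proof -
  interpret B: cstar_algebra B by fact
  define b where "b i = (case i of Isom s \<Rightarrow> v s | Proj X \<Rightarrow> e X)" for i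
  have b: "b i \<in> carrier B" if "i \<in> lcm_gens T" for i
    using that rep by (auto simp: b_def lcm_gens_def lcm_rep_def)
  have \<phi>: "B.free_eval b \<in> star_hom F B" by (rule B.free_eval_hom[OF b])
  have val: "B.free_eval b (letter (Isom s)) = v s" if "s \<in> carrier T" for s
    using B.free_eval_letter[of "lcm_gens T" b "Isom s", OF b] that by (simp add: b_def lcm_gens_def)
  have vale: "B.free_eval b (letter (Proj X)) = e X" if "X \<in> constructible_ideals T" for X
    using B.free_eval_letter[of "lcm_gens T" b "Proj X", OF b] that by (simp add: b_def lcm_gens_def)
  have "lcm_rep T B (\<lambda>s. B.free_eval b (letter (Isom s))) (\<lambda>X. B.free_eval b (letter (Proj X)))"
    using rep unfolding lcm_rep_def by (simp add: val vale)
  then have "\<forall>r\<in>lcm_rels T. B.free_eval b r = \<zero>\<^bsub>B\<^esub>"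
    using lcm_rels_zero_iff[OF B.star_algebra_axioms \<phi>] by blast
  then obtain \<psi> where \<psi>: "\<psi> \<in> star_hom (lcm_cstar T) B" "\<And>x. x \<in> carrier F \<Longrightarrow> \<psi> (U.emb x) = B.free_eval b x"
    using U.universal_cstar_lift[OF B \<phi>] unfolding lcm_cstar_def by blast
  have "\<psi> x = \<zero>\<^bsub>B\<^esub>" if x: "x \<in> boundary_rels T" for x
  proof -
    obtain xs where xs: "distinct xs" "foundation_set T (set xs)"
      "x = defect_prod (lcm_cstar T) (\<lambda>s. lcm_e T (principal T s)) xs"
      using x by (auto simp: boundary_rels_eq)
    have sub: "set xs \<subseteq> carrier T" using foundation_set_subset[OF xs(2)] .
    have "\<psi> x = defect_prod B (\<lambda>s. \<psi> (lcm_e T (principal T s))) xs"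
      unfolding xs(3) using sub
      by (intro star_hom_defect_prod[OF \<psi>(1) L.star_algebra_axioms B.star_algebra_axioms]) (auto simp: lcm_e_carrier)
    also have "\<dots> = defect_prod B (\<lambda>s. e (principal T s)) xs"
      unfolding defect_prod_def using sub by (intro foldr_cong) (auto simp: lcm_e_eq \<psi>(2) vale)
    finally show ?thesis using defect[OF xs(1,2)] by simp
  qed
  then obtain \<chi> where \<chi>: "\<chi> \<in> star_hom BQ B" "\<And>x. x \<in> carrier (lcm_cstar T) \<Longrightarrow> \<chi> (\<kappa> x) = \<psi> x"
    using L.closed_ideal_quot_lift[OF boundary_rels_carrier boundary_rels_adj B \<psi>(1)]
    unfolding boundary_quotient_def by blast
  have "\<chi> (boundary_v T s) = v s" if "s \<in> carrier T" for s
    using that by (simp add: boundary_v_def \<chi>(2) lcm_e_carrier) (simp add: lcm_v_eq \<psi>(2) val)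
  then show ?thesis using \<chi>(1) by blast
qed

text \<open>\<open>D\<close> contains the isometries by assumption and the projections as v v*,
  hence the images of all polynomials. These are dense, since the quotient map is contractive and
  polynomials are dense in C*(T).\<close>

theorem boundary_quotient_generated:
  assumes D: "subring D BQ" "\<And>c x. x \<in> D \<Longrightarrow> c \<odot>\<^bsub>BQ\<^esub> x \<in> D" "\<And>x. x \<in> D \<Longrightarrow> x\<^sup>\<star>\<^bsub>BQ\<^esub> \<in> D"
    "norm_closed BQ D" and v: "\<And>s. s \<in> carrier T \<Longrightarrow> boundary_v T s \<in> D"
  shows "carrier BQ \<subseteq> D"
proof
  interpret B: cstar_algebra BQ by (rule boundary_quotient_cstar_algebra)
  note Dring = subringE[OF D(1)]
  have e: "boundary_e X \<in> D" if "X \<in> constructible_ideals T" for X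
    using that
  proof (cases rule: constructible_idealsE)
    case 1
    then show ?thesis using boundary_rep Dring by (simp add: lcm_rep_def)
  next
    case (2 s)
    have "boundary_e X = boundary_v T s \<otimes>\<^bsub>BQ\<^esub> (boundary_v T s)\<^sup>\<star>\<^bsub>BQ\<^esub>"
      using lcm_rep_e[OF B.star_algebra_axioms boundary_rep 2(1)] 2(2) by simp
    then show ?thesis using v[OF 2(1)] D(3) Dring by simp
  qed
  have mem: "(\<kappa> \<circ> U.emb) f \<in> D" if "f \<in> carrier F" for f
    using boundary_hom _ _ _ _ _ _ that
    by (rule star_hom_mem_of_letters)
      (use D(2,3) Dring v e in \<open>auto simp: lcm_gens_def boundary_v_def boundary_e_def lcm_v_eq lcm_e_eq\<close>)
  fix x assume x: "x \<in> carrier BQ"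
  then obtain a where a: "a \<in> carrier (lcm_cstar T)" "x = \<kappa> a"
    by (auto simp: boundary_quotient_def BI.quot_carrier)
  obtain f where f: "\<And>n. f n \<in> carrier F" "converges_to (lcm_cstar T) (\<lambda>n. U.emb (f n)) a"
    using U.N.completion_dense[of a] a(1) by (auto simp: lcm_cstar_def universal_cstar_def)
  have fL: "U.emb (f n) \<in> carrier (lcm_cstar T)" for n using star_homD(1)[OF emb_hom f(1)] .
  have "converges_to BQ (\<lambda>n. (\<kappa> \<circ> U.emb) (f n)) x"
    unfolding converges_to_def
  proof (rule LIMSEQ_0_le[OF f(2)[unfolded converges_to_def]])
    fix n
    have "cnorm BQ (\<kappa> (U.emb (f n) \<ominus>\<^bsub>lcm_cstar T\<^esub> a)) \<le> cnorm (lcm_cstar T) (U.emb (f n) \<ominus>\<^bsub>lcm_cstar T\<^esub> a)"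
      by (rule star_hom_contractive[OF L.cstar_algebra_axioms B.cstar_algebra_axioms \<kappa>_hom])
        (simp add: a fL)
    then show "cnorm BQ ((\<kappa> \<circ> U.emb) (f n) \<ominus>\<^bsub>BQ\<^esub> x) \<le> cnorm (lcm_cstar T) (U.emb (f n) \<ominus>\<^bsub>lcm_cstar T\<^esub> a)"
      using star_hom_diff[OF \<kappa>_hom L.star_algebra_axioms B.star_algebra_axioms fL a(1)] a(2) by simp
    show "0 \<le> cnorm BQ ((\<kappa> \<circ> U.emb) (f n) \<ominus>\<^bsub>BQ\<^esub> x)"
      using star_homD(1)[OF boundary_hom f(1)] x by simp
  qed
  then show "x \<in> D" by (rule B.norm_closedD[OF D(4) mem[OF f(1)] x])
qed

end

section \<open>Coverings of a group by cosets\<close>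

context group
begin

text \<open>For D the whole group and K a subgroup this is finite index. The relative form measures
  a subgroup D that need not contain K.\<close>

definition coset_cover :: "'a set \<Rightarrow> 'a set \<Rightarrow> bool" where
  "coset_cover D K \<longleftrightarrow> (\<exists>C. finite C \<and> C \<subseteq> carrier G \<and> D \<subseteq> (\<Union>c\<in>C. c <# K))"

lemma mem_l_coset: "x \<in> c <# K \<longleftrightarrow> (\<exists>k\<in>K. x = c \<otimes> k)"
  by (auto simp: l_coset_def)

lemma mem_l_coset_iff:
  assumes "subgroup K G" "c \<in> carrier G" "x \<in> carrier G"
  shows "x \<in> c <# K \<longleftrightarrow> inv c \<otimes> x \<in> K"
proof
  assume "x \<in> c <# K"
  then show "inv c \<otimes> x \<in> K"
    using assms subgroup.mem_carrier[OF assms(1)] by (auto simp: mem_l_coset m_assoc[symmetric])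
next
  assume "inv c \<otimes> x \<in> K"
  moreover have "x = c \<otimes> (inv c \<otimes> x)" using assms by (simp add: m_assoc[symmetric])
  ultimately show "x \<in> c <# K" by (auto simp: mem_l_coset)
qed

lemma mult_eq_solve:
  assumes "x \<in> carrier G" "k \<in> carrier G" "c \<in> carrier G" "l \<in> carrier G" "x \<otimes> k = c \<otimes> l"
  shows "x = c \<otimes> (l \<otimes> inv k)"
proof -
  have "x = (x \<otimes> k) \<otimes> inv k" using assms(1,2) by (simp add: m_assoc)
  then show ?thesis using assms by (simp add: m_assoc)
qed

lemma l_coset_diff:
  assumes K: "subgroup K G" and c: "c \<in> carrier G" and xy: "x \<in> c <# K" "y \<in> c <# K"
  shows "inv x \<otimes> y \<in> K"
proof -
  obtain a b where ab: "a \<in> K" "b \<in> K" "x = c \<otimes> a" "y = c \<otimes> b" using xy by (auto simp: mem_l_coset)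
  then have "inv x \<otimes> y = inv a \<otimes> b"
    using c subgroup.mem_carrier[OF K] by (simp add: inv_mult_group m_assoc) (simp add: m_assoc[symmetric])
  then show ?thesis using ab K by (simp add: subgroup.m_closed subgroup.m_inv_closed)
qed

lemma l_coset_eq:
  assumes K: "subgroup K G" and c: "c \<in> carrier G" and x: "x \<in> c <# K"
  shows "x <# K = c <# K"
  using l_repr_independence[OF x c K] by simp

lemma coset_cover_carrier_iff:
  assumes K: "subgroup K G"
  shows "coset_cover (carrier G) K \<longleftrightarrow> finite (lcosets K)"
proof
  assume "coset_cover (carrier G) K"
  then obtain C where C: "finite C" "C \<subseteq> carrier G" "carrier G \<subseteq> (\<Union>c\<in>C. c <# K)"
    by (auto simp: coset_cover_def)
  have "lcosets K \<subseteq> (\<lambda>c. c <# K) ` C"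
  proof
    fix X assume "X \<in> lcosets K"
    then obtain a where a: "a \<in> carrier G" "X = a <# K" by (auto simp: LCOSETS_def)
    then obtain c where c: "c \<in> C" "a \<in> c <# K" using C(3) by blast
    then have "a <# K = c <# K" using C(2) by (intro l_coset_eq[OF K _ c(2)]) blast
    then show "X \<in> (\<lambda>c. c <# K) ` C" using a(2) c(1) by blast
  qed
  then show "finite (lcosets K)" by (rule finite_surj[OF C(1)])
next
  assume fin: "finite (lcosets K)"
  have "\<exists>a\<in>carrier G. X = a <# K" if "X \<in> lcosets K" for X using that by (auto simp: LCOSETS_def)
  then obtain r where r: "\<And>X. X \<in> lcosets K \<Longrightarrow> r X \<in> carrier G \<and> X = r X <# K" by metis
  have "carrier G \<subseteq> (\<Union>c\<in>r ` (lcosets K). c <# K)"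
  proof
    fix x assume x: "x \<in> carrier G"
    then have X: "x <# K \<in> lcosets K" by (auto simp: LCOSETS_def)
    have "x \<in> x <# K" using lcos_self[OF x K] .
    then show "x \<in> (\<Union>c\<in>r ` (lcosets K). c <# K)" using r[OF X] X by auto
  qed
  then show "coset_cover (carrier G) K"
    unfolding coset_cover_def using fin r by (intro exI[of _ "r ` (lcosets K)"]) auto
qed

text \<open>A nonempty intersection of a left coset of H with a left coset of K is a left coset of H
  \<inter> K, and only finitely many such intersections arise.\<close>

lemma coset_cover_Int:
  assumes H: "subgroup H G" and K: "subgroup K G"
    and "coset_cover (carrier G) H" "coset_cover (carrier G) K"
  shows "coset_cover (carrier G) (H \<inter> K)"
proof -
  obtain C E where C: "finite C" "C \<subseteq> carrier G" "carrier G \<subseteq> (\<Union>c\<in>C. c <# H)"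
    and E: "finite E" "E \<subseteq> carrier G" "carrier G \<subseteq> (\<Union>c\<in>E. c <# K)"
    using assms(3,4) by (auto simp: coset_cover_def)
  define d where "d c e = (SOME x. x \<in> (c <# H) \<inter> (e <# K))" for c e
  \<comment> \<open>For disjoint cosets the choice \<open>d c e\<close> is arbitrary. Intersecting
    with the carrier discards values outside the group.\<close>
  let ?D = "(\<lambda>(c, e). d c e) ` (C \<times> E) \<inter> carrier G"
  have "carrier G \<subseteq> (\<Union>x\<in>?D. x <# (H \<inter> K))"
  proof
    fix y assume y: "y \<in> carrier G"
    obtain c where "c \<in> C" "y \<in> c <# H" using y C(3) by blast
    moreover obtain e where "e \<in> E" "y \<in> e <# K" using y E(3) by blast
    ultimately have ce: "c \<in> C" "e \<in> E" "y \<in> c <# H" "y \<in> e <# K" by auto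
    have "d c e \<in> (c <# H) \<inter> (e <# K)"
      unfolding d_def by (rule someI[of _ y]) (simp add: ce)
    then have d: "d c e \<in> c <# H" "d c e \<in> e <# K" by auto
    have dG: "d c e \<in> carrier G"
      using d(1) ce C subgroup.mem_carrier[OF H] by (auto simp: mem_l_coset)
    have "inv (d c e) \<otimes> y \<in> H \<inter> K"
      using l_coset_diff[OF H _ d(1) ce(3)] l_coset_diff[OF K _ d(2) ce(4)] ce C E by auto
    then have "y \<in> d c e <# (H \<inter> K)"
      using mem_l_coset_iff[OF subgroups_Inter_pair[OF H K] dG y] by simp
    then show "y \<in> (\<Union>x\<in>?D. x <# (H \<inter> K))" using ce dG by auto
  qed
  then show ?thesis unfolding coset_cover_def using C E by (intro exI[of _ ?D]) auto
qed

text \<open>The cosets of K by the products of the two families of representatives cover the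
  group.\<close>

lemma coset_cover_trans:
  assumes D: "coset_cover (carrier G) D" and K: "coset_cover D K" and KG: "K \<subseteq> carrier G"
  shows "coset_cover (carrier G) K"
proof -
  obtain C E where C: "finite C" "C \<subseteq> carrier G" "carrier G \<subseteq> (\<Union>c\<in>C. c <# D)"
    and E: "finite E" "E \<subseteq> carrier G" "D \<subseteq> (\<Union>c\<in>E. c <# K)"
    using D K by (auto simp: coset_cover_def)
  have "carrier G \<subseteq> (\<Union>x\<in>(\<lambda>(c, e). c \<otimes> e) ` (C \<times> E). x <# K)"
  proof
    fix y assume "y \<in> carrier G"
    then obtain c where "c \<in> C" "y \<in> c <# D" using C(3) by blast
    then obtain x where cx: "c \<in> C" "x \<in> D" "y = c \<otimes> x" by (auto simp: mem_l_coset)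
    then obtain e where "e \<in> E" "x \<in> e <# K" using E(3) by blast
    then obtain k where ek: "e \<in> E" "k \<in> K" "x = e \<otimes> k" by (auto simp: mem_l_coset)
    then have "y = c \<otimes> e \<otimes> k" using cx C E KG by (auto simp: m_assoc subset_iff)
    then show "y \<in> (\<Union>x\<in>(\<lambda>(c, e). c \<otimes> e) ` (C \<times> E). x <# K)"
      using cx ek by (force simp: mem_l_coset)
  qed
  then show ?thesis
    unfolding coset_cover_def using C E by (intro exI[of _ "(\<lambda>(c, e). c \<otimes> e) ` (C \<times> E)"]) auto
qed

text \<open>If \<open>x K\<close> meets none of the given cosets of \<open>K\<close>, then \<open>x (K \<inter> D)\<close>, and hence every
  translate of it, is covered by the cosets of the other subgroups.\<close>

lemma not_covered_by_infinite_index: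
  assumes D: "subgroup D G" and "finite \<K>"
    and "\<And>K. K \<in> \<K> \<Longrightarrow> subgroup K G" "\<And>K. K \<in> \<K> \<Longrightarrow> \<not> coset_cover D K"
    and "finite A" "A \<subseteq> carrier G \<times> \<K>"
  shows "\<not> D \<subseteq> (\<Union>(c, K)\<in>A. c <# K)"
  using assms(2-)
proof (induction \<K> arbitrary: A rule: finite_induct)
  case empty
  then show ?case using subgroup.one_closed[OF D] by auto
next
  case (insert K \<K>)
  show ?case
  proof
    assume cover: "D \<subseteq> (\<Union>(c, K)\<in>A. c <# K)"
    have K: "subgroup K G" using insert.prems by blast
    define C where "C = {c. (c, K) \<in> A}"
    define A' where "A' = A \<inter> carrier G \<times> \<K>"
    have C: "finite C" "C \<subseteq> carrier G"
      using insert.prems(3,4) finite_surj[of A C fst] by (force simp: C_def)+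
    have A': "finite A'" "A' \<subseteq> carrier G \<times> \<K>" using insert.prems by (auto simp: A'_def)
    have split: "x \<in> (\<Union>c\<in>C. c <# K) \<or> (\<exists>(c, L)\<in>A'. x \<in> c <# L)" if "x \<in> D" for x
      using that cover insert.prems(4) by (fastforce simp: C_def A'_def)
    have "\<not> D \<subseteq> (\<Union>c\<in>C. c <# K)"
      using insert.prems(2)[of K] C by (auto simp: coset_cover_def)
    then obtain x where x: "x \<in> D" "x \<notin> (\<Union>c\<in>C. c <# K)" by blast
    have DG: "y \<in> carrier G" if "y \<in> D" for y using subgroup.mem_carrier[OF D that] .
    define d where "d c = (SOME y. y \<in> D \<inter> (c <# K))" for c
    \<comment> \<open>An element y of D in c K equals d k with d = \<open>d c\<close> and k in K
      \<inter> D. If x k lies in c' L, then y = d inv(x) (x k) lies in (d inv(x) c') L. The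
      intersection with the carrier removes values of \<open>d c\<close> chosen from an empty
      set.\<close>
    define B where "B = (\<lambda>(c, c', L). (d c \<otimes> inv x \<otimes> c', L)) ` (C \<times> A') \<inter> carrier G \<times> \<K>"
    have "D \<subseteq> (\<Union>(c, K)\<in>A' \<union> B. c <# K)"
    proof
      fix y assume y: "y \<in> D"
      show "y \<in> (\<Union>(c, K)\<in>A' \<union> B. c <# K)"
      proof (cases "\<exists>(c, L)\<in>A'. y \<in> c <# L")
        case True
        then show ?thesis by blast
      next
        case False
        then obtain c where c: "c \<in> C" "y \<in> c <# K" using split[OF y] by blast
        have "d c \<in> D \<inter> (c <# K)" unfolding d_def by (rule someI[of _ y]) (simp add: y c)
        then have dD: "d c \<in> D" and dc: "d c \<in> c <# K" by auto
        define k where "k = inv (d c) \<otimes> y"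
        have k: "k \<in> K" "k \<in> D"
          using l_coset_diff[OF K _ dc c(2)] c(1) C y dD D
          by (auto simp: k_def subgroup.m_closed subgroup.m_inv_closed)
        \<comment> \<open>Since k lies in K, multiplying by it on the right does not change the left
          coset of K, and \<open>x\<close> was chosen outside all those listed.\<close>
        have "x \<otimes> k \<notin> (\<Union>c\<in>C. c <# K)"
        proof
          assume "x \<otimes> k \<in> (\<Union>c\<in>C. c <# K)"
          then obtain c' k' where k': "c' \<in> C" "k' \<in> K" "x \<otimes> k = c' \<otimes> k'" by (auto simp: mem_l_coset)
          have "x = c' \<otimes> (k' \<otimes> inv k)"
            using k'(3) x(1) k k'(1,2) C(2) DG subgroup.mem_carrier[OF K]
            by (intro mult_eq_solve) auto
          moreover have "k' \<otimes> inv k \<in> K" using K k k' by (simp add: subgroup.m_closed subgroup.m_inv_closed)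
          ultimately show False using x(2) k'(1) by (auto simp: mem_l_coset)
        qed
        then obtain c' L where cL: "(c', L) \<in> A'" "x \<otimes> k \<in> c' <# L"
          using split[of "x \<otimes> k"] subgroup.m_closed[OF D x(1) k(2)] by blast
        obtain l where l: "l \<in> L" "x \<otimes> k = c' \<otimes> l" using cL(2) by (auto simp: mem_l_coset)
        have LG: "subgroup L G" "c' \<in> carrier G" using cL A' insert.prems(1) by auto
        have carr: "l \<in> carrier G" "k \<in> carrier G" "x \<in> carrier G" "y \<in> carrier G" "d c \<in> carrier G"
          using subgroup.mem_carrier[OF LG(1) l(1)] DG k x y dD by auto
        have "y = d c \<otimes> k" using carr by (simp add: k_def m_assoc[symmetric])
        also have "\<dots> = d c \<otimes> inv x \<otimes> (x \<otimes> k)"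
          using carr by (simp add: m_assoc) (simp add: m_assoc[symmetric])
        also have "\<dots> = d c \<otimes> inv x \<otimes> c' \<otimes> l" using carr LG by (simp add: l m_assoc)
        finally have "y \<in> (d c \<otimes> inv x \<otimes> c') <# L" using l(1) by (auto simp: mem_l_coset)
        moreover have "(d c \<otimes> inv x \<otimes> c', L) \<in> B"
          unfolding B_def using c(1) cL(1) A' carr LG
          by (auto intro!: image_eqI[of _ _ "(c, c', L)"])
        ultimately show ?thesis by blast
      qed
    qed
    moreover have "finite (A' \<union> B)" "A' \<union> B \<subseteq> carrier G \<times> \<K>" using A' C by (auto simp: B_def)
    ultimately show False using insert.IH[of "A' \<union> B"] insert.prems(1,2) by blast
  qed
qed

text \<open>This is B. H. Neumann's lemma. Let D be the intersection of the finitely many H(a) of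
  finite index. If y is missed by their cosets, so is all of y D, and D would be covered by
  translated cosets of the remaining subgroups. None of these covers D with finitely many cosets,
  because D has finite index.\<close>

theorem finite_index_cosets_cover:
  assumes A: "finite A" and x: "\<And>a. a \<in> A \<Longrightarrow> x a \<in> carrier G" and H: "\<And>a. a \<in> A \<Longrightarrow> subgroup (H a) G"
    and cover: "carrier G \<subseteq> (\<Union>a\<in>A. x a <# H a)"
  shows "carrier G \<subseteq> (\<Union>a\<in>{a\<in>A. finite (lcosets (H a))}. x a <# H a)"
proof
  fix y assume y: "y \<in> carrier G"
  let ?F = "{a\<in>A. finite (lcosets (H a))}"
  show "y \<in> (\<Union>a\<in>?F. x a <# H a)"
  proof (rule ccontr)
    assume notin: "y \<notin> (\<Union>a\<in>?F. x a <# H a)"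
    have common: "\<exists>D. subgroup D G \<and> coset_cover (carrier G) D \<and> (\<forall>a\<in>B. D \<subseteq> H a)"
      if "finite B" "B \<subseteq> ?F" for B
      using that
    proof (induction B rule: finite_induct)
      case empty
      have "coset_cover (carrier G) (carrier G)"
        unfolding coset_cover_def by (intro exI[of _ "{\<one>}"]) (auto simp: mem_l_coset)
      then show ?case using subgroup_self by blast
    next
      case (insert a B)
      then obtain D where D: "subgroup D G" "coset_cover (carrier G) D" "\<forall>a\<in>B. D \<subseteq> H a" by blast
      have a: "subgroup (H a) G" "coset_cover (carrier G) (H a)"
        using insert.prems H coset_cover_carrier_iff by auto
      have "subgroup (H a \<inter> D) G" using subgroups_Inter_pair[OF a(1) D(1)] .
      moreover have "coset_cover (carrier G) (H a \<inter> D)" by (rule coset_cover_Int[OF a(1) D(1) a(2) D(2)])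
      ultimately show ?case using D(3) by (intro exI[of _ "H a \<inter> D"]) auto
    qed
    have "finite ?F" using A by simp
    from common[OF this subset_refl]
    obtain D where D: "subgroup D G" "coset_cover (carrier G) D" "\<And>a. a \<in> ?F \<Longrightarrow> D \<subseteq> H a" by blast
    let ?I = "A - ?F"
    let ?B = "(\<lambda>a. (inv y \<otimes> x a, H a)) ` ?I"
    have "\<not> D \<subseteq> (\<Union>(c, K)\<in>?B. c <# K)"
    proof (rule not_covered_by_infinite_index[OF D(1)])
      show "finite (H ` ?I)" "finite ?B" using A by auto
      show "?B \<subseteq> carrier G \<times> H ` ?I" using x y by auto
      show "subgroup K G" if "K \<in> H ` ?I" for K using that H by auto
      show "\<not> coset_cover D K" if "K \<in> H ` ?I" for K
        using that coset_cover_trans[OF D(2), of K] coset_cover_carrier_iff[of K] H subgroup.subset by blast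
    qed
    moreover have "D \<subseteq> (\<Union>(c, K)\<in>?B. c <# K)"
    proof
      fix d assume d: "d \<in> D"
      have dG: "d \<in> carrier G" using subgroup.mem_carrier[OF D(1) d] .
      obtain a where a: "a \<in> A" "y \<otimes> d \<in> x a <# H a" using cover y dG by blast
      have "a \<notin> ?F"
      proof
        assume aF: "a \<in> ?F"
        obtain h where h: "h \<in> H a" "y \<otimes> d = x a \<otimes> h" using a(2) by (auto simp: mem_l_coset)
        have hG: "h \<in> carrier G" using subgroup.mem_carrier[OF H[OF a(1)] h(1)] .
        have "y = x a \<otimes> (h \<otimes> inv d)"
          by (rule mult_eq_solve[OF y dG x[OF a(1)] hG h(2)])
        moreover have "h \<otimes> inv d \<in> H a"
          using H[OF a(1)] h(1) D(3)[OF aF] d by (meson subgroup.m_closed subgroup.m_inv_closed subsetD)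
        ultimately show False using notin aF by (auto simp: mem_l_coset)
      qed
      moreover have "d \<in> (inv y \<otimes> x a) <# H a"
      proof -
        obtain h where h: "h \<in> H a" "y \<otimes> d = x a \<otimes> h" using a(2) by (auto simp: mem_l_coset)
        have hG: "h \<in> carrier G" using subgroup.mem_carrier[OF H[OF a(1)] h(1)] .
        have "d = inv y \<otimes> (y \<otimes> d)" using y dG by (simp add: m_assoc[symmetric])
        also have "\<dots> = inv y \<otimes> x a \<otimes> h" using h(2) y x[OF a(1)] hG by (simp add: m_assoc)
        finally show ?thesis using h(1) by (auto simp: mem_l_coset)
      qed
      ultimately show "d \<in> (\<Union>(c, K)\<in>?B. c <# K)" using a(1) by auto
    qed
    ultimately show False by blast
  qed
qed

end

section \<open>Isometric representations of right LCM semigroups\<close>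

lemma (in star_algebra) isometry_cancel:
  "\<lbrakk>a \<in> carrier A; x \<in> carrier A; a\<^sup>\<star> \<otimes> a = \<one>\<rbrakk> \<Longrightarrow> a\<^sup>\<star> \<otimes> (a \<otimes> x) = x"
  by (simp flip: m_assoc)

text \<open>Used to show that multiplicative families of isometries send the unit to the unit, which
  their definitions do not require.\<close>

lemma (in star_algebra) isometry_idempotent:
  "\<lbrakk>a \<in> carrier A; a\<^sup>\<star> \<otimes> a = \<one>; a \<otimes> a = a\<rbrakk> \<Longrightarrow> a = \<one>"
  using isometry_cancel[of a a] by simp

context right_lcm
begin

text \<open>Inserting the range projections on both sides gives v_s* v_t = v_s* e_X v_t, where X is
  the intersection of the two principal ideals. Either e_X = 0, or it is the range projection of s a
  = t b, and the isometries cancel.\<close>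

lemma lcm_rep_product:
  assumes B: "star_algebra B" and rep: "lcm_rep T B v e"
    and s: "s \<in> carrier T" and t: "t \<in> carrier T"
  shows "principal T s \<inter> principal T t = {} \<Longrightarrow> (v s)\<^sup>\<star>\<^bsub>B\<^esub> \<otimes>\<^bsub>B\<^esub> v t = \<zero>\<^bsub>B\<^esub>"
    "\<lbrakk>a \<in> carrier T; b \<in> carrier T; s \<otimes> a = t \<otimes> b;
      principal T s \<inter> principal T t = principal T (s \<otimes> a)\<rbrakk> \<Longrightarrow>
      (v s)\<^sup>\<star>\<^bsub>B\<^esub> \<otimes>\<^bsub>B\<^esub> v t = v a \<otimes>\<^bsub>B\<^esub> (v b)\<^sup>\<star>\<^bsub>B\<^esub>"
proof -
  interpret B: star_algebra B by fact
  have v [simp]: "v s \<in> carrier B" if "s \<in> carrier T" for s using rep that by (simp add: lcm_rep_def)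
  have iso [simp]: "(v s)\<^sup>\<star>\<^bsub>B\<^esub> \<otimes>\<^bsub>B\<^esub> v s = \<one>\<^bsub>B\<^esub>" if "s \<in> carrier T" for s
    using rep that by (simp add: lcm_rep_def)
  have vv: "v s \<otimes>\<^bsub>B\<^esub> v t = v (s \<otimes> t)" if "s \<in> carrier T" "t \<in> carrier T" for s t
    using rep that by (simp add: lcm_rep_def)
  have ec: "e X \<in> carrier B" if "X \<in> constructible_ideals T" for X using rep that by (simp add: lcm_rep_def)
  have ee: "e (principal T s) \<otimes>\<^bsub>B\<^esub> e (principal T t) = e (principal T s \<inter> principal T t)"
    using rep s t by (simp add: lcm_rep_def)
  note es = lcm_rep_e[OF B rep]
  have *: "(v s)\<^sup>\<star>\<^bsub>B\<^esub> \<otimes>\<^bsub>B\<^esub> v t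
      = (v s)\<^sup>\<star>\<^bsub>B\<^esub> \<otimes>\<^bsub>B\<^esub> (e (principal T s \<inter> principal T t) \<otimes>\<^bsub>B\<^esub> v t)"
    unfolding ee[symmetric] es[OF s] es[OF t] using s t by (simp add: B.m_assoc B.isometry_cancel)
  {
    assume "principal T s \<inter> principal T t = {}"
    moreover have "e {} = \<zero>\<^bsub>B\<^esub>" using rep by (simp add: lcm_rep_def)
    ultimately show "(v s)\<^sup>\<star>\<^bsub>B\<^esub> \<otimes>\<^bsub>B\<^esub> v t = \<zero>\<^bsub>B\<^esub>" using * s t by simp
  }
  assume ab: "a \<in> carrier T" "b \<in> carrier T" "s \<otimes> a = t \<otimes> b"
    "principal T s \<inter> principal T t = principal T (s \<otimes> a)"
  have "e (principal T s \<inter> principal T t) = v s \<otimes>\<^bsub>B\<^esub> v a \<otimes>\<^bsub>B\<^esub> (v t \<otimes>\<^bsub>B\<^esub> v b)\<^sup>\<star>\<^bsub>B\<^esub>"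
    using ab s t es[of "s \<otimes> a"] by (simp add: vv)
  then show "(v s)\<^sup>\<star>\<^bsub>B\<^esub> \<otimes>\<^bsub>B\<^esub> v t = v a \<otimes>\<^bsub>B\<^esub> (v b)\<^sup>\<star>\<^bsub>B\<^esub>"
    unfolding * using s t ab(1,2) by (simp add: B.adj_mult B.m_assoc B.isometry_cancel)
qed

text \<open>The generator of a principal right ideal is unique up to a unit, and units act by
  unitaries, so the choice of \<open>t\<close> is immaterial.\<close>

definition range_projection :: "('b, 'k) star_alg_scheme \<Rightarrow> ('s \<Rightarrow> 'b) \<Rightarrow> 's set \<Rightarrow> 'b" where
  "range_projection B v X = (if X = {} then \<zero>\<^bsub>B\<^esub>
    else let t = SOME t. t \<in> carrier T \<and> X = principal T t in v t \<otimes>\<^bsub>B\<^esub> (v t)\<^sup>\<star>\<^bsub>B\<^esub>)"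

text \<open>The product of two range projections is v_s (v_s* v_t) v_t*, which \<open>disj\<close>
  and \<open>meet\<close> evaluate to zero or to the range projection of a least common multiple.
  One choice of that multiple suffices, as the projection depends only on the ideal.\<close>

lemma lcm_rep_of_isometries:
  assumes B: "star_algebra B"
    and v: "\<And>s. s \<in> carrier T \<Longrightarrow> v s \<in> carrier B"
    and iso: "\<And>s. s \<in> carrier T \<Longrightarrow> (v s)\<^sup>\<star>\<^bsub>B\<^esub> \<otimes>\<^bsub>B\<^esub> v s = \<one>\<^bsub>B\<^esub>"
    and vv: "\<And>s t. s \<in> carrier T \<Longrightarrow> t \<in> carrier T \<Longrightarrow> v s \<otimes>\<^bsub>B\<^esub> v t = v (s \<otimes> t)"
    and disj: "\<And>s t. s \<in> carrier T \<Longrightarrow> t \<in> carrier T \<Longrightarrow> principal T s \<inter> principal T t = {} \<Longrightarrow>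
      (v s)\<^sup>\<star>\<^bsub>B\<^esub> \<otimes>\<^bsub>B\<^esub> v t = \<zero>\<^bsub>B\<^esub>"
    and meet: "\<And>s t. s \<in> carrier T \<Longrightarrow> t \<in> carrier T \<Longrightarrow> principal T s \<inter> principal T t \<noteq> {} \<Longrightarrow>
      \<exists>a\<in>carrier T. \<exists>b\<in>carrier T. s \<otimes> a = t \<otimes> b \<and>
        principal T s \<inter> principal T t = principal T (s \<otimes> a) \<and>
        (v s)\<^sup>\<star>\<^bsub>B\<^esub> \<otimes>\<^bsub>B\<^esub> v t = v a \<otimes>\<^bsub>B\<^esub> (v b)\<^sup>\<star>\<^bsub>B\<^esub>"
  shows "lcm_rep T B v (range_projection B v)"
proof -
  interpret B: star_algebra B by fact
  let ?e = "range_projection B v"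
  note v [simp] and iso [simp]
  have v1: "v \<one> = \<one>\<^bsub>B\<^esub>" by (rule B.isometry_idempotent) (simp_all add: vv)
  \<comment> \<open>A right inverse b of \<open>a\<close> forces v b to be the adjoint of v a, so
    the isometry v a is unitary.\<close>
  have unit: "v a \<otimes>\<^bsub>B\<^esub> (v a)\<^sup>\<star>\<^bsub>B\<^esub> = \<one>\<^bsub>B\<^esub>" if ab: "a \<in> carrier T" "b \<in> carrier T" "a \<otimes> b = \<one>" for a b
  proof -
    have "v b = (v a)\<^sup>\<star>\<^bsub>B\<^esub> \<otimes>\<^bsub>B\<^esub> (v a \<otimes>\<^bsub>B\<^esub> v b)" using ab by (simp add: B.isometry_cancel)
    also have "\<dots> = (v a)\<^sup>\<star>\<^bsub>B\<^esub>" using ab by (simp add: vv v1)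
    finally have "v a \<otimes>\<^bsub>B\<^esub> (v a)\<^sup>\<star>\<^bsub>B\<^esub> = v a \<otimes>\<^bsub>B\<^esub> v b" by simp
    then show ?thesis using ab by (simp add: vv v1)
  qed
  have same: "v t \<otimes>\<^bsub>B\<^esub> (v t)\<^sup>\<star>\<^bsub>B\<^esub> = v s \<otimes>\<^bsub>B\<^esub> (v s)\<^sup>\<star>\<^bsub>B\<^esub>"
    if st: "s \<in> carrier T" "t \<in> carrier T" "principal T s = principal T t" for s t
  proof -
    obtain a where a: "a \<in> carrier T" "t = s \<otimes> a"
      using self_mem_principal[OF st(2)] st(3) principal_iff by blast
    obtain b where b: "b \<in> carrier T" "s = t \<otimes> b"
      using self_mem_principal[OF st(1)] st(3) principal_iff by blast
    have "s \<otimes> (a \<otimes> b) = t \<otimes> b" using a b(1) st(1) by (simp add: m_assoc)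
    also have "\<dots> = s \<otimes> \<one>" using b(2) st(1) by simp
    finally have "s \<otimes> (a \<otimes> b) = s \<otimes> \<one>" .
    then have "a \<otimes> b = \<one>" using a(1) b(1) st(1) by (intro left_cancel[of s "a \<otimes> b" \<one>]) auto
    then have "v a \<otimes>\<^bsub>B\<^esub> (v a)\<^sup>\<star>\<^bsub>B\<^esub> = \<one>\<^bsub>B\<^esub>" by (rule unit[OF a(1) b(1)])
    moreover have "v t \<otimes>\<^bsub>B\<^esub> (v t)\<^sup>\<star>\<^bsub>B\<^esub> = v s \<otimes>\<^bsub>B\<^esub> (v a \<otimes>\<^bsub>B\<^esub> (v a)\<^sup>\<star>\<^bsub>B\<^esub>) \<otimes>\<^bsub>B\<^esub> (v s)\<^sup>\<star>\<^bsub>B\<^esub>"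
      using a st(1) by (simp add: vv[symmetric] B.adj_mult B.m_assoc)
    ultimately show ?thesis using st(1) by simp
  qed
  have e0: "?e {} = \<zero>\<^bsub>B\<^esub>" by (simp add: range_projection_def)
  have e: "?e (principal T s) = v s \<otimes>\<^bsub>B\<^esub> (v s)\<^sup>\<star>\<^bsub>B\<^esub>" if s: "s \<in> carrier T" for s
  proof -
    let ?t = "SOME t. t \<in> carrier T \<and> principal T s = principal T t"
    have "?t \<in> carrier T \<and> principal T s = principal T ?t" by (rule someI[of _ s]) (simp add: s)
    then have "v ?t \<otimes>\<^bsub>B\<^esub> (v ?t)\<^sup>\<star>\<^bsub>B\<^esub> = v s \<otimes>\<^bsub>B\<^esub> (v s)\<^sup>\<star>\<^bsub>B\<^esub>"
      using same[OF s] by blast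
    moreover have "principal T s \<noteq> {}" using self_mem_principal[OF s] by blast
    ultimately show ?thesis by (simp add: range_projection_def Let_def)
  qed
  have proj: "?e X \<in> carrier B \<and> (?e X)\<^sup>\<star>\<^bsub>B\<^esub> = ?e X \<and> ?e X \<otimes>\<^bsub>B\<^esub> ?e X = ?e X"
    if "X \<in> constructible_ideals T" for X
    using that
    by (elim constructible_idealsE) (simp_all add: e0 e B.adj_mult B.m_assoc B.isometry_cancel)
  have trans: "v s \<otimes>\<^bsub>B\<^esub> ?e X \<otimes>\<^bsub>B\<^esub> (v s)\<^sup>\<star>\<^bsub>B\<^esub> = ?e (s <# X)"
    if s: "s \<in> carrier T" and X: "X \<in> constructible_ideals T" for s X
    using X
  proof (cases rule: constructible_idealsE)
    case (2 t)
    then show ?thesis using s by (simp add: e principal_translate vv[symmetric] B.adj_mult B.m_assoc)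
  qed (use s in \<open>simp add: e0\<close>)
  have inter: "?e X \<otimes>\<^bsub>B\<^esub> ?e Y = ?e (X \<inter> Y)"
    if X: "X \<in> constructible_ideals T" and Y: "Y \<in> constructible_ideals T" for X Y
    using X
  proof (cases rule: constructible_idealsE)
    case 1
    then show ?thesis using proj[OF Y] by (simp add: e0)
  next
    case s: (2 s)
    show ?thesis
      using Y
    proof (cases rule: constructible_idealsE)
      case 1
      then show ?thesis using proj[OF X] by (simp add: e0)
    next
      case t: (2 t)
      have "?e X \<otimes>\<^bsub>B\<^esub> ?e Y = v s \<otimes>\<^bsub>B\<^esub> ((v s)\<^sup>\<star>\<^bsub>B\<^esub> \<otimes>\<^bsub>B\<^esub> v t) \<otimes>\<^bsub>B\<^esub> (v t)\<^sup>\<star>\<^bsub>B\<^esub>"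
        using s t by (simp add: e B.m_assoc)
      also have "\<dots> = ?e (X \<inter> Y)"
      proof (cases "X \<inter> Y = {}")
        case True
        then show ?thesis using disj[OF s(1) t(1)] s t by (simp add: e0)
      next
        case False
        then obtain a b where ab: "a \<in> carrier T" "b \<in> carrier T" "s \<otimes> a = t \<otimes> b"
          "X \<inter> Y = principal T (s \<otimes> a)" "(v s)\<^sup>\<star>\<^bsub>B\<^esub> \<otimes>\<^bsub>B\<^esub> v t = v a \<otimes>\<^bsub>B\<^esub> (v b)\<^sup>\<star>\<^bsub>B\<^esub>"
          using meet[OF s(1) t(1)] s(2) t(2) by blast
        have "v s \<otimes>\<^bsub>B\<^esub> (v a \<otimes>\<^bsub>B\<^esub> (v b)\<^sup>\<star>\<^bsub>B\<^esub>) \<otimes>\<^bsub>B\<^esub> (v t)\<^sup>\<star>\<^bsub>B\<^esub>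
            = (v s \<otimes>\<^bsub>B\<^esub> v a) \<otimes>\<^bsub>B\<^esub> (v t \<otimes>\<^bsub>B\<^esub> v b)\<^sup>\<star>\<^bsub>B\<^esub>"
          using s t ab(1,2) by (simp add: B.adj_mult B.m_assoc)
        also have "\<dots> = v (s \<otimes> a) \<otimes>\<^bsub>B\<^esub> (v (s \<otimes> a))\<^sup>\<star>\<^bsub>B\<^esub>"
          using s t ab(1-3) by (simp add: vv)
        also have "\<dots> = ?e (X \<inter> Y)" using s ab(1,4) by (simp add: e)
        finally show ?thesis by (simp add: ab(5))
      qed
      finally show ?thesis .
    qed
  qed
  have "?e (carrier T) = \<one>\<^bsub>B\<^esub>" using e[of \<one>] by (simp add: v1)
  then show ?thesis unfolding lcm_rep_def using proj trans inter by (simp add: e0 vv)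
qed

end

section \<open>The semidirect product\<close>

context algebraic_dynamical_system
begin

abbreviation "S \<equiv> semidirect G P \<theta>"

lemma theta_hom: "p \<in> carrier P \<Longrightarrow> group_hom G G (\<theta> p)"
  using endo by (simp add: group_hom_def group_hom_axioms_def)

lemma theta_closed [simp]: "p \<in> carrier P \<Longrightarrow> g \<in> carrier G \<Longrightarrow> \<theta> p g \<in> carrier G"
  using group_hom.hom_closed[OF theta_hom] .

lemma theta_mult:
  "p \<in> carrier P \<Longrightarrow> g \<in> carrier G \<Longrightarrow> h \<in> carrier G \<Longrightarrow> \<theta> p (g \<otimes>\<^bsub>G\<^esub> h) = \<theta> p g \<otimes>\<^bsub>G\<^esub> \<theta> p h"
  using group_hom.hom_mult[OF theta_hom] .

lemma theta_one [simp]: "p \<in> carrier P \<Longrightarrow> \<theta> p \<one>\<^bsub>G\<^esub> = \<one>\<^bsub>G\<^esub>"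
  using group_hom.hom_one[OF theta_hom] .

lemma theta_inv: "p \<in> carrier P \<Longrightarrow> g \<in> carrier G \<Longrightarrow> \<theta> p (inv\<^bsub>G\<^esub> g) = inv\<^bsub>G\<^esub> (\<theta> p g)"
  using group_hom.hom_inv[OF theta_hom] .

lemma theta_range_subgroup: "p \<in> carrier P \<Longrightarrow> subgroup (\<theta> p ` carrier G) G"
  using group_hom.img_is_subgroup[OF theta_hom] .

lemma S_carrier: "carrier S = carrier G \<times> carrier P"
  and S_mult: "(g, p) \<otimes>\<^bsub>S\<^esub> (h, q) = (g \<otimes>\<^bsub>G\<^esub> \<theta> p h, p \<otimes>\<^bsub>P\<^esub> q)"
  and S_one: "\<one>\<^bsub>S\<^esub> = (\<one>\<^bsub>G\<^esub>, \<one>\<^bsub>P\<^esub>)"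
  by (simp_all add: semidirect_def)

lemma S_monoid: "monoid S"
  by (rule monoidI) (auto simp: S_carrier S_mult S_one theta_mult action action_one G.m_assoc P.m_assoc)

lemma S_left_cancel:
  assumes "x \<in> carrier S" "y \<in> carrier S" "z \<in> carrier S" "x \<otimes>\<^bsub>S\<^esub> y = x \<otimes>\<^bsub>S\<^esub> z"
  shows "y = z"
proof -
  obtain g p h q k r where xyz: "x = (g, p)" "y = (h, q)" "z = (k, r)" by (metis surj_pair)
  then have "\<theta> p h = \<theta> p k" "p \<otimes>\<^bsub>P\<^esub> q = p \<otimes>\<^bsub>P\<^esub> r" using assms by (auto simp: S_carrier S_mult)
  moreover have "p \<in> carrier P" "h \<in> carrier G" "k \<in> carrier G" "q \<in> carrier P" "r \<in> carrier P"
    using assms(1-3) xyz by (auto simp: S_carrier)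
  ultimately show ?thesis
    using inj_onD[OF inj, of p h k] P.left_cancel[of p q r] by (simp add: xyz)
qed

lemma principal_S_iff:
  "x \<in> principal S (g, p) \<longleftrightarrow>
    (\<exists>k\<in>carrier G. \<exists>p'\<in>carrier P. x = (g \<otimes>\<^bsub>G\<^esub> \<theta> p k, p \<otimes>\<^bsub>P\<^esub> p'))"
  by (auto simp: l_coset_def S_carrier S_mult)

lemma mem_principal_S:
  assumes "g \<in> carrier G" "h \<in> carrier G" "p \<in> carrier P"
  shows "(h, m) \<in> principal S (g, p) \<longleftrightarrow> m \<in> principal P p \<and> h \<in> g <#\<^bsub>G\<^esub> (\<theta> p ` carrier G)"
  by (auto simp: principal_S_iff P.principal_iff G.mem_l_coset)

text \<open>For any other common multiple the quotient of the group components can be computed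
  through p and through q, so it lies in both images. Respecting the order places it in the image of
  theta_r, with r = p p', which is what divisibility in \<open>S\<close> asks for.\<close>

lemma principal_S_Int:
  assumes g: "g \<in> carrier G" and h: "h \<in> carrier G" and p: "p \<in> carrier P" and q: "q \<in> carrier P"
    and k: "k \<in> carrier G" and l: "l \<in> carrier G" and p': "p' \<in> carrier P" and q': "q' \<in> carrier P"
    and r: "principal P p \<inter> principal P q = principal P (p \<otimes>\<^bsub>P\<^esub> p')" "p \<otimes>\<^bsub>P\<^esub> p' = q \<otimes>\<^bsub>P\<^esub> q'"
    and eq: "g \<otimes>\<^bsub>G\<^esub> \<theta> p k = h \<otimes>\<^bsub>G\<^esub> \<theta> q l"
  shows "principal S (g, p) \<inter> principal S (h, q) = principal S (g \<otimes>\<^bsub>G\<^esub> \<theta> p k, p \<otimes>\<^bsub>P\<^esub> p')"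
proof
  show "principal S (g \<otimes>\<^bsub>G\<^esub> \<theta> p k, p \<otimes>\<^bsub>P\<^esub> p') \<subseteq> principal S (g, p) \<inter> principal S (h, q)"
  proof
    fix x assume "x \<in> principal S (g \<otimes>\<^bsub>G\<^esub> \<theta> p k, p \<otimes>\<^bsub>P\<^esub> p')"
    then obtain m c where mc: "m \<in> carrier G" "c \<in> carrier P"
      "x = (g \<otimes>\<^bsub>G\<^esub> \<theta> p k \<otimes>\<^bsub>G\<^esub> \<theta> (p \<otimes>\<^bsub>P\<^esub> p') m, p \<otimes>\<^bsub>P\<^esub> p' \<otimes>\<^bsub>P\<^esub> c)"
      by (auto simp: principal_S_iff)
    have "x = (g \<otimes>\<^bsub>G\<^esub> \<theta> p (k \<otimes>\<^bsub>G\<^esub> \<theta> p' m), p \<otimes>\<^bsub>P\<^esub> (p' \<otimes>\<^bsub>P\<^esub> c))"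
      using mc g p k p' by (simp add: theta_mult action G.m_assoc P.m_assoc)
    then have 1: "x \<in> principal S (g, p)" using mc k p' by (auto simp: principal_S_iff)
    have "x = (h \<otimes>\<^bsub>G\<^esub> \<theta> q (l \<otimes>\<^bsub>G\<^esub> \<theta> q' m), q \<otimes>\<^bsub>P\<^esub> (q' \<otimes>\<^bsub>P\<^esub> c))"
      using mc h q l q' by (simp add: eq r(2) theta_mult action G.m_assoc P.m_assoc)
    then have "x \<in> principal S (h, q)" using mc l q' by (auto simp: principal_S_iff)
    with 1 show "x \<in> principal S (g, p) \<inter> principal S (h, q)" by blast
  qed
  show "principal S (g, p) \<inter> principal S (h, q) \<subseteq> principal S (g \<otimes>\<^bsub>G\<^esub> \<theta> p k, p \<otimes>\<^bsub>P\<^esub> p')"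
  proof
    fix x assume "x \<in> principal S (g, p) \<inter> principal S (h, q)"
    then obtain k1 p1 l1 q1 where kp: "k1 \<in> carrier G" "p1 \<in> carrier P" "x = (g \<otimes>\<^bsub>G\<^esub> \<theta> p k1, p \<otimes>\<^bsub>P\<^esub> p1)"
      and lq: "l1 \<in> carrier G" "q1 \<in> carrier P" "x = (h \<otimes>\<^bsub>G\<^esub> \<theta> q l1, q \<otimes>\<^bsub>P\<^esub> q1)"
      unfolding Int_iff principal_S_iff by blast
    have "p \<otimes>\<^bsub>P\<^esub> p1 = q \<otimes>\<^bsub>P\<^esub> q1" using kp lq by simp
    then have "p \<otimes>\<^bsub>P\<^esub> p1 \<in> principal P p \<inter> principal P q"
      unfolding Int_iff P.principal_iff using kp(2) lq(2) by blast
    then obtain c where c: "c \<in> carrier P" "p \<otimes>\<^bsub>P\<^esub> p1 = p \<otimes>\<^bsub>P\<^esub> p' \<otimes>\<^bsub>P\<^esub> c"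
      using r(1) P.principal_iff by blast
    let ?y = "inv\<^bsub>G\<^esub> (g \<otimes>\<^bsub>G\<^esub> \<theta> p k) \<otimes>\<^bsub>G\<^esub> (g \<otimes>\<^bsub>G\<^esub> \<theta> p k1)"
    have diff: "inv\<^bsub>G\<^esub> (a \<otimes>\<^bsub>G\<^esub> b) \<otimes>\<^bsub>G\<^esub> (a \<otimes>\<^bsub>G\<^esub> c) = inv\<^bsub>G\<^esub> b \<otimes>\<^bsub>G\<^esub> c"
      if "a \<in> carrier G" "b \<in> carrier G" "c \<in> carrier G" for a b c
    proof -
      have "inv\<^bsub>G\<^esub> a \<otimes>\<^bsub>G\<^esub> (a \<otimes>\<^bsub>G\<^esub> c) = c" using that by (simp add: G.m_assoc[symmetric])
      then show ?thesis using that by (simp add: G.inv_mult_group G.m_assoc)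
    qed
    have y1: "?y = \<theta> p (inv\<^bsub>G\<^esub> k \<otimes>\<^bsub>G\<^esub> k1)" using g p k kp by (simp add: diff theta_mult theta_inv)
    have "?y = inv\<^bsub>G\<^esub> (h \<otimes>\<^bsub>G\<^esub> \<theta> q l) \<otimes>\<^bsub>G\<^esub> (h \<otimes>\<^bsub>G\<^esub> \<theta> q l1)" using eq kp lq by simp
    then have y2: "?y = \<theta> q (inv\<^bsub>G\<^esub> l \<otimes>\<^bsub>G\<^esub> l1)" using h q l lq by (simp add: diff theta_mult theta_inv)
    have "?y \<in> \<theta> p ` carrier G" unfolding y1 using k kp(1) by (intro imageI) simp
    moreover have "?y \<in> \<theta> q ` carrier G" unfolding y2 using l lq(1) by (intro imageI) simp
    ultimately have "?y \<in> \<theta> p ` carrier G \<inter> \<theta> q ` carrier G" by simp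
    then obtain m where m: "m \<in> carrier G" "?y = \<theta> (p \<otimes>\<^bsub>P\<^esub> p') m"
      using respects_order[OF p q _ r(1)] p p' by auto
    have "g \<otimes>\<^bsub>G\<^esub> \<theta> p k1 = g \<otimes>\<^bsub>G\<^esub> \<theta> p k \<otimes>\<^bsub>G\<^esub> ?y" using g p k kp by (simp add: G.m_assoc[symmetric])
    then have "x = (g \<otimes>\<^bsub>G\<^esub> \<theta> p k \<otimes>\<^bsub>G\<^esub> \<theta> (p \<otimes>\<^bsub>P\<^esub> p') m, p \<otimes>\<^bsub>P\<^esub> p' \<otimes>\<^bsub>P\<^esub> c)"
      using kp(3) c(2) m(2) by simp
    then show "x \<in> principal S (g \<otimes>\<^bsub>G\<^esub> \<theta> p k, p \<otimes>\<^bsub>P\<^esub> p')" using m(1) c(1) by (auto simp: principal_S_iff)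
  qed
qed

text \<open>Writing the group element of (A2) as g^-1 h turns its condition into g theta_p(k) = h
  theta_q(l). It then says that (g, p) and (h, q) have the common multiple (g, p)(k, p') = (h, q)(l,
  q').\<close>

lemma A2_case_iff:
  assumes g: "g \<in> carrier G" and h: "h \<in> carrier G" and p: "p \<in> carrier P" and q: "q \<in> carrier P"
  shows "A2_case G P \<theta> p q (inv\<^bsub>G\<^esub> g \<otimes>\<^bsub>G\<^esub> h) p' q' k l \<longleftrightarrow>
    p' \<in> carrier P \<and> q' \<in> carrier P \<and> k \<in> carrier G \<and> l \<in> carrier G \<and>
    principal P p \<inter> principal P q = principal P (p \<otimes>\<^bsub>P\<^esub> p') \<and> p \<otimes>\<^bsub>P\<^esub> p' = q \<otimes>\<^bsub>P\<^esub> q' \<and>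
    g \<otimes>\<^bsub>G\<^esub> \<theta> p k = h \<otimes>\<^bsub>G\<^esub> \<theta> q l"
proof -
  have "inv\<^bsub>G\<^esub> g \<otimes>\<^bsub>G\<^esub> h = a \<otimes>\<^bsub>G\<^esub> inv\<^bsub>G\<^esub> b \<longleftrightarrow> g \<otimes>\<^bsub>G\<^esub> a = h \<otimes>\<^bsub>G\<^esub> b"
    if a: "a \<in> carrier G" and b: "b \<in> carrier G" for a b
  proof
    assume eq: "inv\<^bsub>G\<^esub> g \<otimes>\<^bsub>G\<^esub> h = a \<otimes>\<^bsub>G\<^esub> inv\<^bsub>G\<^esub> b"
    have "h = g \<otimes>\<^bsub>G\<^esub> (inv\<^bsub>G\<^esub> g \<otimes>\<^bsub>G\<^esub> h)" using g h by (simp add: G.m_assoc[symmetric])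
    then have "h \<otimes>\<^bsub>G\<^esub> b = g \<otimes>\<^bsub>G\<^esub> (a \<otimes>\<^bsub>G\<^esub> inv\<^bsub>G\<^esub> b) \<otimes>\<^bsub>G\<^esub> b" by (simp add: eq)
    then show "g \<otimes>\<^bsub>G\<^esub> a = h \<otimes>\<^bsub>G\<^esub> b" using a b g by (simp add: G.m_assoc)
  next
    assume eq: "g \<otimes>\<^bsub>G\<^esub> a = h \<otimes>\<^bsub>G\<^esub> b"
    have "h = g \<otimes>\<^bsub>G\<^esub> (a \<otimes>\<^bsub>G\<^esub> inv\<^bsub>G\<^esub> b)"
      by (rule G.mult_eq_solve) (use a b g h eq in auto)
    then show "inv\<^bsub>G\<^esub> g \<otimes>\<^bsub>G\<^esub> h = a \<otimes>\<^bsub>G\<^esub> inv\<^bsub>G\<^esub> b"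
      using a b g by (simp add: G.m_assoc[symmetric])
  qed
  then have key: "inv\<^bsub>G\<^esub> g \<otimes>\<^bsub>G\<^esub> h = \<theta> p k \<otimes>\<^bsub>G\<^esub> \<theta> q (inv\<^bsub>G\<^esub> l) \<longleftrightarrow> g \<otimes>\<^bsub>G\<^esub> \<theta> p k = h \<otimes>\<^bsub>G\<^esub> \<theta> q l"
    if "k \<in> carrier G" "l \<in> carrier G"
    using p q that by (simp add: theta_inv)
  show ?thesis
    unfolding A2_case_def using p q key by (metis P.m_closed)
qed

text \<open>A common multiple supplies \<open>k\<close> and \<open>l\<close>. Its second component
  only shows that p and q have a least common multiple, whose cofactors replace those of the given
  one.\<close>

lemma principal_S_meet:
  assumes g: "g \<in> carrier G" and h: "h \<in> carrier G" and p: "p \<in> carrier P" and q: "q \<in> carrier P"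
    and ne: "principal S (g, p) \<inter> principal S (h, q) \<noteq> {}"
  shows "\<exists>p' q' k l. A2_case G P \<theta> p q (inv\<^bsub>G\<^esub> g \<otimes>\<^bsub>G\<^esub> h) p' q' k l"
proof -
  obtain k p1 l q1 where kl: "k \<in> carrier G" "p1 \<in> carrier P" "l \<in> carrier G" "q1 \<in> carrier P"
    "g \<otimes>\<^bsub>G\<^esub> \<theta> p k = h \<otimes>\<^bsub>G\<^esub> \<theta> q l" "p \<otimes>\<^bsub>P\<^esub> p1 = q \<otimes>\<^bsub>P\<^esub> q1"
    using ne by (auto simp: principal_S_iff set_eq_iff)
  then have "p \<otimes>\<^bsub>P\<^esub> p1 \<in> principal P p \<inter> principal P q"
    unfolding Int_iff P.principal_iff by blast
  then obtain r where r: "r \<in> carrier P" "principal P p \<inter> principal P q = principal P r"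
    using P.lcm[OF p q] by blast
  then have "r \<in> principal P p \<inter> principal P q" using P.self_mem_principal by blast
  then obtain p' q' where "p' \<in> carrier P" "r = p \<otimes>\<^bsub>P\<^esub> p'" "q' \<in> carrier P" "r = q \<otimes>\<^bsub>P\<^esub> q'"
    unfolding Int_iff P.principal_iff by blast
  then have "A2_case G P \<theta> p q (inv\<^bsub>G\<^esub> g \<otimes>\<^bsub>G\<^esub> h) p' q' k l"
    unfolding A2_case_iff[OF g h p q] using r kl by simp
  then show ?thesis by blast
qed

lemma A2_case_principal_S:
  assumes "g \<in> carrier G" "h \<in> carrier G" "p \<in> carrier P" "q \<in> carrier P"
    and "A2_case G P \<theta> p q (inv\<^bsub>G\<^esub> g \<otimes>\<^bsub>G\<^esub> h) p' q' k l"
  shows "(k, p') \<in> carrier S" "(l, q') \<in> carrier S"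
    "(g, p) \<otimes>\<^bsub>S\<^esub> (k, p') = (h, q) \<otimes>\<^bsub>S\<^esub> (l, q')"
    "principal S (g, p) \<inter> principal S (h, q) = principal S ((g, p) \<otimes>\<^bsub>S\<^esub> (k, p'))"
  using assms principal_S_Int[of g h p q k l p' q'] by (auto simp: A2_case_iff S_carrier S_mult)

theorem S_right_lcm: "right_lcm S"
proof (intro right_lcm.intro S_monoid right_lcm_axioms.intro)
  show "countable (carrier S)" using countable_G P.countable by (simp add: S_carrier)
  fix x y assume x: "x \<in> carrier S" and y: "y \<in> carrier S"
  obtain g p h q where xy: "x = (g, p)" "y = (h, q)" by (metis surj_pair)
  interpret monoid S by (rule S_monoid)
  show "principal S x \<inter> principal S y = {} \<or> (\<exists>r\<in>carrier S. principal S x \<inter> principal S y = principal S r)"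
  proof (cases "principal S x \<inter> principal S y = {}")
    case False
    then obtain p' q' k l where "A2_case G P \<theta> p q (inv\<^bsub>G\<^esub> g \<otimes>\<^bsub>G\<^esub> h) p' q' k l"
      using principal_S_meet[of g h p q] x y xy by (auto simp: S_carrier)
    then show ?thesis
      using A2_case_principal_S[of g h p q p' q' k l] x y xy
      by (intro disjI2 bexI[of _ "(g, p) \<otimes>\<^bsub>S\<^esub> (k, p')"]) (auto simp: S_carrier S_mult)
  qed simp
qed (rule S_left_cancel)

end

section \<open>Products of complements of projections\<close>

context star_algebra
begin

text \<open>In (1 - f x)(1 - sum) the mixed term vanishes by orthogonality. For elementary
  foundation sets this translates between the product form of the boundary relations and the sum in
  (O).\<close>

lemma defect_prod_orthogonal:
  assumes "distinct xs" "\<And>s. s \<in> set xs \<Longrightarrow> f s \<in> carrier A"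
    and "\<And>s t. s \<in> set xs \<Longrightarrow> t \<in> set xs \<Longrightarrow> s \<noteq> t \<Longrightarrow> f s \<otimes> f t = \<zero>"
  shows "defect_prod A f xs = \<one> \<ominus> (\<Oplus>s\<in>set xs. f s)"
  using assms
proof (induction xs)
  case Nil
  then show ?case by (simp add: defect_prod_def)
next
  case (Cons x xs)
  let ?\<sigma> = "\<Oplus>s\<in>set xs. f s"
  have x: "f x \<in> carrier A" and \<sigma>: "?\<sigma> \<in> carrier A" and fs: "f \<in> set xs \<rightarrow> carrier A"
    using Cons.prems(2) by (auto intro!: finsum_closed)
  have "f x \<otimes> ?\<sigma> = (\<Oplus>s\<in>set xs. f x \<otimes> f s)" using x fs by (intro finsum_rdistr) auto
  also have "\<dots> = (\<Oplus>s\<in>set xs. \<zero>)" using Cons.prems by (intro finsum_cong') auto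
  finally have x\<sigma>: "f x \<otimes> ?\<sigma> = \<zero>" by simp
  have "defect_prod A f (x # xs) = (\<one> \<ominus> f x) \<otimes> (\<one> \<ominus> ?\<sigma>)"
    using Cons by (simp add: defect_prod_def)
  also have "\<dots> = \<one> \<ominus> (f x \<oplus> ?\<sigma>)"
    using x \<sigma> by (simp add: l_diff_distr r_diff_distr x\<sigma>) (simp add: a_minus_def minus_add a_ac)
  also have "f x \<oplus> ?\<sigma> = (\<Oplus>s\<in>set (x # xs). f s)" using Cons.prems(1) x fs by simp
  finally show ?case .
qed

lemma defect_prod_commute:
  assumes y: "y \<in> carrier A" and "\<And>s. s \<in> set xs \<Longrightarrow> f s \<in> carrier A"
    and "\<And>s. s \<in> set xs \<Longrightarrow> f s \<otimes> y = y \<otimes> f s"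
  shows "defect_prod A f xs \<otimes> y = y \<otimes> defect_prod A f xs"
  using assms(2,3)
proof (induction xs)
  case Nil
  then show ?case using y by (simp add: defect_prod_def)
next
  case (Cons b xs)
  have b: "f b \<in> carrier A" "f b \<otimes> y = y \<otimes> f b" using Cons.prems by auto
  have d: "defect_prod A f xs \<in> carrier A" using Cons.prems(1) by (intro defect_prod_closed) auto
  have IH: "defect_prod A f xs \<otimes> y = y \<otimes> defect_prod A f xs" using Cons by auto
  have "defect_prod A f (b # xs) \<otimes> y = ((\<one> \<ominus> f b) \<otimes> y) \<otimes> defect_prod A f xs"
    using b d y IH by (simp add: defect_prod_def m_assoc)
  also have "(\<one> \<ominus> f b) \<otimes> y = y \<otimes> (\<one> \<ominus> f b)" using b y by (simp add: l_diff_distr r_diff_distr)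
  finally show ?case using b d y by (simp add: defect_prod_def m_assoc)
qed

text \<open>As y commutes with all factors, it can be moved next to 1 - f x, which annihilates
  it.\<close>

lemma defect_prod_absorb:
  assumes y: "y \<in> carrier A" and f: "\<And>s. s \<in> set xs \<Longrightarrow> f s \<in> carrier A"
    and comm: "\<And>s. s \<in> set xs \<Longrightarrow> f s \<otimes> y = y \<otimes> f s" and x: "x \<in> set xs" "f x \<otimes> y = y"
  shows "defect_prod A f xs \<otimes> y = \<zero>"
  using f comm x
proof (induction xs)
  case (Cons a xs)
  have a: "f a \<in> carrier A" "f a \<otimes> y = y \<otimes> f a" using Cons.prems(1,2) by auto
  have dx: "defect_prod A f xs \<in> carrier A" using Cons.prems(1) by (intro defect_prod_closed) auto
  show ?case
  proof (cases "x \<in> set xs")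
    case True
    then have "defect_prod A f xs \<otimes> y = \<zero>" using Cons by auto
    then show ?thesis using a dx y by (simp add: defect_prod_def m_assoc)
  next
    case False
    have commute: "defect_prod A f xs \<otimes> y = y \<otimes> defect_prod A f xs"
      using Cons.prems(1,2) by (intro defect_prod_commute y) auto
    have "a = x" using False Cons.prems(3) by simp
    then have "(\<one> \<ominus> f a) \<otimes> y = \<zero>" using Cons.prems(4) a y by (simp add: l_diff_distr)
    moreover have "defect_prod A f (a # xs) \<otimes> y = ((\<one> \<ominus> f a) \<otimes> y) \<otimes> defect_prod A f xs"
      using a dx y commute by (simp add: defect_prod_def m_assoc)
    ultimately show ?thesis using dx by simp
  qed
qed simp

end

section \<open>Passing to multiples that decide all intersections\<close>

context right_lcm
begin

lemma principal_mono:
  assumes "r \<in> carrier T" "t \<in> principal T r"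
  shows "principal T t \<subseteq> principal T r"
proof
  fix x assume "x \<in> principal T t"
  then obtain a b where ab: "a \<in> carrier T" "b \<in> carrier T" "t = r \<otimes> a" "x = t \<otimes> b"
    using assms(2) unfolding principal_iff by blast
  then have "x = r \<otimes> (a \<otimes> b)" using assms(1) by (simp add: m_assoc)
  then show "x \<in> principal T r" using ab(1,2) by (auto simp: principal_iff)
qed

text \<open>Whenever r and p have a common multiple, r is replaced by a least one. The alternatives
  already decided persist, because both are inherited by smaller principal ideals.\<close>

lemma deepen:
  assumes "finite V" "V \<subseteq> carrier T" "q \<in> carrier T"
  shows "\<exists>r\<in>principal T q. \<forall>p\<in>V. r \<in> principal T p \<or> principal T r \<inter> principal T p = {}"
  using assms
proof (induction V rule: finite_induct)
  case empty
  then show ?case using self_mem_principal by auto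
next
  case (insert p V)
  then obtain r where r: "r \<in> principal T q"
    "\<forall>p\<in>V. r \<in> principal T p \<or> principal T r \<inter> principal T p = {}" by auto
  have rT: "r \<in> carrier T" using r(1) principal_subset insert.prems(2) by blast
  show ?case
  proof (cases "principal T r \<inter> principal T p = {}")
    case True
    then show ?thesis using r by (intro bexI[of _ r]) auto
  next
    case False
    then obtain t where t: "t \<in> carrier T" "principal T r \<inter> principal T p = principal T t"
      using lcm[of r p] rT insert.prems(1) by auto
    then have tm: "t \<in> principal T r" "t \<in> principal T p" using self_mem_principal by auto
    have sub: "principal T t \<subseteq> principal T r" by (rule principal_mono[OF rT tm(1)])
    have "t \<in> principal T p' \<or> principal T t \<inter> principal T p' = {}" if p': "p' \<in> V" for p'
    proof (cases "r \<in> principal T p'")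
      case True
      then have "principal T r \<subseteq> principal T p'" using principal_mono[of p' r] insert.prems(1) p' by blast
      then show ?thesis using tm(1) by blast
    next
      case False
      then show ?thesis using r(2) p' sub by blast
    qed
    moreover have "t \<in> principal T q" using principal_mono[OF insert.prems(2) r(1)] tm(1) by blast
    ultimately show ?thesis using tm(2) by (intro bexI[of _ t]) auto
  qed
qed

end

section \<open>Elementary foundation sets\<close>

context algebraic_dynamical_system
begin

lemma coset_self: "g \<in> carrier G \<Longrightarrow> p \<in> carrier P \<Longrightarrow> g \<in> g <#\<^bsub>G\<^esub> (\<theta> p ` carrier G)"
  using G.lcos_self theta_range_subgroup by blast

lemma coset_sym:
  "\<lbrakk>g \<in> carrier G; p \<in> carrier P; h \<in> g <#\<^bsub>G\<^esub> (\<theta> p ` carrier G)\<rbrakk> \<Longrightarrow>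
    h \<in> carrier G \<and> h <#\<^bsub>G\<^esub> (\<theta> p ` carrier G) = g <#\<^bsub>G\<^esub> (\<theta> p ` carrier G)"
  using G.l_coset_eq[OF theta_range_subgroup] by (auto simp: G.mem_l_coset)

text \<open>The transversal over p meets every coset, which lifts the foundation property from
  \<open>P\<close> to \<open>S\<close>. Disjointness comes from accuracy for different second
  components and from uniqueness in the transversal for equal ones.\<close>

lemma elementary_foundation_set_S:
  assumes F: "elementary_foundation_set G P \<theta> F"
  shows "foundation_set S F"
    and "\<And>x y. x \<in> F \<Longrightarrow> y \<in> F \<Longrightarrow> x \<noteq> y \<Longrightarrow> principal S x \<inter> principal S y = {}"
proof -
  have fin: "finite F" and sub: "F \<subseteq> carrier G \<times> carrier P"
    and acc: "accurate_foundation_set P (snd ` F)"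
    and trans: "\<And>p. p \<in> snd ` F \<Longrightarrow> left_transversal G (\<theta> p ` carrier G) {g. (g, p) \<in> F}"
    using F by (auto simp: elementary_foundation_set_def)
  have "\<exists>t\<in>F. principal S x \<inter> principal S t \<noteq> {}" if x: "x \<in> carrier S" for x
  proof -
    obtain h q where hq: "x = (h, q)" "h \<in> carrier G" "q \<in> carrier P" using x by (auto simp: S_carrier)
    then obtain p where p: "p \<in> snd ` F" "principal P q \<inter> principal P p \<noteq> {}"
      using acc unfolding accurate_foundation_set_def foundation_set_def by blast
    then obtain z where z: "z \<in> principal P q" "z \<in> principal P p" by blast
    have pP: "p \<in> carrier P" using p(1) sub by auto
    have "h <#\<^bsub>G\<^esub> (\<theta> p ` carrier G) \<in> lcosets\<^bsub>G\<^esub> (\<theta> p ` carrier G)" using hq by (auto simp: LCOSETS_def)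
    then obtain g where g: "(g, p) \<in> F" "g \<in> h <#\<^bsub>G\<^esub> (\<theta> p ` carrier G)"
      using trans[OF p(1)] unfolding left_transversal_def by blast
    have gG: "g \<in> carrier G" using g(1) sub by auto
    have "h \<in> g <#\<^bsub>G\<^esub> (\<theta> p ` carrier G)"
      using coset_self[OF hq(2) pP] coset_sym[OF hq(2) pP g(2)] by simp
    then have "(h, z) \<in> principal S (g, p)"
      using z(2) mem_principal_S[OF gG hq(2) pP] by simp
    moreover have "(h, z) \<in> principal S (h, q)"
      using z(1) mem_principal_S[OF hq(2) hq(2) hq(3)] coset_self[OF hq(2,3)] by simp
    ultimately show ?thesis using g(1) hq(1) by blast
  qed
  then show "foundation_set S F" using fin sub by (simp add: foundation_set_def S_carrier)
  fix x y assume x: "x \<in> F" and y: "y \<in> F" and ne: "x \<noteq> y"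
  obtain g p h q where xy: "x = (g, p)" "y = (h, q)" by (metis surj_pair)
  have gh: "g \<in> carrier G" "h \<in> carrier G" "p \<in> carrier P" "q \<in> carrier P" using x y xy sub by auto
  show "principal S x \<inter> principal S y = {}"
  proof (rule ccontr)
    assume "principal S x \<inter> principal S y \<noteq> {}"
    then obtain a b where ab: "(a, b) \<in> principal S (g, p)" "(a, b) \<in> principal S (h, q)"
      using xy by (metis disjoint_iff surj_pair)
    then have a: "a \<in> carrier G" using gh by (auto simp: principal_S_iff)
    have 1: "b \<in> principal P p" "a \<in> g <#\<^bsub>G\<^esub> (\<theta> p ` carrier G)"
      using ab(1) mem_principal_S[OF gh(1) a gh(3)] by auto
    have 2: "b \<in> principal P q" "a \<in> h <#\<^bsub>G\<^esub> (\<theta> q ` carrier G)"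
      using ab(2) mem_principal_S[OF gh(2) a gh(4)] by auto
    have pF: "p \<in> snd ` F" "q \<in> snd ` F" using x y xy by force+
    have "p = q"
      using acc pF 1(1) 2(1) unfolding accurate_foundation_set_def by blast
    then have "g <#\<^bsub>G\<^esub> (\<theta> p ` carrier G) = h <#\<^bsub>G\<^esub> (\<theta> p ` carrier G)"
      using coset_sym[OF gh(1,3) 1(2)] coset_sym[OF gh(2,4) 2(2)] by simp
    then have "g \<in> {g. (g, p) \<in> F} \<inter> (g <#\<^bsub>G\<^esub> (\<theta> p ` carrier G))"
      "h \<in> {g. (g, p) \<in> F} \<inter> (g <#\<^bsub>G\<^esub> (\<theta> p ` carrier G))"
      using coset_self[OF gh(1,3)] coset_self[OF gh(2,3)] x y xy \<open>p = q\<close> by auto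
    moreover have "g <#\<^bsub>G\<^esub> (\<theta> p ` carrier G) \<in> lcosets\<^bsub>G\<^esub> (\<theta> p ` carrier G)"
      using gh by (auto simp: LCOSETS_def)
    ultimately have "g = h" using trans[OF pF(1)] unfolding left_transversal_def by blast
    then show False using ne xy \<open>p = q\<close> by simp
  qed
qed

lemma lcoset_rep:
  "\<exists>r. \<forall>X\<in>lcosets\<^bsub>G\<^esub> H. r X \<in> carrier G \<and> X = r X <#\<^bsub>G\<^esub> H"
proof -
  have "\<forall>X\<in>lcosets\<^bsub>G\<^esub> H. \<exists>a. a \<in> carrier G \<and> X = a <#\<^bsub>G\<^esub> H" by (auto simp: LCOSETS_def)
  then show ?thesis by (rule bchoice)
qed

text \<open>Nonemptiness is recorded so that no member of an accurate foundation set is lost when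
  the elementary one is assembled from the transversals.\<close>

lemma transversal_exists:
  assumes p: "p \<in> P_fin G P \<theta>"
  shows "\<exists>X. finite X \<and> X \<noteq> {} \<and> left_transversal G (\<theta> p ` carrier G) X"
proof -
  let ?H = "\<theta> p ` carrier G"
  have pP: "p \<in> carrier P" and fin: "finite (lcosets\<^bsub>G\<^esub> ?H)" using p by (auto simp: P_fin_def)
  obtain r where r: "\<And>X. X \<in> lcosets\<^bsub>G\<^esub> ?H \<Longrightarrow> r X \<in> carrier G \<and> X = r X <#\<^bsub>G\<^esub> ?H"
    using lcoset_rep[of ?H] by blast
  have mem: "r X \<in> X" if X: "X \<in> lcosets\<^bsub>G\<^esub> ?H" for X
    using coset_self[of "r X" p] r[OF X] pP by simp
  have uniq: "r Y = r X" if X: "X \<in> lcosets\<^bsub>G\<^esub> ?H" and Y: "Y \<in> lcosets\<^bsub>G\<^esub> ?H" and YX: "r Y \<in> X" for X Y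
  proof -
    have "r Y \<in> r X <#\<^bsub>G\<^esub> ?H" using YX r[OF X] by simp
    then have "r Y <#\<^bsub>G\<^esub> ?H = r X <#\<^bsub>G\<^esub> ?H" using coset_sym[of "r X" p "r Y"] r[OF X] pP by blast
    then have "Y = X" using r[OF X] r[OF Y] by simp
    then show ?thesis by simp
  qed
  have "left_transversal G ?H (r ` (lcosets\<^bsub>G\<^esub> ?H))"
    unfolding left_transversal_def
  proof (intro conjI ballI)
    fix X assume X: "X \<in> lcosets\<^bsub>G\<^esub> ?H"
    show "\<exists>!g. g \<in> r ` (lcosets\<^bsub>G\<^esub> ?H) \<inter> X"
    proof (rule ex1I[of _ "r X"])
      show "r X \<in> r ` (lcosets\<^bsub>G\<^esub> ?H) \<inter> X" using mem[OF X] X by blast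
      fix g assume "g \<in> r ` (lcosets\<^bsub>G\<^esub> ?H) \<inter> X"
      then obtain Y where Y: "Y \<in> lcosets\<^bsub>G\<^esub> ?H" "g = r Y" "r Y \<in> X" by blast
      then show "g = r X" using uniq[OF X Y(1,3)] by simp
    qed
  next
    show "r ` (lcosets\<^bsub>G\<^esub> ?H) \<subseteq> carrier G" using r by blast
  qed
  moreover have "lcosets\<^bsub>G\<^esub> ?H \<noteq> {}" by (auto simp: LCOSETS_def)
  ultimately show ?thesis using fin by (intro exI[of _ "r ` (lcosets\<^bsub>G\<^esub> ?H)"]) auto
qed

lemma elementary_foundation_set_exists:
  assumes acc: "accurate_foundation_set P F" and F: "F \<subseteq> P_fin G P \<theta>"
  shows "\<exists>E. elementary_foundation_set G P \<theta> E \<and> snd ` E = F"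
proof -
  have "\<forall>p\<in>F. \<exists>X. finite X \<and> X \<noteq> {} \<and> left_transversal G (\<theta> p ` carrier G) X"
    using transversal_exists F by blast
  then obtain X where X: "\<And>p. p \<in> F \<Longrightarrow> finite (X p) \<and> X p \<noteq> {} \<and> left_transversal G (\<theta> p ` carrier G) (X p)"
    by metis
  define E where "E = (\<lambda>(p, g). (g, p)) ` Sigma F X"
  have "finite F" using acc by (simp add: accurate_foundation_set_def foundation_set_def)
  then have "finite E" unfolding E_def using X by (intro finite_imageI finite_SigmaI) auto
  moreover have sndE: "snd ` E = F" using X by (force simp: E_def)
  moreover have "{g. (g, p) \<in> E} = X p" if "p \<in> F" for p using that by (auto simp: E_def)
  moreover have "E \<subseteq> carrier G \<times> carrier P"
    using X F by (fastforce simp: E_def left_transversal_def P_fin_def)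
  ultimately show ?thesis
    using X F acc by (intro exI[of _ E]) (simp add: elementary_foundation_set_def)
qed

text \<open>theta_m induces an injection of G/theta_n(G) into G/theta_p(G): if theta_m(d) lies in
  theta_p(G), it lies in theta_(mn)(G) because the order is respected, and injectivity of theta_m
  puts d into theta_n(G).\<close>

lemma P_fin_cofactor:
  assumes p: "p \<in> P_fin G P \<theta>" and m: "m \<in> carrier P" and n: "n \<in> carrier P"
    and lcm: "principal P m \<inter> principal P p = principal P (m \<otimes>\<^bsub>P\<^esub> n)"
  shows "n \<in> P_fin G P \<theta>"
proof -
  let ?H = "\<theta> p ` carrier G" and ?K = "\<theta> n ` carrier G"
  have pP: "p \<in> carrier P" and fin: "finite (lcosets\<^bsub>G\<^esub> ?H)" using p by (auto simp: P_fin_def)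
  obtain r where r: "\<And>X. X \<in> lcosets\<^bsub>G\<^esub> ?K \<Longrightarrow> r X \<in> carrier G \<and> X = r X <#\<^bsub>G\<^esub> ?K"
    using lcoset_rep[of ?K] by blast
  have injr: "inj_on (\<lambda>X. \<theta> m (r X) <#\<^bsub>G\<^esub> ?H) (lcosets\<^bsub>G\<^esub> ?K)"
  proof (rule inj_onI)
    fix X Y assume X: "X \<in> lcosets\<^bsub>G\<^esub> ?K" and Y: "Y \<in> lcosets\<^bsub>G\<^esub> ?K"
      and eq: "\<theta> m (r X) <#\<^bsub>G\<^esub> ?H = \<theta> m (r Y) <#\<^bsub>G\<^esub> ?H"
    have rX: "r X \<in> carrier G" and rY: "r Y \<in> carrier G" using r X Y by auto
    let ?d = "inv\<^bsub>G\<^esub> (r X) \<otimes>\<^bsub>G\<^esub> r Y"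
    have "\<theta> m (r Y) \<in> \<theta> m (r X) <#\<^bsub>G\<^esub> ?H" using coset_self[of "\<theta> m (r Y)" p] eq m pP rY by simp
    then have "\<theta> m ?d \<in> ?H"
      using G.mem_l_coset_iff[OF theta_range_subgroup[OF pP]] m rX rY by (simp add: theta_mult theta_inv)
    moreover have "\<theta> m ?d \<in> \<theta> m ` carrier G" using rX rY by (intro imageI) simp
    ultimately have "\<theta> m ?d \<in> \<theta> (m \<otimes>\<^bsub>P\<^esub> n) ` carrier G"
      using respects_order[OF m pP _ lcm] m n by blast
    then obtain k where k: "k \<in> carrier G" "\<theta> m ?d = \<theta> m (\<theta> n k)" using m n by (auto simp: action)
    then have "?d = \<theta> n k" using inj_onD[OF inj[OF m] k(2)] rX rY n by simp
    then have "r Y \<in> r X <#\<^bsub>G\<^esub> ?K"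
      using G.mem_l_coset_iff[OF theta_range_subgroup[OF n] rX rY] k(1) by simp
    then have "r Y <#\<^bsub>G\<^esub> ?K = r X <#\<^bsub>G\<^esub> ?K" using coset_sym[OF rX n] by blast
    then show "X = Y" using r[OF X] r[OF Y] by simp
  qed
  have "a <#\<^bsub>G\<^esub> ?H \<in> lcosets\<^bsub>G\<^esub> ?H" if "a \<in> carrier G" for a
    using that by (auto simp: LCOSETS_def)
  then have subr: "(\<lambda>X. \<theta> m (r X) <#\<^bsub>G\<^esub> ?H) ` (lcosets\<^bsub>G\<^esub> ?K) \<subseteq> lcosets\<^bsub>G\<^esub> ?H"
    using r m by (intro image_subsetI) simp
  have "finite (lcosets\<^bsub>G\<^esub> ?K)" by (rule inj_on_finite[OF injr subr fin])
  then show ?thesis using n by (simp add: P_fin_def)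
qed

text \<open>Members of infinite index can be dropped: below a suitable \<open>r\<close> every member either
  contains or misses the corresponding part of \<open>S\<close>, so the cosets of the members
  containing it cover \<open>G\<close>.\<close>

lemma foundation_set_P_fin:
  assumes F: "foundation_set S F"
  shows "foundation_set S {x\<in>F. snd x \<in> P_fin G P \<theta>}"
proof -
  have fin: "finite F" and sub: "F \<subseteq> carrier G \<times> carrier P"
    and meets: "\<And>x. x \<in> carrier S \<Longrightarrow> \<exists>t\<in>F. principal S x \<inter> principal S t \<noteq> {}"
    using F by (auto simp: foundation_set_def S_carrier)
  have "\<exists>t\<in>{x\<in>F. snd x \<in> P_fin G P \<theta>}. principal S x \<inter> principal S t \<noteq> {}" if x: "x \<in> carrier S" for x
  proof -
    obtain h q where hq: "x = (h, q)" "h \<in> carrier G" "q \<in> carrier P" using x by (auto simp: S_carrier)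
    have sndF: "snd ` F \<subseteq> carrier P" using sub by auto
    obtain r where r: "r \<in> principal P q"
      and rF0: "\<forall>p\<in>snd ` F. r \<in> principal P p \<or> principal P r \<inter> principal P p = {}"
      using P.deepen[OF finite_imageI[OF fin] sndF hq(3)] by (elim bexE) rule
    note rF = bspec[OF rF0]
    have rP: "r \<in> carrier P" using r P.principal_subset[OF hq(3)] by blast
    define A where "A = {x\<in>F. r \<in> principal P (snd x)}"
    have cover: "carrier G \<subseteq> (\<Union>a\<in>A. fst a <#\<^bsub>G\<^esub> (\<theta> (snd a) ` carrier G))"
    proof
      fix y assume y: "y \<in> carrier G"
      then obtain g p where gp: "(g, p) \<in> F" "principal S (y, r) \<inter> principal S (g, p) \<noteq> {}"
        using meets[of "(y, r)"] rP by (auto simp: S_carrier)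
      have g: "g \<in> carrier G" and p: "p \<in> carrier P" using gp(1) sub by auto
      obtain a b where ab: "(a, b) \<in> principal S (y, r)" "(a, b) \<in> principal S (g, p)"
        using gp(2) by (metis disjoint_iff surj_pair)
      have aG: "a \<in> carrier G" using ab(1) y rP by (auto simp: principal_S_iff)
      have b: "b \<in> principal P r" "b \<in> principal P p" "a \<in> y <#\<^bsub>G\<^esub> (\<theta> r ` carrier G)"
        "a \<in> g <#\<^bsub>G\<^esub> (\<theta> p ` carrier G)"
        using ab mem_principal_S[OF y aG rP] mem_principal_S[OF g aG p] by auto
      \<comment> \<open>\<open>b\<close> is a common multiple of \<open>r\<close> and
        \<open>p\<close>, which rules out disjointness. Then theta_r(G) is contained in theta_p(G),
        and the coset of y over p is that of g.\<close>
      then have rp: "r \<in> principal P p" using rF[of p] gp(1) by force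
      then obtain c where c: "c \<in> carrier P" "r = p \<otimes>\<^bsub>P\<^esub> c" by (auto simp: P.principal_iff)
      have ay: "a \<in> y <#\<^bsub>G\<^esub> (\<theta> p ` carrier G)"
        using b(3) c p by (force simp: G.mem_l_coset action[symmetric])
      have "y \<in> g <#\<^bsub>G\<^esub> (\<theta> p ` carrier G)"
        using coset_sym[OF y p ay] coset_sym[OF g p b(4)] coset_self[OF y p] by simp
      moreover have "(g, p) \<in> A" using gp(1) rp by (simp add: A_def)
      ultimately show "y \<in> (\<Union>a\<in>A. fst a <#\<^bsub>G\<^esub> (\<theta> (snd a) ` carrier G))"
        by (intro UN_I[of "(g, p)"]) simp_all
    qed
    have "carrier G \<subseteq> (\<Union>a\<in>{a\<in>A. finite (lcosets\<^bsub>G\<^esub> (\<theta> (snd a) ` carrier G))}.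
        fst a <#\<^bsub>G\<^esub> (\<theta> (snd a) ` carrier G))"
      using fin sub cover by (intro G.finite_index_cosets_cover) (auto simp: A_def intro!: theta_range_subgroup)
    then obtain a where "a \<in> {a\<in>A. finite (lcosets\<^bsub>G\<^esub> (\<theta> (snd a) ` carrier G))}"
      "h \<in> fst a <#\<^bsub>G\<^esub> (\<theta> (snd a) ` carrier G)" using hq(2) by blast
    then obtain g p where gp: "(g, p) \<in> F" "r \<in> principal P p" "finite (lcosets\<^bsub>G\<^esub> (\<theta> p ` carrier G))"
      "h \<in> g <#\<^bsub>G\<^esub> (\<theta> p ` carrier G)" by (cases a) (auto simp: A_def)
    have g: "g \<in> carrier G" and p: "p \<in> carrier P" using gp(1) sub by auto
    have "(h, r) \<in> principal S (g, p)" using mem_principal_S[OF g hq(2) p] gp by simp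
    moreover have "(h, r) \<in> principal S x"
      using mem_principal_S[OF hq(2) hq(2) hq(3)] r coset_self[OF hq(2,3)] hq(1) by simp
    ultimately show ?thesis using gp p by (intro bexI[of _ "(g, p)"]) (auto simp: P_fin_def)
  qed
  then show ?thesis using fin sub by (auto simp: foundation_set_def S_carrier)
qed

end

section \<open>The relations (A1), (A2) and (O)\<close>

context algebraic_dynamical_system
begin

text \<open>(A1) compares two factorisations, (1, p)(g, 1) = (theta_p(g), 1)(1, p). The left side of
  (A2) is the product of the adjoint of v at (1, p) with v at (g, q), so its two cases are those of
  two principal ideals of \<open>S\<close> that meet or do not meet.\<close>

lemma lcm_rep_A1_A2_O:
  assumes B: "cstar_algebra B" and rep: "lcm_rep S B v e"
    and defect: "\<And>xs. distinct xs \<Longrightarrow> foundation_set S (set xs) \<Longrightarrow>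
      defect_prod B (\<lambda>x. e (principal S x)) xs = \<zero>\<^bsub>B\<^esub>"
  shows "A1_A2_O_rep G P \<theta> B (\<lambda>g. v (g, \<one>\<^bsub>P\<^esub>)) (\<lambda>p. v (\<one>\<^bsub>G\<^esub>, p))"
proof -
  interpret B: cstar_algebra B by fact
  interpret S: right_lcm S by (rule S_right_lcm)
  have v [simp]: "v (g, p) \<in> carrier B" "(v (g, p))\<^sup>\<star>\<^bsub>B\<^esub> \<otimes>\<^bsub>B\<^esub> v (g, p) = \<one>\<^bsub>B\<^esub>"
    if "g \<in> carrier G" "p \<in> carrier P" for g p
    using rep that by (simp_all add: lcm_rep_def S_carrier)
  have vv: "v (g, p) \<otimes>\<^bsub>B\<^esub> v (h, q) = v (g \<otimes>\<^bsub>G\<^esub> \<theta> p h, p \<otimes>\<^bsub>P\<^esub> q)"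
    if "g \<in> carrier G" "p \<in> carrier P" "h \<in> carrier G" "q \<in> carrier P" for g p h q
    using rep that by (simp add: lcm_rep_def S_carrier flip: S_mult)
  have us: "v (g, \<one>\<^bsub>P\<^esub>) \<otimes>\<^bsub>B\<^esub> v (\<one>\<^bsub>G\<^esub>, p) = v (g, p)" if "g \<in> carrier G" "p \<in> carrier P" for g p
    using that by (simp add: vv)
  have v1: "v (\<one>\<^bsub>G\<^esub>, \<one>\<^bsub>P\<^esub>) = \<one>\<^bsub>B\<^esub>"
    by (rule B.isometry_idempotent) (simp_all add: vv)
  have u_inv: "(v (g, \<one>\<^bsub>P\<^esub>))\<^sup>\<star>\<^bsub>B\<^esub> = v (inv\<^bsub>G\<^esub> g, \<one>\<^bsub>P\<^esub>)" if g: "g \<in> carrier G" for g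
  proof -
    have "v (inv\<^bsub>G\<^esub> g, \<one>\<^bsub>P\<^esub>) = (v (g, \<one>\<^bsub>P\<^esub>))\<^sup>\<star>\<^bsub>B\<^esub> \<otimes>\<^bsub>B\<^esub> (v (g, \<one>\<^bsub>P\<^esub>) \<otimes>\<^bsub>B\<^esub> v (inv\<^bsub>G\<^esub> g, \<one>\<^bsub>P\<^esub>))"
      using g by (simp add: B.isometry_cancel)
    also have "\<dots> = (v (g, \<one>\<^bsub>P\<^esub>))\<^sup>\<star>\<^bsub>B\<^esub>" using g by (simp add: vv action_one v1)
    finally show ?thesis by simp
  qed
  have unitary: "unitary_rep G B (\<lambda>g. v (g, \<one>\<^bsub>P\<^esub>))"
    by (auto simp: unitary_rep_def vv action_one) (simp add: u_inv vv action_one v1)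
  have isometric: "isometric_rep P B (\<lambda>p. v (\<one>\<^bsub>G\<^esub>, p))" by (simp add: isometric_rep_def vv)
  have A1: "rel_A1 G P \<theta> B (\<lambda>g. v (g, \<one>\<^bsub>P\<^esub>)) (\<lambda>p. v (\<one>\<^bsub>G\<^esub>, p))" by (simp add: rel_A1_def vv)
  have A2: "rel_A2 G P \<theta> B (\<lambda>g. v (g, \<one>\<^bsub>P\<^esub>)) (\<lambda>p. v (\<one>\<^bsub>G\<^esub>, p))"
    unfolding rel_A2_def
  proof (intro ballI conjI allI impI)
    fix p q g assume p: "p \<in> carrier P" and q: "q \<in> carrier P" and g: "g \<in> carrier G"
    have one: "(\<one>\<^bsub>G\<^esub>, p) \<in> carrier S" "(g, q) \<in> carrier S" using p q g by (auto simp: S_carrier)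
    have lhs: "(v (\<one>\<^bsub>G\<^esub>, p))\<^sup>\<star>\<^bsub>B\<^esub> \<otimes>\<^bsub>B\<^esub> v (g, \<one>\<^bsub>P\<^esub>) \<otimes>\<^bsub>B\<^esub> v (\<one>\<^bsub>G\<^esub>, q) = (v (\<one>\<^bsub>G\<^esub>, p))\<^sup>\<star>\<^bsub>B\<^esub> \<otimes>\<^bsub>B\<^esub> v (g, q)"
      using p q g by (simp add: B.m_assoc us)
    \<comment> \<open>The lemmas on \<open>A2_case\<close> speak of a product inv(g) h; here the
      first group element is the unit.\<close>
    have g1: "inv\<^bsub>G\<^esub> \<one>\<^bsub>G\<^esub> \<otimes>\<^bsub>G\<^esub> g = g" using g by simp
    {
      fix p' q' k l assume "A2_case G P \<theta> p q g p' q' k l"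
      then have A2: "A2_case G P \<theta> p q (inv\<^bsub>G\<^esub> \<one>\<^bsub>G\<^esub> \<otimes>\<^bsub>G\<^esub> g) p' q' k l" unfolding g1 .
      note c = A2_case_principal_S[OF G.one_closed g p q A2]
      have kl: "k \<in> carrier G" "l \<in> carrier G" "p' \<in> carrier P" "q' \<in> carrier P"
        using c(1,2) by (auto simp: S_carrier)
      have "(v (\<one>\<^bsub>G\<^esub>, p))\<^sup>\<star>\<^bsub>B\<^esub> \<otimes>\<^bsub>B\<^esub> v (g, q) = v (k, p') \<otimes>\<^bsub>B\<^esub> (v (l, q'))\<^sup>\<star>\<^bsub>B\<^esub>"
        by (rule S.lcm_rep_product(2)[OF B.star_algebra_axioms rep one c])
      also have "\<dots> = v (k, \<one>\<^bsub>P\<^esub>) \<otimes>\<^bsub>B\<^esub> v (\<one>\<^bsub>G\<^esub>, p') \<otimes>\<^bsub>B\<^esub> (v (\<one>\<^bsub>G\<^esub>, q'))\<^sup>\<star>\<^bsub>B\<^esub> \<otimes>\<^bsub>B\<^esub> (v (l, \<one>\<^bsub>P\<^esub>))\<^sup>\<star>\<^bsub>B\<^esub>"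
        unfolding us[OF kl(1,3), symmetric] us[OF kl(2,4), symmetric]
        using kl by (simp add: B.m_assoc B.adj_mult)
      finally show "(v (\<one>\<^bsub>G\<^esub>, p))\<^sup>\<star>\<^bsub>B\<^esub> \<otimes>\<^bsub>B\<^esub> v (g, \<one>\<^bsub>P\<^esub>) \<otimes>\<^bsub>B\<^esub> v (\<one>\<^bsub>G\<^esub>, q)
        = v (k, \<one>\<^bsub>P\<^esub>) \<otimes>\<^bsub>B\<^esub> v (\<one>\<^bsub>G\<^esub>, p') \<otimes>\<^bsub>B\<^esub> (v (\<one>\<^bsub>G\<^esub>, q'))\<^sup>\<star>\<^bsub>B\<^esub> \<otimes>\<^bsub>B\<^esub> (v (l, \<one>\<^bsub>P\<^esub>))\<^sup>\<star>\<^bsub>B\<^esub>"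
        unfolding lhs .
    }
    assume "\<nexists>p' q' k l. A2_case G P \<theta> p q g p' q' k l"
    then have "principal S (\<one>\<^bsub>G\<^esub>, p) \<inter> principal S (g, q) = {}"
      using principal_S_meet[OF G.one_closed g p q] unfolding g1 by blast
    then show "(v (\<one>\<^bsub>G\<^esub>, p))\<^sup>\<star>\<^bsub>B\<^esub> \<otimes>\<^bsub>B\<^esub> v (g, \<one>\<^bsub>P\<^esub>) \<otimes>\<^bsub>B\<^esub> v (\<one>\<^bsub>G\<^esub>, q) = \<zero>\<^bsub>B\<^esub>"
      unfolding lhs by (rule S.lcm_rep_product(1)[OF B.star_algebra_axioms rep one])
  qed
  have e: "e (principal S (g, p)) = range_proj B (\<lambda>g. v (g, \<one>\<^bsub>P\<^esub>)) (\<lambda>p. v (\<one>\<^bsub>G\<^esub>, p)) g p"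
    if "g \<in> carrier G" "p \<in> carrier P" for g p
    using that S.lcm_rep_e[OF B.star_algebra_axioms rep, of "(g, p)"]
    unfolding us[OF that, symmetric] by (simp add: range_proj_def S_carrier B.m_assoc B.adj_mult)
  have O: "rel_O G P \<theta> B (\<lambda>g. v (g, \<one>\<^bsub>P\<^esub>)) (\<lambda>p. v (\<one>\<^bsub>G\<^esub>, p))"
    unfolding rel_O_def
  proof (intro allI impI)
    fix F assume F: "elementary_foundation_set G P \<theta> F"
    have sub: "F \<subseteq> carrier G \<times> carrier P" and fin: "finite F"
      using F by (auto simp: elementary_foundation_set_def)
    obtain xs where xs: "distinct xs" "set xs = F" using finite_distinct_list[OF fin] by blast
    have J: "principal S x \<in> constructible_ideals S" if "x \<in> F" for x
      using that sub by (intro S.constructible_ideals_simps(3)) (auto simp: S_carrier)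
    have eF: "e (principal S x) \<in> carrier B" if "x \<in> F" for x
      using J[OF that] rep by (simp add: lcm_rep_def)
    have eq: "e (principal S x) = range_proj B (\<lambda>g. v (g, \<one>\<^bsub>P\<^esub>)) (\<lambda>p. v (\<one>\<^bsub>G\<^esub>, p)) (fst x) (snd x)"
      if "x \<in> F" for x
      using that sub e[of "fst x" "snd x"] by auto
    have orth: "e (principal S x) \<otimes>\<^bsub>B\<^esub> e (principal S y) = \<zero>\<^bsub>B\<^esub>" if "x \<in> F" "y \<in> F" "x \<noteq> y" for x y
      using J[OF that(1)] J[OF that(2)] elementary_foundation_set_S(2)[OF F that] rep
      by (simp add: lcm_rep_def)
    have "defect_prod B (\<lambda>x. e (principal S x)) xs = \<one>\<^bsub>B\<^esub> \<ominus>\<^bsub>B\<^esub> (\<Oplus>\<^bsub>B\<^esub>x\<in>set xs. e (principal S x))"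
      using xs eF orth by (intro B.defect_prod_orthogonal) auto
    moreover have "foundation_set S (set xs)" using elementary_foundation_set_S(1)[OF F] xs by simp
    ultimately have "\<one>\<^bsub>B\<^esub> = (\<Oplus>\<^bsub>B\<^esub>x\<in>F. e (principal S x))"
      using defect[OF xs(1)] xs(2) eF by (simp add: B.diff_eq_zero B.finsum_closed Pi_iff)
    also have "\<dots> = (\<Oplus>\<^bsub>B\<^esub>x\<in>F. range_proj B (\<lambda>g. v (g, \<one>\<^bsub>P\<^esub>)) (\<lambda>p. v (\<one>\<^bsub>G\<^esub>, p)) (fst x) (snd x))"
      by (rule B.finsum_cong') (simp_all add: eq[symmetric] eF Pi_iff)
    finally show "\<one>\<^bsub>B\<^esub> = (\<Oplus>\<^bsub>B\<^esub>x\<in>F. range_proj B (\<lambda>g. v (g, \<one>\<^bsub>P\<^esub>)) (\<lambda>p. v (\<one>\<^bsub>G\<^esub>, p)) (fst x) (snd x))" .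
  qed
  show ?thesis using unitary isometric A1 A2 O by (simp add: A1_A2_O_rep_def)
qed

lemma A1_A2_O_rep_one:
  assumes B: "cstar_algebra B" and rep: "A1_A2_O_rep G P \<theta> B u s"
  shows "u \<one>\<^bsub>G\<^esub> = \<one>\<^bsub>B\<^esub>" "s \<one>\<^bsub>P\<^esub> = \<one>\<^bsub>B\<^esub>"
proof -
  interpret B: cstar_algebra B by fact
  have u: "u g \<in> carrier B" "(u g)\<^sup>\<star>\<^bsub>B\<^esub> \<otimes>\<^bsub>B\<^esub> u g = \<one>\<^bsub>B\<^esub>"
    and uu: "u g \<otimes>\<^bsub>B\<^esub> u h = u (g \<otimes>\<^bsub>G\<^esub> h)" if "g \<in> carrier G" "h \<in> carrier G" for g h
    using rep that by (simp_all add: A1_A2_O_rep_def unitary_rep_def)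
  have s: "s p \<in> carrier B" "(s p)\<^sup>\<star>\<^bsub>B\<^esub> \<otimes>\<^bsub>B\<^esub> s p = \<one>\<^bsub>B\<^esub>"
    and ss: "s p \<otimes>\<^bsub>B\<^esub> s q = s (p \<otimes>\<^bsub>P\<^esub> q)" if "p \<in> carrier P" "q \<in> carrier P" for p q
    using rep that by (simp_all add: A1_A2_O_rep_def isometric_rep_def)
  show "u \<one>\<^bsub>G\<^esub> = \<one>\<^bsub>B\<^esub>"
    by (rule B.isometry_idempotent[OF u[OF G.one_closed G.one_closed]]) (simp add: uu)
  show "s \<one>\<^bsub>P\<^esub> = \<one>\<^bsub>B\<^esub>"
    by (rule B.isometry_idempotent[OF s[OF P.one_closed P.one_closed]]) (simp add: ss)
qed

text \<open>Relation (A1) moves s_p past u_h, which makes u_g s_p multiplicative on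
  \<open>S\<close>. For x = (g, p) and y = (h, q) the product v_x* v_y is s_p* u_(g^-1 h) s_q, the
  left side of (A2), and its two branches are the two cases for the principal ideals.\<close>

lemma A1_A2_O_lcm_rep:
  assumes B: "cstar_algebra B" and rep: "A1_A2_O_rep G P \<theta> B u s"
  shows "lcm_rep S B (\<lambda>(g, p). u g \<otimes>\<^bsub>B\<^esub> s p) (right_lcm.range_projection S B (\<lambda>(g, p). u g \<otimes>\<^bsub>B\<^esub> s p))"
proof -
  interpret B: cstar_algebra B by fact
  interpret S: right_lcm S by (rule S_right_lcm)
  let ?v = "\<lambda>(g, p). u g \<otimes>\<^bsub>B\<^esub> s p"
  have u [simp]: "u g \<in> carrier B" "(u g)\<^sup>\<star>\<^bsub>B\<^esub> \<otimes>\<^bsub>B\<^esub> u g = \<one>\<^bsub>B\<^esub>" if "g \<in> carrier G" for g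
    using rep that by (simp_all add: A1_A2_O_rep_def unitary_rep_def)
  have uu: "u (g \<otimes>\<^bsub>G\<^esub> h) = u g \<otimes>\<^bsub>B\<^esub> u h" if "g \<in> carrier G" "h \<in> carrier G" for g h
    using rep that by (simp add: A1_A2_O_rep_def unitary_rep_def)
  have s [simp]: "s p \<in> carrier B" "(s p)\<^sup>\<star>\<^bsub>B\<^esub> \<otimes>\<^bsub>B\<^esub> s p = \<one>\<^bsub>B\<^esub>" if "p \<in> carrier P" for p
    using rep that by (simp_all add: A1_A2_O_rep_def isometric_rep_def)
  have ss: "s (p \<otimes>\<^bsub>P\<^esub> q) = s p \<otimes>\<^bsub>B\<^esub> s q" if "p \<in> carrier P" "q \<in> carrier P" for p q
    using rep that by (simp add: A1_A2_O_rep_def isometric_rep_def)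
  have su: "s p \<otimes>\<^bsub>B\<^esub> u g = u (\<theta> p g) \<otimes>\<^bsub>B\<^esub> s p" if "p \<in> carrier P" "g \<in> carrier G" for p g
    using rep that by (simp add: A1_A2_O_rep_def rel_A1_def)
  have A2: "rel_A2 G P \<theta> B u s" using rep by (simp add: A1_A2_O_rep_def)
  have u1: "u \<one>\<^bsub>G\<^esub> = \<one>\<^bsub>B\<^esub>" by (rule A1_A2_O_rep_one(1)[OF B rep])
  have u_inv: "(u g)\<^sup>\<star>\<^bsub>B\<^esub> = u (inv\<^bsub>G\<^esub> g)" if g: "g \<in> carrier G" for g
  proof -
    have "u (inv\<^bsub>G\<^esub> g) = (u g)\<^sup>\<star>\<^bsub>B\<^esub> \<otimes>\<^bsub>B\<^esub> (u g \<otimes>\<^bsub>B\<^esub> u (inv\<^bsub>G\<^esub> g))" using g by (simp add: B.isometry_cancel)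
    also have "\<dots> = (u g)\<^sup>\<star>\<^bsub>B\<^esub>" using g by (simp add: u1 flip: uu)
    finally show ?thesis by simp
  qed
  have prod: "(?v (g, p))\<^sup>\<star>\<^bsub>B\<^esub> \<otimes>\<^bsub>B\<^esub> ?v (h, q) = (s p)\<^sup>\<star>\<^bsub>B\<^esub> \<otimes>\<^bsub>B\<^esub> u (inv\<^bsub>G\<^esub> g \<otimes>\<^bsub>G\<^esub> h) \<otimes>\<^bsub>B\<^esub> s q"
    if "g \<in> carrier G" "h \<in> carrier G" "p \<in> carrier P" "q \<in> carrier P" for g h p q
    using that by (simp add: B.adj_mult u_inv uu B.m_assoc)
  show ?thesis
  proof (rule S.lcm_rep_of_isometries[OF B.star_algebra_axioms])
    fix x assume "x \<in> carrier S"
    then obtain g p where x: "x = (g, p)" "g \<in> carrier G" "p \<in> carrier P" by (auto simp: S_carrier)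
    show "?v x \<in> carrier B" using x by simp
    show "(?v x)\<^sup>\<star>\<^bsub>B\<^esub> \<otimes>\<^bsub>B\<^esub> ?v x = \<one>\<^bsub>B\<^esub>" using x by (simp add: B.adj_mult B.m_assoc B.isometry_cancel)
    fix y assume "y \<in> carrier S"
    then obtain h q where y: "y = (h, q)" "h \<in> carrier G" "q \<in> carrier P" by (auto simp: S_carrier)
    have "u g \<otimes>\<^bsub>B\<^esub> s p \<otimes>\<^bsub>B\<^esub> (u h \<otimes>\<^bsub>B\<^esub> s q) = u g \<otimes>\<^bsub>B\<^esub> (s p \<otimes>\<^bsub>B\<^esub> u h) \<otimes>\<^bsub>B\<^esub> s q"
      using x y by (simp add: B.m_assoc)
    also have "\<dots> = u (g \<otimes>\<^bsub>G\<^esub> \<theta> p h) \<otimes>\<^bsub>B\<^esub> s (p \<otimes>\<^bsub>P\<^esub> q)"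
      using x y by (simp add: su uu ss B.m_assoc)
    finally show "?v x \<otimes>\<^bsub>B\<^esub> ?v y = ?v (x \<otimes>\<^bsub>S\<^esub> y)" using x y by (simp add: S_mult)
    {
      assume "principal S x \<inter> principal S y = {}"
      then have "\<nexists>p' q' k l. A2_case G P \<theta> p q (inv\<^bsub>G\<^esub> g \<otimes>\<^bsub>G\<^esub> h) p' q' k l"
        using A2_case_principal_S(1,4)[OF x(2) y(2) x(3) y(3)] S.self_mem_principal x y
          S.m_closed[OF \<open>x \<in> carrier S\<close>] by (metis empty_iff)
      then have "(s p)\<^sup>\<star>\<^bsub>B\<^esub> \<otimes>\<^bsub>B\<^esub> u (inv\<^bsub>G\<^esub> g \<otimes>\<^bsub>G\<^esub> h) \<otimes>\<^bsub>B\<^esub> s q = \<zero>\<^bsub>B\<^esub>"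
        using A2 x y unfolding rel_A2_def by simp
      then show "(?v x)\<^sup>\<star>\<^bsub>B\<^esub> \<otimes>\<^bsub>B\<^esub> ?v y = \<zero>\<^bsub>B\<^esub>" using prod[of g h p q] x y by simp
    }
    assume "principal S x \<inter> principal S y \<noteq> {}"
    then obtain p' q' k l where A2c: "A2_case G P \<theta> p q (inv\<^bsub>G\<^esub> g \<otimes>\<^bsub>G\<^esub> h) p' q' k l"
      using principal_S_meet[of g h p q] x y by blast
    note c = A2_case_principal_S[OF x(2) y(2) x(3) y(3) A2c]
    have kl: "k \<in> carrier G" "l \<in> carrier G" "p' \<in> carrier P" "q' \<in> carrier P"
      using c(1,2) by (auto simp: S_carrier)
    have "(?v x)\<^sup>\<star>\<^bsub>B\<^esub> \<otimes>\<^bsub>B\<^esub> ?v y = u k \<otimes>\<^bsub>B\<^esub> s p' \<otimes>\<^bsub>B\<^esub> (s q')\<^sup>\<star>\<^bsub>B\<^esub> \<otimes>\<^bsub>B\<^esub> (u l)\<^sup>\<star>\<^bsub>B\<^esub>"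
      using A2 A2c prod[of g h p q] x y unfolding rel_A2_def by simp
    also have "\<dots> = ?v (k, p') \<otimes>\<^bsub>B\<^esub> (?v (l, q'))\<^sup>\<star>\<^bsub>B\<^esub>" using kl by (simp add: B.adj_mult B.m_assoc)
    finally show "\<exists>a\<in>carrier S. \<exists>b\<in>carrier S. x \<otimes>\<^bsub>S\<^esub> a = y \<otimes>\<^bsub>S\<^esub> b \<and>
        principal S x \<inter> principal S y = principal S (x \<otimes>\<^bsub>S\<^esub> a) \<and>
        (?v x)\<^sup>\<star>\<^bsub>B\<^esub> \<otimes>\<^bsub>B\<^esub> ?v y = ?v a \<otimes>\<^bsub>B\<^esub> (?v b)\<^sup>\<star>\<^bsub>B\<^esub>"
      using c x(1) y(1) by (intro bexI[of _ "(k, p')"] bexI[of _ "(l, q')"]) auto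
  qed
qed

end

section \<open>The boundary relations as consequences of (O)\<close>

context algebraic_dynamical_system
begin

text \<open>A member of \<open>F\<close> over the complement of \<open>W\<close> that meets \<open>(h, m x)\<close> would contain \<open>(h, m)\<close>.\<close>

lemma cofactor_foundation_set:
  assumes F: "foundation_set S F" and W: "finite W" "W \<subseteq> snd ` F"
    and m: "m \<in> carrier P" and h: "h \<in> carrier G"
    and below: "\<And>p. p \<in> snd ` F - W \<Longrightarrow> m \<in> principal P p"
    and none: "\<And>x. x \<in> F \<Longrightarrow> snd x \<notin> W \<Longrightarrow> (h, m) \<notin> principal S x"
    and c: "\<And>p. p \<in> W \<Longrightarrow> principal P m \<inter> principal P p \<noteq> {} \<Longrightarrow>
      c p \<in> carrier P \<and> principal P m \<inter> principal P p = principal P (m \<otimes>\<^bsub>P\<^esub> c p)"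
  shows "foundation_set P (c ` {p \<in> W. principal P m \<inter> principal P p \<noteq> {}})"
proof -
  have sub: "F \<subseteq> carrier G \<times> carrier P"
    and meets: "\<And>x. x \<in> carrier S \<Longrightarrow> \<exists>t\<in>F. principal S x \<inter> principal S t \<noteq> {}"
    using F by (auto simp: foundation_set_def S_carrier)
  have "\<exists>p\<in>W. principal P m \<inter> principal P p \<noteq> {} \<and> principal P x \<inter> principal P (c p) \<noteq> {}"
    if x: "x \<in> carrier P" for x
  proof -
    obtain g p where gp: "(g, p) \<in> F" "principal S (h, m \<otimes>\<^bsub>P\<^esub> x) \<inter> principal S (g, p) \<noteq> {}"
      using meets[of "(h, m \<otimes>\<^bsub>P\<^esub> x)"] h m x by (auto simp: S_carrier)
    have g: "g \<in> carrier G" and p: "p \<in> carrier P" using gp(1) sub by auto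
    obtain a b where ab: "(a, b) \<in> principal S (h, m \<otimes>\<^bsub>P\<^esub> x)" "(a, b) \<in> principal S (g, p)"
      using gp(2) by (metis disjoint_iff surj_pair)
    have aG: "a \<in> carrier G" using ab(2) g p by (auto simp: principal_S_iff)
    have mx: "m \<otimes>\<^bsub>P\<^esub> x \<in> carrier P" using m x by simp
    have b: "b \<in> principal P (m \<otimes>\<^bsub>P\<^esub> x)" "b \<in> principal P p"
      "a \<in> h <#\<^bsub>G\<^esub> (\<theta> (m \<otimes>\<^bsub>P\<^esub> x) ` carrier G)" "a \<in> g <#\<^bsub>G\<^esub> (\<theta> p ` carrier G)"
      using ab mem_principal_S[OF h aG mx] mem_principal_S[OF g aG p] by auto
    have pW: "p \<in> W"
    proof (rule ccontr)
      assume notW: "p \<notin> W"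
      then have mp: "m \<in> principal P p" using below[of p] gp(1) by force
      then obtain y where y: "y \<in> carrier P" "m \<otimes>\<^bsub>P\<^esub> x = p \<otimes>\<^bsub>P\<^esub> (y \<otimes>\<^bsub>P\<^esub> x)"
        using p x by (auto simp: P.principal_iff P.m_assoc)
      have ah: "a \<in> h <#\<^bsub>G\<^esub> (\<theta> p ` carrier G)"
        using b(3) y x p by (force simp: G.mem_l_coset action[symmetric])
      have "h \<in> g <#\<^bsub>G\<^esub> (\<theta> p ` carrier G)"
        using coset_sym[OF h p ah] coset_sym[OF g p b(4)] coset_self[OF h p] by simp
      then have "(h, m) \<in> principal S (g, p)" using mem_principal_S[OF g h p] mp by simp
      then show False using none[OF gp(1)] notW by simp
    qed
    have "m \<otimes>\<^bsub>P\<^esub> x \<in> principal P m" using x unfolding P.principal_iff by blast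
    then have bm: "b \<in> principal P m" using P.principal_mono[OF m] b(1) by blast
    then have ne: "principal P m \<inter> principal P p \<noteq> {}" using b(2) by blast
    have cp: "c p \<in> carrier P" and cp': "principal P m \<inter> principal P p = principal P (m \<otimes>\<^bsub>P\<^esub> c p)"
      using c[OF pW ne] by auto
    have "b \<in> principal P (m \<otimes>\<^bsub>P\<^esub> c p)" using bm b(2) cp' by blast
    then obtain w where w: "w \<in> carrier P" "b = m \<otimes>\<^bsub>P\<^esub> (c p \<otimes>\<^bsub>P\<^esub> w)"
      using cp m by (auto simp: P.principal_iff P.m_assoc)
    obtain z where z: "z \<in> carrier P" "b = m \<otimes>\<^bsub>P\<^esub> (x \<otimes>\<^bsub>P\<^esub> z)"
      using b(1) m x by (auto simp: P.principal_iff P.m_assoc)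
    have "m \<otimes>\<^bsub>P\<^esub> (x \<otimes>\<^bsub>P\<^esub> z) = m \<otimes>\<^bsub>P\<^esub> (c p \<otimes>\<^bsub>P\<^esub> w)" using w(2) z(2) by simp
    \<comment> \<open>Cancelling \<open>m\<close> transfers the common multiple of m x and p to a
      common multiple of x and the cofactor \<open>c p\<close>.\<close>
    then have "x \<otimes>\<^bsub>P\<^esub> z = c p \<otimes>\<^bsub>P\<^esub> w"
      by (rule P.left_cancel[OF m, rotated 2]) (simp_all add: w(1) z(1) cp x)
    then have "x \<otimes>\<^bsub>P\<^esub> z \<in> principal P x \<inter> principal P (c p)"
      unfolding Int_iff P.principal_iff using w(1) z(1) by blast
    then show ?thesis using pW ne by blast
  qed
  then have "\<forall>x\<in>carrier P. \<exists>t\<in>c ` {p \<in> W. principal P m \<inter> principal P p \<noteq> {}}.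
      principal P x \<inter> principal P t \<noteq> {}" by blast
  moreover have "c ` {p \<in> W. principal P m \<inter> principal P p \<noteq> {}} \<subseteq> carrier P" using c by blast
  ultimately show ?thesis using W(1) by (simp add: foundation_set_def)
qed

text \<open>Conjugating the sum in (O) by v y decomposes the projection of y S into those of the y x
  S, so \<open>z\<close> annihilates it as soon as it annihilates every summand.\<close>

lemma elementary_sum_translate:
  assumes B: "star_algebra B" and rep: "lcm_rep S B v e"
    and E: "finite E" "E \<subseteq> carrier S" and one: "\<one>\<^bsub>B\<^esub> = (\<Oplus>\<^bsub>B\<^esub>x\<in>E. e (principal S x))"
    and y: "y \<in> carrier S" and z: "z \<in> carrier B"
    and zero: "\<And>x. x \<in> E \<Longrightarrow> z \<otimes>\<^bsub>B\<^esub> e (principal S (y \<otimes>\<^bsub>S\<^esub> x)) = \<zero>\<^bsub>B\<^esub>"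
  shows "z \<otimes>\<^bsub>B\<^esub> e (principal S y) = \<zero>\<^bsub>B\<^esub>"
proof -
  interpret B: star_algebra B by fact
  interpret S: right_lcm S by (rule S_right_lcm)
  have vy: "v y \<in> carrier B" using rep y by (simp add: lcm_rep_def)
  have J: "principal S x \<in> constructible_ideals S" if "x \<in> E" for x
    using that E(2) by (intro S.constructible_ideals_simps(3)) auto
  have ex: "e (principal S x) \<in> carrier B" if "x \<in> E" for x
    using J[OF that] rep by (simp add: lcm_rep_def)
  have trans: "v y \<otimes>\<^bsub>B\<^esub> e (principal S x) \<otimes>\<^bsub>B\<^esub> (v y)\<^sup>\<star>\<^bsub>B\<^esub> = e (principal S (y \<otimes>\<^bsub>S\<^esub> x))" if x: "x \<in> E" for x
  proof -
    have "v y \<otimes>\<^bsub>B\<^esub> e (principal S x) \<otimes>\<^bsub>B\<^esub> (v y)\<^sup>\<star>\<^bsub>B\<^esub> = e (y <#\<^bsub>S\<^esub> principal S x)"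
      using rep y J[OF x] unfolding lcm_rep_def by blast
    then show ?thesis using S.principal_translate[OF y, of x] x E(2) by auto
  qed
  let ?f = "\<lambda>x. z \<otimes>\<^bsub>B\<^esub> (v y \<otimes>\<^bsub>B\<^esub> e (principal S x) \<otimes>\<^bsub>B\<^esub> (v y)\<^sup>\<star>\<^bsub>B\<^esub>)"
  have "z \<otimes>\<^bsub>B\<^esub> e (principal S y) = z \<otimes>\<^bsub>B\<^esub> (v y \<otimes>\<^bsub>B\<^esub> \<one>\<^bsub>B\<^esub> \<otimes>\<^bsub>B\<^esub> (v y)\<^sup>\<star>\<^bsub>B\<^esub>)"
    using S.lcm_rep_e[OF B rep y] vy by simp
  also have "\<dots> = (\<Oplus>\<^bsub>B\<^esub>x\<in>E. ?f x)"
  proof -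
    have 1: "v y \<otimes>\<^bsub>B\<^esub> (\<Oplus>\<^bsub>B\<^esub>x\<in>E. e (principal S x)) = (\<Oplus>\<^bsub>B\<^esub>x\<in>E. v y \<otimes>\<^bsub>B\<^esub> e (principal S x))"
      by (rule B.finsum_rdistr) (use E(1) vy ex in auto)
    have 2: "(\<Oplus>\<^bsub>B\<^esub>x\<in>E. v y \<otimes>\<^bsub>B\<^esub> e (principal S x)) \<otimes>\<^bsub>B\<^esub> (v y)\<^sup>\<star>\<^bsub>B\<^esub>
        = (\<Oplus>\<^bsub>B\<^esub>x\<in>E. v y \<otimes>\<^bsub>B\<^esub> e (principal S x) \<otimes>\<^bsub>B\<^esub> (v y)\<^sup>\<star>\<^bsub>B\<^esub>)"
      by (rule B.finsum_ldistr) (use E(1) vy ex in auto)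
    have 3: "z \<otimes>\<^bsub>B\<^esub> (\<Oplus>\<^bsub>B\<^esub>x\<in>E. v y \<otimes>\<^bsub>B\<^esub> e (principal S x) \<otimes>\<^bsub>B\<^esub> (v y)\<^sup>\<star>\<^bsub>B\<^esub>) = (\<Oplus>\<^bsub>B\<^esub>x\<in>E. ?f x)"
      by (rule B.finsum_rdistr) (use E(1) vy ex z in auto)
    show ?thesis unfolding one 1 2 3 ..
  qed
  also have "\<dots> = (\<Oplus>\<^bsub>B\<^esub>x\<in>E. \<zero>\<^bsub>B\<^esub>)"
    by (rule B.finsum_cong') (auto simp: trans zero)
  finally show ?thesis by simp
qed

text \<open>Write \<open>z\<close> for the product over \<open>F\<close>. By induction on \<open>W\<close>, \<open>z e = 0\<close> for the range projection
  \<open>e\<close> of every \<open>(h, m)\<close> with \<open>m\<close> below all members of \<open>F\<close> outside \<open>W\<close>: decompose \<open>e\<close> by (O) along an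
  accurate refinement of the cofactors, each of which brings a further member of \<open>W\<close> above \<open>m\<close>.\<close>

lemma defect_prod_P_fin_zero:
  assumes refine: "\<And>F. foundation_set P F \<Longrightarrow> F \<subseteq> P_fin G P \<theta> \<Longrightarrow>
      \<exists>F'. accurate_foundation_set P F' \<and> refines P F' F \<and> F' \<subseteq> P_fin G P \<theta>"
    and B: "star_algebra B" and rep: "lcm_rep S B v e"
    and O: "\<And>E. elementary_foundation_set G P \<theta> E \<Longrightarrow> \<one>\<^bsub>B\<^esub> = (\<Oplus>\<^bsub>B\<^esub>x\<in>E. e (principal S x))"
    and F: "foundation_set S (set xs)" and fin: "snd ` set xs \<subseteq> P_fin G P \<theta>"
  shows "defect_prod B (\<lambda>x. e (principal S x)) xs = \<zero>\<^bsub>B\<^esub>"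
proof -
  interpret B: star_algebra B by fact
  interpret S: right_lcm S by (rule S_right_lcm)
  let ?F = "set xs" and ?z = "defect_prod B (\<lambda>x. e (principal S x)) xs"
  have sub: "?F \<subseteq> carrier S" using foundation_set_subset[OF F] .
  have ec: "e (principal S x) \<in> carrier B" if "x \<in> carrier S" for x
    using S.constructible_ideals_simps(3)[OF that] rep by (simp add: lcm_rep_def)
  have ee: "e (principal S x) \<otimes>\<^bsub>B\<^esub> e (principal S y) = e (principal S x \<inter> principal S y)"
    if "x \<in> carrier S" "y \<in> carrier S" for x y
    using S.constructible_ideals_simps(3)[OF that(1)] S.constructible_ideals_simps(3)[OF that(2)] rep
    by (simp add: lcm_rep_def)
  have z: "?z \<in> carrier B" using sub ec by (intro B.defect_prod_closed) auto
  have absorb: "?z \<otimes>\<^bsub>B\<^esub> e (principal S y) = \<zero>\<^bsub>B\<^esub>"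
    if x: "x \<in> ?F" and y: "y \<in> carrier S" and yx: "y \<in> principal S x" for x y
  proof (rule B.defect_prod_absorb[OF ec[OF y] _ _ x])
    have xS: "x \<in> carrier S" using x sub by blast
    have "principal S x \<inter> principal S y = principal S y" using S.principal_mono[OF xS yx] by blast
    then show "e (principal S x) \<otimes>\<^bsub>B\<^esub> e (principal S y) = e (principal S y)" by (simp add: ee[OF xS y])
    fix s assume "s \<in> ?F"
    then have s: "s \<in> carrier S" using sub by blast
    show "e (principal S s) \<in> carrier B" by (rule ec[OF s])
    show "e (principal S s) \<otimes>\<^bsub>B\<^esub> e (principal S y) = e (principal S y) \<otimes>\<^bsub>B\<^esub> e (principal S s)"
      by (simp add: ee[OF s y] ee[OF y s] Int_commute)
  qed
  have smaller: "?z \<otimes>\<^bsub>B\<^esub> e (principal S y') = \<zero>\<^bsub>B\<^esub>"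
    if zero: "?z \<otimes>\<^bsub>B\<^esub> e (principal S y) = \<zero>\<^bsub>B\<^esub>" and y: "y \<in> carrier S" and y': "y' \<in> carrier S"
      and yy: "y' \<in> principal S y" for y y'
  proof -
    have "principal S y \<inter> principal S y' = principal S y'" using S.principal_mono[OF y yy] by blast
    then have "?z \<otimes>\<^bsub>B\<^esub> e (principal S y') = (?z \<otimes>\<^bsub>B\<^esub> e (principal S y)) \<otimes>\<^bsub>B\<^esub> e (principal S y')"
      using z ec[OF y] ec[OF y'] by (simp add: B.m_assoc ee[OF y y'])
    then show ?thesis using zero ec[OF y'] by simp
  qed
  have claim: "?z \<otimes>\<^bsub>B\<^esub> e (principal S (h, m)) = \<zero>\<^bsub>B\<^esub>"
    if "finite W" "W \<subseteq> snd ` ?F" "h \<in> carrier G" "m \<in> carrier P"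
      "\<And>p. p \<in> snd ` ?F - W \<Longrightarrow> m \<in> principal P p" for W h m
    using that
  proof (induction "card W" arbitrary: W h m rule: less_induct)
    case less
    note W = less.prems(1,2) and h = less.prems(3) and m = less.prems(4) and below = less.prems(5)
    have hm: "(h, m) \<in> carrier S" using h m by (simp add: S_carrier)
    show ?case
    proof (cases "\<exists>x\<in>?F. snd x \<notin> W \<and> (h, m) \<in> principal S x")
      case True
      then show ?thesis using absorb hm by blast
    next
      case False
      have WP: "W \<subseteq> carrier P" using W(2) fin by (auto simp: P_fin_def)
      have "\<exists>n. n \<in> carrier P \<and> principal P m \<inter> principal P p = principal P (m \<otimes>\<^bsub>P\<^esub> n)"
        if p: "p \<in> W" and ne: "principal P m \<inter> principal P p \<noteq> {}" for p
      proof -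
        have pP: "p \<in> carrier P" using WP p by blast
        obtain r where r: "r \<in> carrier P" "principal P m \<inter> principal P p = principal P r"
          using P.lcm[OF m pP] ne by blast
        then have "r \<in> principal P m" using P.self_mem_principal by blast
        then show ?thesis using r(2) by (auto simp: P.principal_iff)
      qed
      then obtain c where c: "\<And>p. p \<in> W \<Longrightarrow> principal P m \<inter> principal P p \<noteq> {} \<Longrightarrow>
          c p \<in> carrier P \<and> principal P m \<inter> principal P p = principal P (m \<otimes>\<^bsub>P\<^esub> c p)"
        by metis
      let ?W = "{p \<in> W. principal P m \<inter> principal P p \<noteq> {}}"
      \<comment> \<open>For empty W this would be an empty foundation set, which does not exist; the
        base of the induction is thereby included.\<close>
      have "foundation_set P (c ` ?W)"
        by (rule cofactor_foundation_set[OF F W m h below _ c]) (use False in auto)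
      moreover have "c ` ?W \<subseteq> P_fin G P \<theta>"
      proof (rule image_subsetI)
        fix p assume "p \<in> ?W"
        then have p: "p \<in> W" "principal P m \<inter> principal P p \<noteq> {}" by auto
        have "p \<in> P_fin G P \<theta>" using p(1) W(2) fin by blast
        then show "c p \<in> P_fin G P \<theta>"
          by (rule P_fin_cofactor[OF _ m conjunct1[OF c[OF p]] conjunct2[OF c[OF p]]])
      qed
      ultimately obtain A where A: "accurate_foundation_set P A" "refines P A (c ` ?W)" "A \<subseteq> P_fin G P \<theta>"
        using refine by blast
      obtain E where E: "elementary_foundation_set G P \<theta> E" "snd ` E = A"
        using elementary_foundation_set_exists[OF A(1,3)] by blast
      have ES: "finite E" "E \<subseteq> carrier S" using E(1) by (auto simp: elementary_foundation_set_def S_carrier)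
      show ?thesis
      proof (rule elementary_sum_translate[OF B rep ES O[OF E(1)] hm z])
        fix x assume x: "x \<in> E"
        obtain g q where gq: "x = (g, q)" "g \<in> carrier G" "q \<in> carrier P" using x ES(2) by (auto simp: S_carrier)
        have "q \<in> A" using x gq(1) E(2) by force
        then obtain p where p: "p \<in> W" "principal P m \<inter> principal P p \<noteq> {}" "q \<in> principal P (c p)"
          using A(2) unfolding refines_def by blast
        have cp: "c p \<in> carrier P" and cp': "principal P m \<inter> principal P p = principal P (m \<otimes>\<^bsub>P\<^esub> c p)"
          using c[OF p(1,2)] by auto
        \<comment> \<open>The group part of the summand (h, m) x is kept, while q is replaced by the
          coarser \<open>c p\<close>. The element (?h, ?m) is handled by the induction hypothesis
          for \<open>W - {p}\<close>, since m c p is a multiple of p, and the summand lies below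
          it.\<close>
        let ?m = "m \<otimes>\<^bsub>P\<^esub> c p" and ?h = "h \<otimes>\<^bsub>G\<^esub> \<theta> m g"
        have m': "?m \<in> carrier P" and h': "?h \<in> carrier G" using m cp h gq by auto
        have "card (W - {p}) < card W" using W(1) p(1) by (rule card_Diff1_less)
        moreover have "?m \<in> principal P p'" if p': "p' \<in> snd ` ?F - (W - {p})" for p'
        proof (cases "p' = p")
          case True
          have "?m \<in> principal P ?m" by (rule P.self_mem_principal[OF m'])
          then show ?thesis using cp' True by blast
        next
          case False
          then have mp': "m \<in> principal P p'" using below p' by blast
          have "p' \<in> carrier P" using p' fin by (auto simp: P_fin_def)
          then have "principal P m \<subseteq> principal P p'" using P.principal_mono mp' by blast
          moreover have "?m \<in> principal P m" using cp unfolding P.principal_iff by blast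
          ultimately show ?thesis by blast
        qed
        ultimately have zero: "?z \<otimes>\<^bsub>B\<^esub> e (principal S (?h, ?m)) = \<zero>\<^bsub>B\<^esub>"
          using W m' h' by (intro less.hyps[of "W - {p}"]) auto
        have "(h, m) \<otimes>\<^bsub>S\<^esub> x = (?h, m \<otimes>\<^bsub>P\<^esub> q)" by (simp add: gq(1) S_mult)
        moreover have "m \<otimes>\<^bsub>P\<^esub> q \<in> principal P ?m"
          using p(3) cp m by (auto simp: P.principal_iff P.m_assoc)
        then have "(?h, m \<otimes>\<^bsub>P\<^esub> q) \<in> principal S (?h, ?m)"
          using mem_principal_S[OF h' h' m'] coset_self[OF h' m'] by simp
        ultimately show "?z \<otimes>\<^bsub>B\<^esub> e (principal S ((h, m) \<otimes>\<^bsub>S\<^esub> x)) = \<zero>\<^bsub>B\<^esub>"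
          using zero h' m' m gq by (intro smaller[OF zero]) (auto simp: S_carrier)
      qed
    qed
  qed
  \<comment> \<open>With W all second components the condition on m is vacuous, so m may be the
    unit, and the projection of (1, 1) is the unit of \<open>B\<close>.\<close>
  have "?z \<otimes>\<^bsub>B\<^esub> e (principal S \<one>\<^bsub>S\<^esub>) = \<zero>\<^bsub>B\<^esub>"
    unfolding S_one by (rule claim[of "snd ` ?F"]) auto
  moreover have "e (principal S \<one>\<^bsub>S\<^esub>) = \<one>\<^bsub>B\<^esub>" using rep unfolding lcm_rep_def S.principal_one by blast
  ultimately show ?thesis using z by simp
qed

text \<open>Range projections of a representation commute, so the factors over \<open>P_fin\<close>
  can be collected in front. They still come from a foundation set, and their product is already
  zero.\<close>

lemma defect_prod_zero:
  assumes refine: "\<And>F. foundation_set P F \<Longrightarrow> F \<subseteq> P_fin G P \<theta> \<Longrightarrow>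
      \<exists>F'. accurate_foundation_set P F' \<and> refines P F' F \<and> F' \<subseteq> P_fin G P \<theta>"
    and B: "star_algebra B" and rep: "lcm_rep S B v e"
    and O: "\<And>E. elementary_foundation_set G P \<theta> E \<Longrightarrow> \<one>\<^bsub>B\<^esub> = (\<Oplus>\<^bsub>B\<^esub>x\<in>E. e (principal S x))"
    and F: "foundation_set S (set xs)"
  shows "defect_prod B (\<lambda>x. e (principal S x)) xs = \<zero>\<^bsub>B\<^esub>"
proof -
  interpret B: star_algebra B by fact
  interpret S: right_lcm S by (rule S_right_lcm)
  let ?f = "\<lambda>x. e (principal S x)" and ?Q = "\<lambda>x. snd x \<in> P_fin G P \<theta>"
  have sub: "set xs \<subseteq> carrier S" using foundation_set_subset[OF F] .
  have ec: "e (principal S x) \<in> carrier B" if "x \<in> carrier S" for x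
    using S.constructible_ideals_simps(3)[OF that] rep by (simp add: lcm_rep_def)
  have ee: "e (principal S x) \<otimes>\<^bsub>B\<^esub> e (principal S y) = e (principal S y) \<otimes>\<^bsub>B\<^esub> e (principal S x)"
    if "x \<in> carrier S" "y \<in> carrier S" for x y
    using S.constructible_ideals_simps(3)[OF that(1)] S.constructible_ideals_simps(3)[OF that(2)] rep
    by (simp add: lcm_rep_def Int_commute)
  have perm: "defect_prod B ?f ys = defect_prod B ?f (filter ?Q ys) \<otimes>\<^bsub>B\<^esub> defect_prod B ?f (filter (\<lambda>x. \<not> ?Q x) ys)"
    if "set ys \<subseteq> carrier S" for ys
    using that
  proof (induction ys)
    case Nil
    then show ?case by (simp add: defect_prod_def)
  next
    case (Cons y ys)
    let ?a = "defect_prod B ?f (filter ?Q ys)" and ?b = "defect_prod B ?f (filter (\<lambda>x. \<not> ?Q x) ys)"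
    have y: "y \<in> carrier S" and ys: "set ys \<subseteq> carrier S" using Cons.prems by auto
    have ab: "?a \<in> carrier B" "?b \<in> carrier B" using ys ec by (auto intro!: B.defect_prod_closed)
    have fy: "?f y \<in> carrier B" by (rule ec[OF y])
    have IH: "defect_prod B ?f ys = ?a \<otimes>\<^bsub>B\<^esub> ?b" by (rule Cons.IH[OF ys])
    have comm: "?a \<otimes>\<^bsub>B\<^esub> ?f y = ?f y \<otimes>\<^bsub>B\<^esub> ?a"
      using ys by (intro B.defect_prod_commute fy) (auto intro!: ec ee y)
    have "(\<one>\<^bsub>B\<^esub> \<ominus>\<^bsub>B\<^esub> ?f y) \<otimes>\<^bsub>B\<^esub> ?a = ?a \<otimes>\<^bsub>B\<^esub> (\<one>\<^bsub>B\<^esub> \<ominus>\<^bsub>B\<^esub> ?f y)"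
      using ab fy by (simp add: B.l_diff_distr B.r_diff_distr comm)
    then have "(\<one>\<^bsub>B\<^esub> \<ominus>\<^bsub>B\<^esub> ?f y) \<otimes>\<^bsub>B\<^esub> (?a \<otimes>\<^bsub>B\<^esub> ?b) = ?a \<otimes>\<^bsub>B\<^esub> ((\<one>\<^bsub>B\<^esub> \<ominus>\<^bsub>B\<^esub> ?f y) \<otimes>\<^bsub>B\<^esub> ?b)"
      using ab fy by (simp flip: B.m_assoc)
    then show ?case using IH ab fy by (simp add: defect_prod_def B.m_assoc)
  qed
  have "foundation_set S (set (filter ?Q xs))" using foundation_set_P_fin[OF F] by simp
  then have "defect_prod B ?f (filter ?Q xs) = \<zero>\<^bsub>B\<^esub>"
    by (intro defect_prod_P_fin_zero[OF refine B rep O]) auto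
  moreover have "defect_prod B ?f (filter (\<lambda>x. \<not> ?Q x) xs) \<in> carrier B"
    using sub ec by (intro B.defect_prod_closed) auto
  ultimately show ?thesis using perm[OF sub] by simp
qed

end

section \<open>The universal property of the boundary quotient\<close>

theorem proposition4p1:
  fixes G :: "('g, 'm) monoid_scheme" and P :: "('p, 'n) monoid_scheme"
    and \<theta> :: "'p \<Rightarrow> 'g \<Rightarrow> 'g"
  assumes "algebraic_dynamical_system G P \<theta>"
    and "\<And>F. foundation_set P F \<Longrightarrow> F \<subseteq> P_fin G P \<theta> \<Longrightarrow>
      \<exists>F'. accurate_foundation_set P F' \<and> refines P F' F \<and> F' \<subseteq> P_fin G P \<theta>"
  shows "let S = semidirect G P \<theta>; Q = boundary_quotient S;
             ubar = (\<lambda>g. boundary_v S (g, \<one>\<^bsub>P\<^esub>)); sbar = (\<lambda>p. boundary_v S (\<one>\<^bsub>G\<^esub>, p))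
    in cstar_algebra Q \<and>
       A1_A2_O_rep G P \<theta> Q ubar sbar \<and>
       cstar_generated Q (ubar ` carrier G \<union> sbar ` carrier P) = carrier Q \<and>
       (\<forall>(B :: 'b cstar) u s. cstar_algebra B \<longrightarrow> A1_A2_O_rep G P \<theta> B u s \<longrightarrow>
         (\<exists>!\<phi>. \<phi> \<in> star_hom Q B \<and> \<phi> \<in> extensional (carrier Q) \<and>
           (\<forall>g\<in>carrier G. \<phi> (ubar g) = u g) \<and> (\<forall>p\<in>carrier P. \<phi> (sbar p) = s p)))"
proof -
  interpret algebraic_dynamical_system G P \<theta> by fact
  interpret S: right_lcm_cstar S by (intro right_lcm_cstar.intro S_right_lcm)
  define Q where "Q = boundary_quotient S"
  define ubar where "ubar = (\<lambda>g. boundary_v S (g, \<one>\<^bsub>P\<^esub>))"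
  define sbar where "sbar = (\<lambda>p. boundary_v S (\<one>\<^bsub>G\<^esub>, p))"
  have Q: "cstar_algebra Q" unfolding Q_def by (rule S.boundary_quotient_cstar_algebra)
  interpret Q: cstar_algebra Q by (rule Q)
  have Qrep: "A1_A2_O_rep G P \<theta> Q ubar sbar"
    unfolding Q_def ubar_def sbar_def
    by (rule lcm_rep_A1_A2_O[OF S.boundary_quotient_cstar_algebra S.boundary_rep S.boundary_defect])
  have us: "boundary_v S (g, p) = ubar g \<otimes>\<^bsub>Q\<^esub> sbar p" if "g \<in> carrier G" "p \<in> carrier P" for g p
  proof -
    have "(g, \<one>\<^bsub>P\<^esub>) \<in> carrier S" "(\<one>\<^bsub>G\<^esub>, p) \<in> carrier S" using that by (auto simp: S_carrier)
    then have "ubar g \<otimes>\<^bsub>Q\<^esub> sbar p = boundary_v S ((g, \<one>\<^bsub>P\<^esub>) \<otimes>\<^bsub>S\<^esub> (\<one>\<^bsub>G\<^esub>, p))"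
      using S.boundary_rep unfolding lcm_rep_def Q_def ubar_def sbar_def by blast
    then show ?thesis using that by (simp add: S_mult)
  qed
  let ?X = "ubar ` carrier G \<union> sbar ` carrier P"
  have X: "?X \<subseteq> carrier Q"
    using Qrep by (auto simp: A1_A2_O_rep_def unitary_rep_def isometric_rep_def)
  have gen: "cstar_generated Q ?X = carrier Q"
  proof
    show "cstar_generated Q ?X \<subseteq> carrier Q"
      unfolding cstar_generated_def
      using X Q.carrier_is_subring by (intro Inter_lower) (auto simp: norm_closed_def)
    show "carrier Q \<subseteq> cstar_generated Q ?X"
      unfolding cstar_generated_def
    proof (rule Inter_greatest)
      fix D assume "D \<in> {D. subring D Q \<and> (\<forall>c. \<forall>x\<in>D. c \<odot>\<^bsub>Q\<^esub> x \<in> D) \<and>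
        (\<forall>x\<in>D. x\<^sup>\<star>\<^bsub>Q\<^esub> \<in> D) \<and> norm_closed Q D \<and> ?X \<subseteq> D}"
      then have D: "subring D Q" "\<And>c x. x \<in> D \<Longrightarrow> c \<odot>\<^bsub>Q\<^esub> x \<in> D" "\<And>x. x \<in> D \<Longrightarrow> x\<^sup>\<star>\<^bsub>Q\<^esub> \<in> D"
        "norm_closed Q D" "?X \<subseteq> D" by auto
      have "boundary_v S x \<in> D" if xS: "x \<in> carrier S" for x
      proof -
        obtain g p where x: "x = (g, p)" "g \<in> carrier G" "p \<in> carrier P" using xS by (auto simp: S_carrier)
        then have "ubar g \<in> D" "sbar p \<in> D" using D(5) by blast+
        then show ?thesis using x subringE(6)[OF D(1)] by (simp add: us)
      qed
      then show "carrier Q \<subseteq> D"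
        using D(1-4) unfolding Q_def by (intro S.boundary_quotient_generated) auto
    qed
  qed
  have "\<exists>!\<phi>. \<phi> \<in> star_hom Q B \<and> \<phi> \<in> extensional (carrier Q) \<and>
      (\<forall>g\<in>carrier G. \<phi> (ubar g) = u g) \<and> (\<forall>p\<in>carrier P. \<phi> (sbar p) = s p)"
    if B: "cstar_algebra B" and rep: "A1_A2_O_rep G P \<theta> B u s" for B :: "'b cstar" and u s
  proof -
    interpret B: cstar_algebra B by fact
    let ?v = "\<lambda>(g, p). u g \<otimes>\<^bsub>B\<^esub> s p" and ?e = "S.range_projection B (\<lambda>(g, p). u g \<otimes>\<^bsub>B\<^esub> s p)"
    have lcm: "lcm_rep S B ?v ?e" by (rule A1_A2_O_lcm_rep[OF B rep])
    have u: "u g \<in> carrier B" "(u g)\<^sup>\<star>\<^bsub>B\<^esub> \<otimes>\<^bsub>B\<^esub> u g = \<one>\<^bsub>B\<^esub>" if "g \<in> carrier G" for g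
      using rep that by (simp_all add: A1_A2_O_rep_def unitary_rep_def)
    have s: "s p \<in> carrier B" "(s p)\<^sup>\<star>\<^bsub>B\<^esub> \<otimes>\<^bsub>B\<^esub> s p = \<one>\<^bsub>B\<^esub>" if "p \<in> carrier P" for p
      using rep that by (simp_all add: A1_A2_O_rep_def isometric_rep_def)
    have u1: "u \<one>\<^bsub>G\<^esub> = \<one>\<^bsub>B\<^esub>" and s1: "s \<one>\<^bsub>P\<^esub> = \<one>\<^bsub>B\<^esub>"
      using A1_A2_O_rep_one[OF B rep] by auto
    have e: "?e (principal S x) = range_proj B u s (fst x) (snd x)" if xS: "x \<in> carrier S" for x
    proof -
      obtain g p where "x = (g, p)" "g \<in> carrier G" "p \<in> carrier P" using xS by (auto simp: S_carrier)
      then show ?thesis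
        using S.lcm_rep_e[OF B.star_algebra_axioms lcm xS] u s
        by (simp add: range_proj_def B.adj_mult B.m_assoc)
    qed
    have O: "\<one>\<^bsub>B\<^esub> = (\<Oplus>\<^bsub>B\<^esub>x\<in>E. ?e (principal S x))" if E: "elementary_foundation_set G P \<theta> E" for E
    proof -
      have ES: "E \<subseteq> carrier S" using E by (auto simp: elementary_foundation_set_def S_carrier)
      have "\<one>\<^bsub>B\<^esub> = (\<Oplus>\<^bsub>B\<^esub>x\<in>E. range_proj B u s (fst x) (snd x))"
        using rep E by (simp add: A1_A2_O_rep_def rel_O_def)
      also have "\<dots> = (\<Oplus>\<^bsub>B\<^esub>x\<in>E. ?e (principal S x))"
      proof (rule B.finsum_cong'[OF refl])
        have ec: "?e (principal S x) \<in> carrier B" if "x \<in> carrier S" for x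
          using S.constructible_ideals_simps(3)[OF that] lcm unfolding lcm_rep_def by blast
        then show "(\<lambda>x. ?e (principal S x)) \<in> E \<rightarrow> carrier B" using ES by blast
        show "range_proj B u s (fst x) (snd x) = ?e (principal S x)" if "x \<in> E" for x
          using e[of x] that ES by auto
      qed
      finally show ?thesis .
    qed
    have "defect_prod B (\<lambda>x. ?e (principal S x)) xs = \<zero>\<^bsub>B\<^esub>" if "foundation_set S (set xs)" for xs
      by (rule defect_prod_zero[OF assms(2) B.star_algebra_axioms lcm O that])
    then obtain \<psi> where \<psi>: "\<psi> \<in> star_hom Q B" "\<forall>x\<in>carrier S. \<psi> (boundary_v S x) = ?v x"
      using S.boundary_quotient_lift[OF B lcm] unfolding Q_def by blast
    \<comment> \<open>Homomorphisms are functions on a whole type, so uniqueness requires their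
      values off the carrier to be fixed by restriction.\<close>
    let ?\<phi> = "restrict \<psi> (carrier Q)"
    have \<phi>: "?\<phi> \<in> star_hom Q B" by (rule star_hom_restrict[OF \<psi>(1) Q.star_algebra_axioms])
    have \<phi>u: "?\<phi> (ubar g) = u g" if g: "g \<in> carrier G" for g
    proof -
      have "\<psi> (ubar g) = u g \<otimes>\<^bsub>B\<^esub> s \<one>\<^bsub>P\<^esub>" using \<psi>(2) g by (simp add: ubar_def S_carrier)
      then show ?thesis using X g u by (auto simp: s1)
    qed
    have \<phi>s: "?\<phi> (sbar p) = s p" if p: "p \<in> carrier P" for p
    proof -
      have "\<psi> (sbar p) = u \<one>\<^bsub>G\<^esub> \<otimes>\<^bsub>B\<^esub> s p" using \<psi>(2) p by (simp add: sbar_def S_carrier)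
      then show ?thesis using X p s by (auto simp: u1)
    qed
    show ?thesis
    proof (rule ex1I[of _ ?\<phi>])
      show "?\<phi> \<in> star_hom Q B \<and> ?\<phi> \<in> extensional (carrier Q) \<and>
          (\<forall>g\<in>carrier G. ?\<phi> (ubar g) = u g) \<and> (\<forall>p\<in>carrier P. ?\<phi> (sbar p) = s p)"
        using \<phi> \<phi>u \<phi>s by blast
      fix \<chi> assume \<chi>: "\<chi> \<in> star_hom Q B \<and> \<chi> \<in> extensional (carrier Q) \<and>
          (\<forall>g\<in>carrier G. \<chi> (ubar g) = u g) \<and> (\<forall>p\<in>carrier P. \<chi> (sbar p) = s p)"
      have agree: "\<chi> x = ?\<phi> x" if "x \<in> ?X" for x
        using that \<chi> \<phi>u \<phi>s by (elim UnE imageE) (simp_all del: restrict_apply)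
      show "\<chi> = ?\<phi>"
      proof (rule extensionalityI[of _ "carrier Q"])
        fix x assume "x \<in> carrier Q"
        then show "\<chi> x = ?\<phi> x"
          using star_hom_eq_on_generated[OF Q B conjunct1[OF \<chi>] \<phi> X agree] unfolding gen by blast
      qed (use \<chi> in auto)
    qed
  qed
  then show ?thesis
    unfolding Let_def using Q Qrep gen unfolding Q_def ubar_def sbar_def by blast
qed

end
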